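(* Fix $\varepsilon\in(0,1)$, $\alpha\in(0,1/5)$ and $d$ such that $\alpha d\ge 1$. Let $G=(V,E)$ be a graph with no isolated vertices and $V=W\cup B$ (a partition). Suppose $G$ is an $(n,d,\alpha)$-expander. Let $d_{\max}$ be the maximum degree of the induced subgraph $G[W]$, and suppose the minimum degree of $G[W]$ is at least $\ell:=2(\varepsilon+\alpha)d$. Define $\delta=\varepsilon d/(d_{\max}-2\varepsilon d)$. Suppose that \[\frac{8(1+\delta)(d_{\max}+1)}{\delta^2\exp\!\big(\frac{\varepsilon}{40\alpha}\log(1+\delta)\big)}\le 1\qquad\text{and}\qquad \frac{8}{d_{\max}-4\varepsilon d}\le 1.\] Suppose furthermore that: (B1) $|B|\le\alpha n$; (B2) no edge of $G$ has both endpoints in $B$; (B3) every $v\in B$ has $\deg v\le d_{\max}+1$; (B4) every $v\in V$ satisfies $|N(v)\cap B|\le 1$. Then $G$ is globally synchronizing.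
   Context: For a matrix $M$, $\|M\|$ is the spectral norm; $J$ is the $n\times n$ all-ones matrix and $A_G$ the adjacency matrix of $G$. A graph $G=(V,E)$ is an $(n,d,\alpha)$-expander if $|V|=n$ and $\|A_G-\frac dn J\|\le\alpha d$. $N(v)$ is the neighborhood of $v$ in $G$. For a graph $G$ with adjacency matrix $A$, the homogeneous Kuramoto model is the gradient flow $\frac{d\theta}{dt}=-\nabla\mathcal{E}_G(\theta)$ on $(\mathbb{S}^1)^V$ with $\mathcal{E}_G(\theta)=\frac12\sum_{u,v}A_{u,v}(1-\cos(\theta_u-\theta_v))$; $G$ is globally synchronizing if, from a uniformly random initial state, the flow converges with probability one to a fully synchronized state (all $\theta_v$ equal). *)

theory Defs
  imports "HOL-Analysis.Analysis"
begin

text \<open>Graphs on the finite vertex type 'n (so V = UNIV, n = CARD('n)), given by a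
symmetric irreflexive adjacency relation.\<close>

definition simple_graph :: "('n \<Rightarrow> 'n \<Rightarrow> bool) \<Rightarrow> bool" where
  "simple_graph adj \<longleftrightarrow> (\<forall>u v. adj u v \<longleftrightarrow> adj v u) \<and> (\<forall>v. \<not> adj v v)"

definition adj_matrix :: "('n::finite \<Rightarrow> 'n \<Rightarrow> bool) \<Rightarrow> real^'n^'n" where
  "adj_matrix adj = (\<chi> u v. if adj u v then 1 else 0)"

definition ones_matrix :: "real^'n::finite^'n" where
  "ones_matrix = (\<chi> u v. 1)"

definition spectral_norm :: "real^'n::finite^'n \<Rightarrow> real" where
  "spectral_norm M = onorm (\<lambda>x. M *v x)"

definition is_expander :: "('n::finite \<Rightarrow> 'n \<Rightarrow> bool) \<Rightarrow> nat \<Rightarrow> real \<Rightarrow> real \<Rightarrow> bool" where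
  "is_expander adj n d \<alpha> \<longleftrightarrow> CARD('n) = n \<and>
     spectral_norm (adj_matrix adj - (d / real n) *\<^sub>R ones_matrix) \<le> \<alpha> * d"

definition nbhd :: "('n \<Rightarrow> 'n \<Rightarrow> bool) \<Rightarrow> 'n \<Rightarrow> 'n set" where
  "nbhd adj v = {u. adj v u}"

definition degree :: "('n \<Rightarrow> 'n \<Rightarrow> bool) \<Rightarrow> 'n \<Rightarrow> nat" where
  "degree adj v = card (nbhd adj v)"

definition induced_degree :: "('n \<Rightarrow> 'n \<Rightarrow> bool) \<Rightarrow> 'n set \<Rightarrow> 'n \<Rightarrow> nat" where
  "induced_degree adj W v = card (nbhd adj v \<inter> W)"

text \<open>Kuramoto energy E_G(theta) = 1/2 sum_{u,v} A_{uv} (1 - cos(theta_u - theta_v)),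
on the lifted torus R^V (angles taken mod 2 pi).\<close>
definition kuramoto_energy :: "('n::finite \<Rightarrow> 'n \<Rightarrow> bool) \<Rightarrow> real^'n \<Rightarrow> real" where
  "kuramoto_energy adj \<theta> =
     (1/2) * (\<Sum>u\<in>UNIV. \<Sum>v\<in>UNIV. adj_matrix adj $ u $ v * (1 - cos (\<theta> $ u - \<theta> $ v)))"

definition grad :: "(real^'n::finite \<Rightarrow> real) \<Rightarrow> real^'n \<Rightarrow> real^'n" where
  "grad f x = (THE g. (f has_derivative (\<lambda>h. g \<bullet> h)) (at x))"

definition kuramoto_trajectory :: "('n::finite \<Rightarrow> 'n \<Rightarrow> bool) \<Rightarrow> (real \<Rightarrow> real^'n) \<Rightarrow> bool" where
  "kuramoto_trajectory adj \<theta> \<longleftrightarrow>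
     (\<forall>t\<ge>0. (\<theta> has_vector_derivative (- grad (kuramoto_energy adj) (\<theta> t))) (at t within {0..}))"

text \<open>Convergence on the torus (S^1)^V to a fully synchronized state (all phases equal).\<close>
definition converges_to_sync :: "(real \<Rightarrow> real^'n) \<Rightarrow> bool" where
  "converges_to_sync \<theta> \<longleftrightarrow> (\<exists>c::complex. \<forall>v. ((\<lambda>t. cis (\<theta> t $ v)) \<longlongrightarrow> c) at_top)"

text \<open>Globally synchronizing: for a uniformly random initial state in (S^1)^V
(i.e. uniform on [0, 2 pi]^V), with probability one the flow converges to a synchronized state.\<close>
definition globally_synchronizing :: "('n::finite \<Rightarrow> 'n \<Rightarrow> bool) \<Rightarrow> bool" where
  "globally_synchronizing adj \<longleftrightarrow>
     (AE x in uniform_measure lborel (cbox (0::real^'n) (\<chi> v. 2 * pi)).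
        \<forall>\<theta>. \<theta> 0 = x \<and> kuramoto_trajectory adj \<theta> \<longrightarrow> converges_to_sync \<theta>)"

end

theory Submission
  imports Defs
begin

text \<open>
  Three facts are combined. (1) A critical point with positive semidefinite Hessian is synchronized. Testing
  the Hessian against the cosines and the sines shows that the order parameter is large, so all but
  \<open>\<alpha> n\<close> vertices lie within angle \<open>1/4\<close> of the mean phase. The sets of vertices of \<open>W\<close> at angle at least
  \<open>\<psi>\<close> then shrink by a factor \<open>1 + \<delta>\<close> for every increase of \<open>\<psi>\<close> by about \<open>6 \<alpha> / \<epsilon>\<close>, and a Poincare
  inequality for the truncated angle excludes vertices at angle at least 1.
  (2) Every trajectory converges. The length of a curve of steepest descent is at most that of the talweg,
  i.e. of the points where the gradient is smallest on its energy level (D'Acunto and Kurdyka). After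
  penalisation these are minimisers of a polynomial without constraints, whose coordinates satisfy
  polynomial equations over the level, by counting dimensions; so they have bounded variation.
  (3) The initial states of trajectories converging to a strict saddle form a null set: two trajectories
  remaining near the saddle cannot differ by a vector of the unstable cone.
\<close>

section \<open>Stable critical points on expanders\<close>

text \<open>Two features of the energy shape parts (2) and (3). It is invariant under rotations, so
  critical points are never isolated and every Hessian has a kernel. A gradient tending to 0
  therefore does not by itself give convergence, and there are uncountably many saddles: null sets
  of starting points are built for whole neighbourhoods, countably many of which suffice, and the
  Hessian is shifted by a small multiple of the identity to make its form nondegenerate. In cosines
  and sines the energy is a polynomial, so the length bound only needs algebraic functions of one
  variable, the energy level. In part (1) the step size comes from edge counting. Each of two half
  circles costs \<open>3 * \<alpha> * d\<close> edges per vertex, while expansion supplies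
  \<open>2 * \<epsilon> * d\<close>, half of which may be lost; this asks for a sine of at least
  \<open>6 * \<alpha> / \<epsilon>\<close>. The constant 40 in the growth condition lets enough
  steps of that size fit between the angles 1/2 and 1.\<close>

abbreviation adjr :: "('n \<Rightarrow> 'n \<Rightarrow> bool) \<Rightarrow> 'n \<Rightarrow> 'n \<Rightarrow> real" where
  "adjr adj u v \<equiv> (if adj u v then 1 else 0)"

section \<open>Expander mixing and elementary estimates for the sine\<close>

lemma expander_norm_bound:
  fixes adj :: "'n::finite \<Rightarrow> 'n \<Rightarrow> bool" and x :: "'n \<Rightarrow> real"
  assumes "is_expander adj n d \<alpha>" and "\<alpha> * d \<ge> 0"
  shows "(\<Sum>u\<in>UNIV. ((\<Sum>v\<in>UNIV. adjr adj u v * x v) - d / real n * sum x UNIV)\<^sup>2) \<le> (\<alpha> * d)\<^sup>2 * (\<Sum>v\<in>UNIV. (x v)\<^sup>2)"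
proof -
  define M where "M = adj_matrix adj - (d / real n) *\<^sub>R ones_matrix"
  define X where "X = (\<chi> v. x v)"
  have on: "onorm (\<lambda>x. M *v x) \<le> \<alpha> * d"
    using assms(1) by (simp add: is_expander_def spectral_norm_def M_def)
  have "norm (M *v X) \<le> onorm (\<lambda>x. M *v x) * norm X"
    by (rule onorm) (rule matrix_vector_mul_bounded_linear)
  also have "\<dots> \<le> (\<alpha> * d) * norm X" using on by (rule mult_right_mono) simp
  finally have "(norm (M *v X))\<^sup>2 \<le> ((\<alpha> * d) * norm X)\<^sup>2" by (rule power_mono) simp
  moreover have "(norm (M *v X))\<^sup>2 = (\<Sum>u\<in>UNIV. ((\<Sum>v\<in>UNIV. adjr adj u v * x v) - d / real n * sum x UNIV)\<^sup>2)"
  proof -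
    have "(M *v X) $ u = (\<Sum>v\<in>UNIV. adjr adj u v * x v) - d / real n * sum x UNIV" for u
    proof -
      have "(M *v X) $ u = (\<Sum>v\<in>UNIV. adjr adj u v * x v - d / real n * x v)"
        unfolding matrix_vector_mult_def M_def X_def adj_matrix_def ones_matrix_def
        by (auto intro!: sum.cong simp: algebra_simps)
      then show ?thesis by (simp add: sum_subtractf sum_distrib_left)
    qed
    then show ?thesis by (simp add: norm_vec_def L2_set_def sum_nonneg)
  qed
  moreover have "((\<alpha> * d) * norm X)\<^sup>2 = (\<alpha> * d)\<^sup>2 * (\<Sum>v\<in>UNIV. (x v)\<^sup>2)"
    by (simp add: norm_vec_def L2_set_def sum_nonneg X_def power_mult_distrib)
  ultimately show ?thesis by simp
qed

lemma expander_mixing: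
  fixes adj :: "'n::finite \<Rightarrow> 'n \<Rightarrow> bool" and x y :: "'n \<Rightarrow> real"
  assumes "is_expander adj n d \<alpha>" and "\<alpha> * d \<ge> 0"
  shows "\<bar>(\<Sum>u\<in>UNIV. \<Sum>v\<in>UNIV. adjr adj u v * y u * x v) - d / real n * sum y UNIV * sum x UNIV\<bar>
    \<le> \<alpha> * d * sqrt (\<Sum>v\<in>UNIV. (y v)\<^sup>2) * sqrt (\<Sum>v\<in>UNIV. (x v)\<^sup>2)"
proof -
  define z where "z = (\<lambda>u. (\<Sum>v\<in>UNIV. adjr adj u v * x v) - d / real n * sum x UNIV)"
  have "(\<Sum>u\<in>UNIV. \<Sum>v\<in>UNIV. adjr adj u v * y u * x v) - d / real n * sum y UNIV * sum x UNIV
     = (\<Sum>u\<in>UNIV. y u * z u)"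
  proof -
    have "(\<Sum>u\<in>UNIV. y u * z u) = (\<Sum>u\<in>UNIV. (\<Sum>v\<in>UNIV. adjr adj u v * y u * x v) - y u * (d / real n * sum x UNIV))"
      unfolding z_def by (rule sum.cong[OF refl]) (simp add: right_diff_distrib sum_distrib_left mult_ac)
    also have "\<dots> = (\<Sum>u\<in>UNIV. \<Sum>v\<in>UNIV. adjr adj u v * y u * x v) - sum y UNIV * (d / real n * sum x UNIV)"
      unfolding sum_subtractf by (simp only: sum_distrib_right)
    finally show ?thesis by (simp add: mult_ac)
  qed
  moreover have "\<bar>\<Sum>u\<in>UNIV. y u * z u\<bar> \<le> sqrt (\<Sum>v\<in>UNIV. (y v)\<^sup>2) * sqrt (\<Sum>v\<in>UNIV. (z v)\<^sup>2)"
  proof -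
    have "\<bar>\<Sum>u\<in>UNIV. y u * z u\<bar> \<le> (\<Sum>u\<in>UNIV. \<bar>y u\<bar> * \<bar>z u\<bar>)"
      by (rule order_trans[OF sum_abs]) (simp add: abs_mult)
    also have "\<dots> \<le> L2_set y UNIV * L2_set z UNIV" by (rule L2_set_mult_ineq)
    finally show ?thesis by (simp add: L2_set_def)
  qed
  moreover have "sqrt (\<Sum>v\<in>UNIV. (z v)\<^sup>2) \<le> \<alpha> * d * sqrt (\<Sum>v\<in>UNIV. (x v)\<^sup>2)"
  proof -
    have "sqrt (\<Sum>v\<in>UNIV. (z v)\<^sup>2) \<le> sqrt ((\<alpha> * d)\<^sup>2 * (\<Sum>v\<in>UNIV. (x v)\<^sup>2))"
      using expander_norm_bound[OF assms, of x] by (simp add: z_def)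
    then show ?thesis using assms(2) by (simp add: real_sqrt_mult)
  qed
  then have "sqrt (\<Sum>v\<in>UNIV. (y v)\<^sup>2) * sqrt (\<Sum>v\<in>UNIV. (z v)\<^sup>2) \<le> sqrt (\<Sum>v\<in>UNIV. (y v)\<^sup>2) * (\<alpha> * d * sqrt (\<Sum>v\<in>UNIV. (x v)\<^sup>2))"
    by (rule mult_left_mono) (simp add: sum_nonneg)
  ultimately show ?thesis by (simp add: mult_ac)
qed

lemma sin_ge_cubic: "x - x ^ 3 / 6 \<le> sin (x::real)" if "0 \<le> x"
proof -
  have "(\<Sum>m<3. sin_coeff m * x ^ m) = x" by (simp add: eval_nat_numeral sin_coeff_def)
  then have "\<bar>sin x - x\<bar> \<le> inverse 6 * \<bar>x\<bar> ^ 3"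
    using Maclaurin_sin_bound[of x 3] by (simp add: fact_numeral)
  then have "6 * \<bar>sin x - x\<bar> \<le> x ^ 3" using that by simp
  then show ?thesis using abs_ge_minus_self[of "sin x - x"] by argo
qed

text \<open>In \<open>card_far\<close> every far vertex costs at least
  \<open>45/100 * 6/100 = 27/1000\<close> (times \<open>d\<^sup>2\<close>); this is the second
  factor.\<close>

lemma sin_one_quarter: "(6/100::real) \<le> (sin (1/4))\<^sup>2"
proof -
  have "sin (1/4::real) \<ge> 247/1000" using sin_ge_cubic[of "1/4"] by (simp add: power3_eq_cube)
  then have "(247/1000::real)\<^sup>2 \<le> (sin (1/4))\<^sup>2" by (rule power_mono) simp
  then show ?thesis by (simp add: power2_eq_square)
qed

text \<open>Turns the sine of the criticality equation into a quadratic form: \<open>t\<close> is a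
  difference of angles and \<open>h\<close> the difference of the truncated angles, of the same sign
  and no larger. Two angles below 1 differ by at most 2, and there
  \<open>t - t ^ 3 / 6 \<ge> t / 3\<close>.\<close>

lemma mult_sin_ge:
  fixes h t :: real
  assumes "\<bar>t\<bar> \<le> 2" "\<bar>h\<bar> \<le> \<bar>t\<bar>" "h * t \<ge> 0"
  shows "h * sin t \<ge> h\<^sup>2 / 3"
proof -
  have *: "h * sin t \<ge> h\<^sup>2 / 3" if "0 \<le> h" "h \<le> t" "t \<le> 2" for h t :: real
  proof -
    have "t * t \<le> 2 * 2" using that by (intro mult_mono) auto
    then have "t * (t * t) \<le> t * 4" using that by (intro mult_left_mono) auto
    then have "t - t ^ 3 / 6 \<ge> t / 3" by (simp add: power3_eq_cube)
    then have "sin t \<ge> h / 3" using sin_ge_cubic[of t] that by simp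
    then have "h * (h / 3) \<le> h * sin t" using that by (intro mult_left_mono) auto
    then show ?thesis by (simp add: power2_eq_square)
  qed
  consider "0 \<le> h" "0 \<le> t" | "h \<le> 0" "t \<le> 0"
    using assms(2,3) by (smt (verit) mult_neg_pos mult_pos_neg)
  then show ?thesis
  proof cases
    case 1 then show ?thesis using *[of h t] assms by simp
  next
    case 2 then show ?thesis using *[of "-h" "-t"] assms by simp
  qed
qed

text \<open>The hypotheses in real arithmetic: degrees become row sums of a 0/1 matrix, and the
  spectral norm is represented by the estimates \<open>nrm\<close> (images of vectors) and
  \<open>mix\<close> (bilinear form).\<close>

locale partitioned_expander =
  fixes a :: "'n::finite \<Rightarrow> 'n \<Rightarrow> real" and W B :: "'n set" and \<epsilon> \<alpha> d dm N \<delta> :: real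
  assumes eps: "0 < \<epsilon>" "\<epsilon> < 1" and alpha: "0 < \<alpha>" and alpha_d: "\<alpha> * d \<ge> 1"
    and a01: "\<And>u v. a u v = 0 \<or> a u v = 1" and a_sym: "\<And>u v. a u v = a v u"
    and no_iso: "\<And>v. \<exists>u. a v u = 1"
    and part: "W \<union> B = UNIV" "W \<inter> B = {}"
    and N: "N = real CARD('n)"
    and nrm: "\<And>x. (\<Sum>u\<in>UNIV. ((\<Sum>v\<in>UNIV. a u v * x v) - d / N * sum x UNIV)\<^sup>2) \<le> (\<alpha> * d)\<^sup>2 * (\<Sum>v\<in>UNIV. (x v)\<^sup>2)"
    and mix: "\<And>x y. \<bar>(\<Sum>u\<in>UNIV. \<Sum>v\<in>UNIV. a u v * y u * x v) - d / N * sum y UNIV * sum x UNIV\<bar>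
       \<le> \<alpha> * d * sqrt (\<Sum>v\<in>UNIV. (y v)\<^sup>2) * sqrt (\<Sum>v\<in>UNIV. (x v)\<^sup>2)"
    and min_deg: "\<And>v. v \<in> W \<Longrightarrow> 2 * (\<epsilon> + \<alpha>) * d \<le> (\<Sum>u\<in>W. a v u)"
    and max_deg: "\<And>v. v \<in> W \<Longrightarrow> (\<Sum>u\<in>W. a v u) \<le> dm"
    and W_ne: "W \<noteq> {}"
    and B_indep: "\<And>u v. u \<in> B \<Longrightarrow> v \<in> B \<Longrightarrow> a u v = 0"
    and B_deg: "\<And>v. v \<in> B \<Longrightarrow> (\<Sum>u\<in>UNIV. a v u) \<le> dm + 1"
    and B_nbr: "\<And>v. (\<Sum>u\<in>B. a v u) \<le> 1"
    and delta: "\<delta> = \<epsilon> * d / (dm - 2 * \<epsilon> * d)"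
    and growth: "8 * (1 + \<delta>) * (dm + 1) / (\<delta>\<^sup>2 * exp (\<epsilon> / (40 * \<alpha>) * ln (1 + \<delta>))) \<le> 1"
begin

lemma a_nonneg [simp]: "0 \<le> a u v" using a01[of u v] by auto

lemma d_pos: "d > 0" using alpha alpha_d by (smt (verit) mult_nonneg_nonpos)

lemma N_pos: "N > 0" using N by (simp add: card_gt_0_iff)

lemma split_WB: "(\<Sum>u\<in>UNIV. f u) = (\<Sum>u\<in>W. f u) + (\<Sum>u\<in>B. (f u :: real))"
  using part sum.union_disjoint[of W B f] by simp

text \<open>Some vertex of \<open>W\<close> has degree between the lower bound and
  \<open>dm\<close>. This keeps the denominator of \<open>\<delta>\<close> positive, and at least 2
  because \<open>\<alpha> * d \<ge> 1\<close>.\<close>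

lemma D_ge: "dm - 2 * \<epsilon> * d \<ge> 2 * \<alpha> * d"
proof -
  obtain v where "v \<in> W" using W_ne by blast
  then have "2 * (\<epsilon> + \<alpha>) * d \<le> dm" using min_deg max_deg by force
  then show ?thesis by (simp add: algebra_simps)
qed

lemma D_ge_2: "dm - 2 * \<epsilon> * d \<ge> 2" using D_ge alpha_d by simp

lemma delta_pos: "\<delta> > 0" unfolding delta using eps d_pos D_ge_2 by simp

lemma dm_pos: "dm > 0" using D_ge_2 eps d_pos by (smt (verit) mult_pos_pos)

lemma growth': "8 * (1 + \<delta>) * (dm + 1) \<le> \<delta>\<^sup>2 * (1 + \<delta>) powr (\<epsilon> / (40 * \<alpha>))"
proof -
  have "exp (\<epsilon> / (40 * \<alpha>) * ln (1 + \<delta>)) = (1 + \<delta>) powr (\<epsilon> / (40 * \<alpha>))"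
    using delta_pos by (simp add: powr_def)
  moreover have "\<delta>\<^sup>2 * (1 + \<delta>) powr (\<epsilon> / (40 * \<alpha>)) > 0" using delta_pos by simp
  ultimately show ?thesis using growth by (simp add: divide_le_eq)
qed

text \<open>The growth condition forces \<open>\<alpha>\<close> to be small. With an exponent below
  1 it would give \<open>8 * (dm + 1) \<le> \<delta>\<^sup>2\<close>, but then also
  \<open>\<delta> < 20\<close> and \<open>dm \<ge> 4 * \<delta>\<close>, which is
  contradictory.\<close>

lemma eps_alpha: "40 * \<alpha> \<le> \<epsilon>"
proof (rule ccontr)
  assume "\<not> ?thesis"
  then have lt: "\<epsilon> < 40 * \<alpha>" by simp
  then have q: "\<epsilon> / (40 * \<alpha>) < 1" using alpha by simp
  have "(1 + \<delta>) powr (\<epsilon> / (40 * \<alpha>)) \<le> (1 + \<delta>) powr 1"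
    using q delta_pos by (intro powr_mono) auto
  then have "\<delta>\<^sup>2 * (1 + \<delta>) powr (\<epsilon> / (40 * \<alpha>)) \<le> \<delta>\<^sup>2 * (1 + \<delta>)"
    using delta_pos by (intro mult_left_mono) auto
  then have "8 * (1 + \<delta>) * (dm + 1) \<le> \<delta>\<^sup>2 * (1 + \<delta>)" using growth' by linarith
  then have "(8 * (dm + 1)) * (1 + \<delta>) \<le> \<delta>\<^sup>2 * (1 + \<delta>)" by (simp only: mult_ac)
  then have le: "8 * (dm + 1) \<le> \<delta>\<^sup>2" using delta_pos by simp
  define D where "D = dm - 2 * \<epsilon> * d"
  have D: "D \<ge> 2" "D \<ge> 2 * \<alpha> * d" using D_ge_2 D_ge by (auto simp: D_def)
  have dD: "\<delta> * D = \<epsilon> * d" using D by (simp add: delta D_def)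
  have "\<delta> * (2 * \<alpha> * d) \<le> \<delta> * D" using D delta_pos by (intro mult_left_mono) auto
  also have "\<dots> = \<epsilon> * d" by (rule dD)
  also have "\<dots> < 40 * \<alpha> * d" using lt d_pos by (intro mult_strict_right_mono) auto
  finally have "(2 * \<alpha> * d) * \<delta> < (2 * \<alpha> * d) * 20" by simp
  then have d20: "\<delta> < 20" using alpha d_pos by (simp add: mult_less_cancel_left)
  have "\<delta> * 2 \<le> \<delta> * D" using D delta_pos by (intro mult_left_mono) auto
  then have "dm \<ge> 4 * \<delta>" using dD D by (simp add: D_def)
  moreover have "\<delta>\<^sup>2 \<le> 20 * \<delta>" using d20 delta_pos by (simp add: power2_eq_square)
  ultimately show False using le delta_pos by simp
qed

lemma alpha_small: "\<alpha> < 1/40" using eps_alpha eps by simp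

lemma eps_d_ge: "\<epsilon> * d \<ge> 40"
proof -
  have "40 * \<alpha> * d \<le> \<epsilon> * d" using eps_alpha d_pos by (intro mult_right_mono) auto
  then show ?thesis using alpha_d by simp
qed

lemma deg_le: "(\<Sum>u\<in>UNIV. a v u) \<le> dm + 1"
proof (cases "v \<in> W")
  case True
  then show ?thesis using split_WB[of "a v"] max_deg[OF True] B_nbr[of v] by simp
next
  case False
  then show ?thesis using B_deg part by blast
qed

lemma quad_mix: "\<bar>(\<Sum>u\<in>UNIV. \<Sum>v\<in>UNIV. a u v * x u * x v) - d / N * (sum x UNIV)\<^sup>2\<bar> \<le> \<alpha> * d * (\<Sum>v\<in>UNIV. (x v)\<^sup>2)"
  using mix[of x x] by (simp add: power2_eq_square mult.assoc sum_nonneg)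

lemma sum_if_set: "(\<Sum>v\<in>UNIV. (if v \<in> X then f v else 0)) = (\<Sum>v\<in>X. f v :: real)"
  for X :: "'n set"
  by (simp add: sum.If_cases)

lemma inner_edges: "(\<Sum>u\<in>X. \<Sum>v\<in>X. a u v) \<le> (\<alpha> + card X / N) * d * card X"
proof -
  let ?x = "\<lambda>v. if v \<in> X then 1 else (0::real)"
  have "(\<Sum>u\<in>UNIV. \<Sum>v\<in>UNIV. a u v * ?x u * ?x v) = (\<Sum>u\<in>UNIV. if u \<in> X then (\<Sum>v\<in>UNIV. if v \<in> X then a u v else 0) else 0)"
    by (intro sum.cong refl) (auto intro!: sum.cong)
  also have "\<dots> = (\<Sum>u\<in>X. \<Sum>v\<in>X. a u v)" by (simp only: sum_if_set)
  finally have 1: "(\<Sum>u\<in>UNIV. \<Sum>v\<in>UNIV. a u v * ?x u * ?x v) = (\<Sum>u\<in>X. \<Sum>v\<in>X. a u v)" .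
  have 2: "sum ?x UNIV = card X" by (simp add: sum.If_cases)
  have 3: "(\<Sum>v\<in>UNIV. (?x v)\<^sup>2) = card X"
  proof -
    have "(\<Sum>v\<in>UNIV. (?x v)\<^sup>2) = sum ?x UNIV" by (intro sum.cong) auto
    then show ?thesis using 2 by simp
  qed
  have "(\<Sum>u\<in>X. \<Sum>v\<in>X. a u v) \<le> d / N * (real (card X))\<^sup>2 + \<alpha> * d * card X"
    using quad_mix[of ?x] unfolding 1 2 3 by linarith
  also have "\<dots> = (\<alpha> + card X / N) * d * card X" by (simp add: algebra_simps power2_eq_square)
  finally show ?thesis .
qed

lemma inner_edges_small: "(\<Sum>u\<in>X. \<Sum>v\<in>X. a u v) \<le> 2 * \<alpha> * d * card X" if "card X \<le> \<alpha> * N"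
proof -
  have "card X / N \<le> \<alpha>" using that N_pos by (simp add: divide_le_eq)
  then have "(\<alpha> + card X / N) * d * card X \<le> 2 * \<alpha> * d * card X"
    using d_pos by (intro mult_right_mono) auto
  then show ?thesis using inner_edges[of X] by simp
qed

text \<open>Inside a set of density at most \<open>\<alpha>\<close> the average degree is at most
  \<open>2 * \<alpha> * d\<close>, so of the guaranteed
  \<open>2 * (\<epsilon> + \<alpha>) * d\<close> edges per vertex at least
  \<open>2 * \<epsilon> * d\<close> leave on average.\<close>

lemma boundary_edges: "2 * \<epsilon> * d * card X \<le> (\<Sum>v\<in>X. \<Sum>u\<in>W - X. a v u)"
  if X: "X \<subseteq> W" "card X \<le> \<alpha> * N"
proof -
  have "2 * (\<epsilon> + \<alpha>) * d * card X = (\<Sum>v\<in>X. 2 * (\<epsilon> + \<alpha>) * d)" by simp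
  also have "\<dots> \<le> (\<Sum>v\<in>X. \<Sum>u\<in>W. a v u)" using X min_deg by (intro sum_mono) auto
  also have "\<dots> = (\<Sum>v\<in>X. (\<Sum>u\<in>W - X. a v u) + (\<Sum>u\<in>X. a v u))"
    using X(1) by (intro sum.cong refl) (simp add: sum.subset_diff)
  also have "\<dots> = (\<Sum>v\<in>X. \<Sum>u\<in>W - X. a v u) + (\<Sum>v\<in>X. \<Sum>u\<in>X. a v u)" by (rule sum.distrib)
  finally show ?thesis using inner_edges_small[OF X(2)] by (simp add: algebra_simps)
qed

end

text \<open>A stable critical point seen in the frame in which the order parameter, the sum of all
  \<open>cis (\<theta> v)\<close>, is a nonnegative real number.\<close>

locale stable_state = partitioned_expander a W B \<epsilon> \<alpha> d dm N \<delta>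
  for a :: "'n::finite \<Rightarrow> 'n \<Rightarrow> real" and W B \<epsilon> \<alpha> d dm N \<delta> +
  fixes \<theta> :: "'n \<Rightarrow> real"
  assumes range: "\<And>v. \<bar>\<theta> v\<bar> \<le> pi"
    and crit: "\<And>v. (\<Sum>u\<in>UNIV. a v u * sin (\<theta> u - \<theta> v)) = 0"
    and stable: "\<And>h. (\<Sum>u\<in>UNIV. \<Sum>v\<in>UNIV. a u v * cos (\<theta> u - \<theta> v) * (h u - h v)\<^sup>2) \<ge> 0"
    and sum_sin: "(\<Sum>v\<in>UNIV. sin (\<theta> v)) = 0" and sum_cos: "(\<Sum>v\<in>UNIV. cos (\<theta> v)) \<ge> 0"
begin

definition \<Lambda> :: "'n \<Rightarrow> real" where "\<Lambda> v = (\<Sum>u\<in>UNIV. a v u * cos (\<theta> u - \<theta> v))"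

definition far :: "real \<Rightarrow> 'n set" where "far \<psi> = {v. \<psi> \<le> \<bar>\<theta> v\<bar>}"

text \<open>Testing the Hessian against the indicator of \<open>v\<close> gives twice the sum
  \<open>\<Lambda> v\<close> without its diagonal term, and that term is nonnegative.\<close>

lemma \<Lambda>_nonneg: "\<Lambda> v \<ge> 0"
proof -
  let ?h = "\<lambda>u. if u = v then 1 else (0::real)"
  have "(\<Sum>u\<in>UNIV. \<Sum>w\<in>UNIV. a u w * cos (\<theta> u - \<theta> w) * (?h u - ?h w)\<^sup>2)
     = (\<Sum>u\<in>UNIV. \<Sum>w\<in>UNIV. (if u = v then a u w * cos (\<theta> u - \<theta> w) * (1 - ?h w) else 0)
         + (if w = v then a u w * cos (\<theta> u - \<theta> w) * (1 - ?h u) else 0))"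
    by (intro sum.cong refl) auto
  also have "\<dots> = (\<Sum>w\<in>UNIV. a v w * cos (\<theta> v - \<theta> w) * (1 - ?h w)) + (\<Sum>u\<in>UNIV. a u v * cos (\<theta> u - \<theta> v) * (1 - ?h u))"
  proof -
    have "(\<Sum>u\<in>UNIV. \<Sum>w\<in>UNIV. (if u = v then a u w * cos (\<theta> u - \<theta> w) * (1 - ?h w) else 0))
       = (\<Sum>u\<in>UNIV. if u = v then (\<Sum>w\<in>UNIV. a u w * cos (\<theta> u - \<theta> w) * (1 - ?h w)) else 0)"
      by (intro sum.cong refl) auto
    then show ?thesis by (simp add: sum.distrib)
  qed
  also have "(\<Sum>w\<in>UNIV. a v w * cos (\<theta> v - \<theta> w) * (1 - ?h w)) = (\<Sum>u\<in>UNIV. a u v * cos (\<theta> u - \<theta> v) * (1 - ?h u))"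
    using a_sym cos_minus[of "\<theta> _ - \<theta> v"] by (intro sum.cong refl) (metis minus_diff_eq)
  finally have "0 \<le> (\<Sum>u\<in>UNIV. a u v * cos (\<theta> u - \<theta> v) * (1 - ?h u))"
    using stable[of ?h] by linarith
  also have "\<dots> \<le> \<Lambda> v" unfolding \<Lambda>_def
  proof (rule sum_mono)
    fix u show "a u v * cos (\<theta> u - \<theta> v) * (1 - ?h u) \<le> a v u * cos (\<theta> u - \<theta> v)"
      using a_sym[of v u] by auto
  qed
  finally show ?thesis .
qed

text \<open>Criticality removes the component of the neighbours' phase sum orthogonal to
  \<open>cis (\<theta> v)\<close>. The two parts of the resulting complex identity are stated in a
  frame rotated by an arbitrary \<open>\<psi>\<close>.\<close>

lemma nbr_rotate:
  "(\<Sum>u\<in>UNIV. a v u * sin (\<theta> u - \<psi>)) = \<Lambda> v * sin (\<theta> v - \<psi>)"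
  "(\<Sum>u\<in>UNIV. a v u * cos (\<theta> u - \<psi>)) = \<Lambda> v * cos (\<theta> v - \<psi>)"
proof -
  have "(\<Sum>u\<in>UNIV. a v u * sin (\<theta> u - \<psi>))
     = (\<Sum>u\<in>UNIV. a v u * sin (\<theta> u - \<theta> v) * cos (\<theta> v - \<psi>) + a v u * cos (\<theta> u - \<theta> v) * sin (\<theta> v - \<psi>))"
  proof (intro sum.cong refl)
    fix u
    have "sin (\<theta> u - \<psi>) = sin ((\<theta> u - \<theta> v) + (\<theta> v - \<psi>))" by simp
    then show "a v u * sin (\<theta> u - \<psi>) = a v u * sin (\<theta> u - \<theta> v) * cos (\<theta> v - \<psi>) + a v u * cos (\<theta> u - \<theta> v) * sin (\<theta> v - \<psi>)"
      by (simp only: sin_add) (simp add: algebra_simps)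
  qed
  then show "(\<Sum>u\<in>UNIV. a v u * sin (\<theta> u - \<psi>)) = \<Lambda> v * sin (\<theta> v - \<psi>)"
    using crit[of v] by (simp add: sum.distrib \<Lambda>_def flip: sum_distrib_right)
  have "(\<Sum>u\<in>UNIV. a v u * cos (\<theta> u - \<psi>))
     = (\<Sum>u\<in>UNIV. a v u * cos (\<theta> u - \<theta> v) * cos (\<theta> v - \<psi>) - a v u * sin (\<theta> u - \<theta> v) * sin (\<theta> v - \<psi>))"
  proof (intro sum.cong refl)
    fix u
    have "cos (\<theta> u - \<psi>) = cos ((\<theta> u - \<theta> v) + (\<theta> v - \<psi>))" by simp
    then show "a v u * cos (\<theta> u - \<psi>) = a v u * cos (\<theta> u - \<theta> v) * cos (\<theta> v - \<psi>) - a v u * sin (\<theta> u - \<theta> v) * sin (\<theta> v - \<psi>)"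
      by (simp only: cos_add) (simp add: algebra_simps)
  qed
  then show "(\<Sum>u\<in>UNIV. a v u * cos (\<theta> u - \<psi>)) = \<Lambda> v * cos (\<theta> v - \<psi>)"
    using crit[of v] by (simp add: sum_subtractf \<Lambda>_def flip: sum_distrib_right)
qed

text \<open>Since \<open>(cos x - cos y)\<^sup>2 + (sin x - sin y)\<^sup>2 = 2 - 2 * cos (x -
  y)\<close>, the two Hessian tests add up to: the edge sum of the squared cosine is at most the
  edge sum of the cosine. Expansion evaluates both up to \<open>\<alpha> * d * N\<close>: the cosine
  gives \<open>d / N\<close> times the squared order parameter, the squared cosine gives
  \<open>d * N / 2\<close> from its mean.\<close>

lemma order_parameter: "(1/2 - 2 * \<alpha>) * N\<^sup>2 \<le> (\<Sum>v\<in>UNIV. cos (\<theta> v))\<^sup>2"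
proof -
  define C where "C = (\<Sum>v\<in>UNIV. cos (\<theta> v))"
  define Q where "Q = (\<lambda>x :: 'n \<Rightarrow> real. \<Sum>u\<in>UNIV. \<Sum>v\<in>UNIV. a u v * x u * x v)"
  let ?D = "\<lambda>u v. \<theta> u - \<theta> v"
  have "0 \<le> (\<Sum>u\<in>UNIV. \<Sum>v\<in>UNIV. a u v * cos (?D u v) * (cos (\<theta> u) - cos (\<theta> v))\<^sup>2)
      + (\<Sum>u\<in>UNIV. \<Sum>v\<in>UNIV. a u v * cos (?D u v) * (sin (\<theta> u) - sin (\<theta> v))\<^sup>2)"
    using stable[of "\<lambda>u. cos (\<theta> u)"] stable[of "\<lambda>u. sin (\<theta> u)"] by linarith
  also have "\<dots> = (\<Sum>u\<in>UNIV. \<Sum>v\<in>UNIV. 2 * (a u v * cos (?D u v)) - 2 * (a u v * (cos (?D u v))\<^sup>2))"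
  proof -
    have *: "(cos x - cos y)\<^sup>2 + (sin x - sin y)\<^sup>2 = 2 - 2 * cos (x - y)" for x y :: real
    proof -
      have "(cos x - cos y)\<^sup>2 + (sin x - sin y)\<^sup>2 = ((sin x)\<^sup>2 + (cos x)\<^sup>2) + ((sin y)\<^sup>2 + (cos y)\<^sup>2) - 2 * (cos x * cos y + sin x * sin y)"
        by (simp add: power2_eq_square algebra_simps)
      then show ?thesis by (simp add: cos_diff)
    qed
    have "a u v * cos (?D u v) * (cos (\<theta> u) - cos (\<theta> v))\<^sup>2 + a u v * cos (?D u v) * (sin (\<theta> u) - sin (\<theta> v))\<^sup>2
       = 2 * (a u v * cos (?D u v)) - 2 * (a u v * (cos (?D u v))\<^sup>2)" for u v
      unfolding distrib_left[symmetric] * by (simp add: power2_eq_square algebra_simps)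
    then show ?thesis by (simp add: sum.distrib[symmetric])
  qed
  also have "\<dots> = 2 * (\<Sum>u\<in>UNIV. \<Sum>v\<in>UNIV. a u v * cos (?D u v)) - 2 * (\<Sum>u\<in>UNIV. \<Sum>v\<in>UNIV. a u v * (cos (?D u v))\<^sup>2)"
    by (simp add: sum_subtractf sum_distrib_left)
  finally have main: "(\<Sum>u\<in>UNIV. \<Sum>v\<in>UNIV. a u v * (cos (?D u v))\<^sup>2) \<le> (\<Sum>u\<in>UNIV. \<Sum>v\<in>UNIV. a u v * cos (?D u v))"
    by simp
  have one: "(\<Sum>v\<in>UNIV. (cos (f v))\<^sup>2) + (\<Sum>v\<in>UNIV. (sin (f v))\<^sup>2) = N" for f :: "'n \<Rightarrow> real"
    by (simp add: N sum.distrib[symmetric])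
  have l1: "(\<Sum>u\<in>UNIV. \<Sum>v\<in>UNIV. a u v * cos (?D u v)) \<le> d / N * C\<^sup>2 + \<alpha> * d * N"
  proof -
    have "(\<Sum>u\<in>UNIV. \<Sum>v\<in>UNIV. a u v * cos (?D u v)) = Q (\<lambda>u. cos (\<theta> u)) + Q (\<lambda>u. sin (\<theta> u))"
      unfolding Q_def sum.distrib[symmetric] by (intro sum.cong refl) (simp add: cos_diff algebra_simps)
    moreover have "Q (\<lambda>u. cos (\<theta> u)) \<le> d / N * C\<^sup>2 + \<alpha> * d * (\<Sum>v\<in>UNIV. (cos (\<theta> v))\<^sup>2)"
      using quad_mix[of "\<lambda>u. cos (\<theta> u)"] unfolding Q_def C_def by linarith
    moreover have "Q (\<lambda>u. sin (\<theta> u)) \<le> \<alpha> * d * (\<Sum>v\<in>UNIV. (sin (\<theta> v))\<^sup>2)"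
      using quad_mix[of "\<lambda>u. sin (\<theta> u)"] unfolding Q_def sum_sin by simp
    moreover have "\<alpha> * d * (\<Sum>v\<in>UNIV. (cos (\<theta> v))\<^sup>2) + \<alpha> * d * (\<Sum>v\<in>UNIV. (sin (\<theta> v))\<^sup>2) = \<alpha> * d * N"
      using one[of \<theta>] by (simp only: distrib_left[symmetric])
    ultimately show ?thesis by linarith
  qed
  have l2: "(\<Sum>u\<in>UNIV. \<Sum>v\<in>UNIV. a u v * (cos (?D u v))\<^sup>2) \<ge> d * N / 2 - \<alpha> * d * N"
  proof -
    have "(\<Sum>u\<in>UNIV. \<Sum>v\<in>UNIV. a u v * (cos (?D u v))\<^sup>2)
        = (Q (\<lambda>u. 1) + Q (\<lambda>u. cos (2 * \<theta> u)) + Q (\<lambda>u. sin (2 * \<theta> u))) / 2"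
    proof -
      have "a u v * (cos (?D u v))\<^sup>2 = (a u v + a u v * cos (2 * \<theta> u) * cos (2 * \<theta> v) + a u v * sin (2 * \<theta> u) * sin (2 * \<theta> v)) / 2" for u v
      proof -
        have "(cos (?D u v))\<^sup>2 = (1 + cos (2 * ?D u v)) / 2" unfolding cos_double_cos by simp
        also have "cos (2 * ?D u v) = cos (2 * \<theta> u) * cos (2 * \<theta> v) + sin (2 * \<theta> u) * sin (2 * \<theta> v)"
          using cos_diff[of "2 * \<theta> u" "2 * \<theta> v"] by (simp add: right_diff_distrib)
        finally have e: "(cos (?D u v))\<^sup>2 = (1 + (cos (2 * \<theta> u) * cos (2 * \<theta> v) + sin (2 * \<theta> u) * sin (2 * \<theta> v))) / 2" .
        show ?thesis unfolding e by (simp add: algebra_simps)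
      qed
      then have "(\<Sum>u\<in>UNIV. \<Sum>v\<in>UNIV. a u v * (cos (?D u v))\<^sup>2) = (\<Sum>u\<in>UNIV. \<Sum>v\<in>UNIV.
          (a u v * 1 * 1 + a u v * cos (2 * \<theta> u) * cos (2 * \<theta> v) + a u v * sin (2 * \<theta> u) * sin (2 * \<theta> v)) / 2)"
        by (intro sum.cong refl) simp
      then show ?thesis unfolding Q_def by (simp only: sum.distrib sum_divide_distrib[symmetric])
    qed
    moreover have "Q (\<lambda>u. 1) \<ge> d * N - \<alpha> * d * N"
      using quad_mix[of "\<lambda>u. 1"] N_pos N unfolding Q_def by (simp add: power2_eq_square)
    \<comment> \<open>The second harmonic needs only a lower bound: its main term is a multiple of a
      square.\<close>
    moreover have "Q (\<lambda>u. cos (2 * \<theta> u)) \<ge> - (\<alpha> * d * (\<Sum>v\<in>UNIV. (cos (2 * \<theta> v))\<^sup>2))"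
    proof -
      have "d / N * (\<Sum>v\<in>UNIV. cos (2 * \<theta> v))\<^sup>2 \<ge> 0" using d_pos N_pos by simp
      then show ?thesis using abs_le_D2[OF quad_mix[of "\<lambda>u. cos (2 * \<theta> u)"]] unfolding Q_def by argo
    qed
    moreover have "Q (\<lambda>u. sin (2 * \<theta> u)) \<ge> - (\<alpha> * d * (\<Sum>v\<in>UNIV. (sin (2 * \<theta> v))\<^sup>2))"
    proof -
      have "d / N * (\<Sum>v\<in>UNIV. sin (2 * \<theta> v))\<^sup>2 \<ge> 0" using d_pos N_pos by simp
      then show ?thesis using abs_le_D2[OF quad_mix[of "\<lambda>u. sin (2 * \<theta> u)"]] unfolding Q_def by argo
    qed
    moreover have "\<alpha> * d * (\<Sum>v\<in>UNIV. (cos (2 * \<theta> v))\<^sup>2) + \<alpha> * d * (\<Sum>v\<in>UNIV. (sin (2 * \<theta> v))\<^sup>2) = \<alpha> * d * N"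
      using one[of "\<lambda>v. 2 * \<theta> v"] by (simp only: distrib_left[symmetric])
    moreover have "x = (q1 + q2 + q3) / 2 \<Longrightarrow> A - b \<le> q1 \<Longrightarrow> - b1 \<le> q2 \<Longrightarrow> - b2 \<le> q3 \<Longrightarrow> b1 + b2 = b \<Longrightarrow> A / 2 - b \<le> x"
      for x q1 q2 q3 b b1 b2 A :: real by argo
    ultimately show ?thesis by blast
  qed
  have "d * N / 2 - \<alpha> * d * N \<le> d / N * C\<^sup>2 + \<alpha> * d * N" using main l1 l2 by linarith
  then have "d * ((1/2 - 2 * \<alpha>) * N\<^sup>2) \<le> d * C\<^sup>2"
    using N_pos by (simp add: field_simps power2_eq_square)
  then show ?thesis using d_pos by (simp add: C_def)
qed

text \<open>By \<open>nrm\<close> the points \<open>\<Lambda> v * cis (\<theta> v)\<close> are on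
  average within \<open>\<alpha> * d\<close> of the real point \<open>d * \<rho>\<close>. A vertex
  at angle 1/4 or more lies, as \<open>\<Lambda> v \<ge> 0\<close>, on a ray whose distance from
  that point is at least \<open>d * \<rho> * sin (1/4)\<close>, so there are few of them.\<close>

lemma card_far: "card (far (1/4)) \<le> \<alpha> * N"
proof -
  define \<rho> where "\<rho> = (\<Sum>v\<in>UNIV. cos (\<theta> v)) / N"
  have rho0: "\<rho> \<ge> 0" using sum_cos N_pos by (simp add: \<rho>_def)
  have rho2: "\<rho>\<^sup>2 \<ge> 45/100"
  proof -
    have "(1/2 - 2 * \<alpha>) \<le> \<rho>\<^sup>2"
      using order_parameter N_pos by (simp add: \<rho>_def power_divide le_divide_eq)
    then show ?thesis using alpha_small by simp
  qed
  define T where "T = (\<lambda>v. (\<Lambda> v * cos (\<theta> v) - d * \<rho>)\<^sup>2 + (\<Lambda> v * sin (\<theta> v))\<^sup>2)"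
  have "(\<Sum>v\<in>UNIV. (\<Lambda> v * cos (\<theta> v) - d * \<rho>)\<^sup>2) \<le> (\<alpha> * d)\<^sup>2 * (\<Sum>v\<in>UNIV. (cos (\<theta> v))\<^sup>2)"
    using nrm[of "\<lambda>v. cos (\<theta> v)"] nbr_rotate(2)[of _ 0] by (simp add: \<rho>_def)
  moreover have "(\<Sum>v\<in>UNIV. (\<Lambda> v * sin (\<theta> v))\<^sup>2) \<le> (\<alpha> * d)\<^sup>2 * (\<Sum>v\<in>UNIV. (sin (\<theta> v))\<^sup>2)"
    using nrm[of "\<lambda>v. sin (\<theta> v)"] nbr_rotate(1)[of _ 0] sum_sin by simp
  moreover have "(\<alpha> * d)\<^sup>2 * (\<Sum>v\<in>UNIV. (cos (\<theta> v))\<^sup>2) + (\<alpha> * d)\<^sup>2 * (\<Sum>v\<in>UNIV. (sin (\<theta> v))\<^sup>2) = (\<alpha> * d)\<^sup>2 * N"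
    by (simp add: N sum.distrib[symmetric] flip: distrib_left)
  ultimately have upper: "(\<Sum>v\<in>UNIV. T v) \<le> (\<alpha> * d)\<^sup>2 * N"
    unfolding T_def sum.distrib by linarith
  have lower: "T v \<ge> (27/1000) * d\<^sup>2" if "v \<in> far (1/4)" for v
  proof -
    have "cos (\<theta> v) = cos \<bar>\<theta> v\<bar>" by (simp add: abs_if)
    also have "\<dots> \<le> cos (1/4)" using that range[of v] by (intro cos_monotone_0_pi_le) (auto simp: far_def)
    finally have c: "cos (\<theta> v) \<le> cos (1/4)" .
    have "T v = (\<Lambda> v)\<^sup>2 * ((sin (\<theta> v))\<^sup>2 + (cos (\<theta> v))\<^sup>2) - 2 * (\<Lambda> v * (d * \<rho>)) * cos (\<theta> v) + (d * \<rho>)\<^sup>2"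
      unfolding T_def by algebra
    also have "\<dots> \<ge> (\<Lambda> v)\<^sup>2 - 2 * (\<Lambda> v * (d * \<rho>)) * cos (1/4) + (d * \<rho>)\<^sup>2"
      using mult_left_mono[OF c, of "2 * (\<Lambda> v * (d * \<rho>))"] \<Lambda>_nonneg[of v] d_pos rho0 by simp
    also (xtrans) have "(\<Lambda> v)\<^sup>2 - 2 * (\<Lambda> v * (d * \<rho>)) * cos (1/4) + (d * \<rho>)\<^sup>2
       = (\<Lambda> v - d * \<rho> * cos (1/4))\<^sup>2 + (d * \<rho>)\<^sup>2 * (sin (1/4))\<^sup>2"
      unfolding sin_squared_eq by algebra
    also (xtrans) have "\<dots> \<ge> (d * \<rho>)\<^sup>2 * (sin (1/4))\<^sup>2" by simp
    also (xtrans) have "(d * \<rho>)\<^sup>2 * (sin (1/4))\<^sup>2 \<ge> (d\<^sup>2 * (45/100)) * (6/100)"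
      using mult_left_mono[OF rho2, of "d\<^sup>2"] sin_one_quarter
      by (intro mult_mono) (auto simp: power_mult_distrib)
    finally show ?thesis by simp
  qed
  have "card (far (1/4)) * ((27/1000) * d\<^sup>2) = (\<Sum>v\<in>far (1/4). (27/1000) * d\<^sup>2)" by simp
  also have "\<dots> \<le> (\<Sum>v\<in>far (1/4). T v)" using lower by (intro sum_mono) auto
  also have "\<dots> \<le> (\<Sum>v\<in>UNIV. T v)" by (intro sum_mono2) (auto simp: T_def)
  also have "\<dots> \<le> (\<alpha> * d)\<^sup>2 * N" by (rule upper)
  finally have "d\<^sup>2 * (card (far (1/4)) * (27/1000)) \<le> d\<^sup>2 * (\<alpha>\<^sup>2 * N)" by (simp add: power_mult_distrib mult_ac)
  then have "card (far (1/4)) * (27/1000) \<le> \<alpha>\<^sup>2 * N" using d_pos by simp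
  \<comment> \<open>Uses \<open>\<alpha> < 1/40 = 25/1000\<close>.\<close>
  also have "\<alpha>\<^sup>2 * N \<le> (27/1000) * (\<alpha> * N)"
    using alpha_small alpha N_pos mult_right_mono[of \<alpha> "27/1000" "\<alpha> * N"] by (simp add: power2_eq_square mult_ac)
  finally show ?thesis by simp
qed

section \<open>Geometric decay of the sets far from the mean phase\<close>

lemma card_far_W: "card (far \<psi> \<inter> W) \<le> \<alpha> * N" if "1/4 \<le> \<psi>"
proof -
  have "card (far \<psi> \<inter> W) \<le> card (far (1/4))"
    using that by (intro card_mono) (auto simp: far_def)
  then show ?thesis using card_far by linarith
qed

text \<open>The half circle starting at angle \<open>\<psi>\<close>, mirrored when
  \<open>\<sigma> = -1\<close>. Unlike \<open>far\<close> it is given by a half plane, a condition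
  that can be tested on sums of neighbour phases.\<close>

definition beyond :: "real \<Rightarrow> real \<Rightarrow> 'n set" where
  "beyond \<sigma> \<psi> = {v. 0 \<le> sin (\<sigma> * \<theta> v - \<psi>)}"

lemma nbr_beyond:
  assumes "\<sigma> = 1 \<or> \<sigma> = -1" "v \<in> beyond \<sigma> \<psi>"
  shows "0 \<le> (\<Sum>u\<in>UNIV. a v u * sin (\<sigma> * \<theta> u - \<psi>))"
  using assms(1)
proof
  assume s: "\<sigma> = 1"
  then show ?thesis using nbr_rotate(1)[of v \<psi>] \<Lambda>_nonneg[of v] assms(2) by (simp add: beyond_def)
next
  assume s: "\<sigma> = -1"
  have "sin (\<sigma> * t - \<psi>) = - sin (t - (- \<psi>))" for t
  proof -
    have "\<sigma> * t - \<psi> = - (t - (- \<psi>))" using s by simp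
    then show ?thesis by (metis sin_minus)
  qed
  then have "(\<Sum>u\<in>UNIV. a v u * sin (\<sigma> * \<theta> u - \<psi>)) = \<Lambda> v * sin (\<sigma> * \<theta> v - \<psi>)"
    using nbr_rotate(1)[of v "- \<psi>"] by (simp add: sum_negf)
  then show ?thesis using \<Lambda>_nonneg[of v] assms(2) by (simp add: beyond_def)
qed

lemma sin_before_neg:
  assumes "\<bar>t\<bar> < \<psi>" "\<psi> < pi / 2"
  shows "sin (t - \<psi>) < 0"
  using assms sin_gt_zero[of "\<psi> - t"] sin_minus[of "\<psi> - t"] by auto

lemma beyond_subset_far:
  assumes "\<sigma> = 1 \<or> \<sigma> = -1" "\<psi> < pi / 2"
  shows "beyond \<sigma> \<psi> \<subseteq> far \<psi>"
proof
  fix v assume v: "v \<in> beyond \<sigma> \<psi>"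
  show "v \<in> far \<psi>"
  proof (rule ccontr)
    assume "v \<notin> far \<psi>"
    then have "\<bar>\<sigma> * \<theta> v\<bar> < \<psi>" using assms(1) by (auto simp: far_def)
    then show False using sin_before_neg[of "\<sigma> * \<theta> v" \<psi>] assms(2) v by (simp add: beyond_def)
  qed
qed

lemma far_subset_beyond:
  assumes "0 < \<psi>"
  shows "far \<psi> \<subseteq> beyond 1 \<psi> \<union> beyond (-1) \<psi>"
proof
  fix v assume v: "v \<in> far \<psi>"
  show "v \<in> beyond 1 \<psi> \<union> beyond (-1) \<psi>"
  proof (cases "\<theta> v \<ge> 0")
    case True
    then have "0 \<le> sin (\<theta> v - \<psi>)" using v range[of v] assms by (intro sin_ge_zero) (auto simp: far_def)
    then show ?thesis by (simp add: beyond_def)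
  next
    case False
    then have "0 \<le> sin (- \<theta> v - \<psi>)" using v range[of v] assms by (intro sin_ge_zero) (auto simp: far_def)
    then show ?thesis by (simp add: beyond_def)
  qed
qed

text \<open>Since \<open>\<Sum>u. a v u * cis (\<theta> u) = \<Lambda> v * cis (\<theta> v)\<close> with \<open>\<Lambda> v \<ge> 0\<close>, the neighbours of a vertex beyond
  the line at angle \<open>\<psi>\<close> lie beyond that line on average: every neighbour well before the line has to be
  compensated by neighbours beyond it.\<close>

lemma long_edges_at:
  assumes s: "\<sigma> = 1 \<or> \<sigma> = -1" and psi: "0 < \<psi>'" "\<psi>' < \<psi>" "\<psi> < pi / 2" and v: "v \<in> beyond \<sigma> \<psi>"
  shows "sin (\<psi> - \<psi>') * (\<Sum>u\<in>- far \<psi>'. a v u) \<le> (\<Sum>u\<in>beyond \<sigma> \<psi>. a v u)"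
proof -
  \<comment> \<open>Three kinds of neighbours: those beyond the line contribute at most 1 each,
    those before it but in \<open>far \<psi>'\<close> at most 0, and those outside
    \<open>far \<psi>'\<close> at most \<open>- sin (\<psi> - \<psi>')\<close>.\<close>
  have pt: "a v u * sin (\<sigma> * \<theta> u - \<psi>) \<le> (if u \<in> beyond \<sigma> \<psi> then a v u else 0)
      + (if u \<in> - far \<psi>' then - (sin (\<psi> - \<psi>') * a v u) else 0)" for u
  proof (cases "u \<in> beyond \<sigma> \<psi>")
    case True
    then have "u \<in> far \<psi>'" using beyond_subset_far[OF s psi(3)] psi(2) by (auto simp: far_def)
    then show ?thesis using True mult_left_mono[OF sin_le_one[of "\<sigma> * \<theta> u - \<psi>"], of "a v u"] by simp
  next
    case False
    then have neg: "sin (\<sigma> * \<theta> u - \<psi>) < 0" by (simp add: beyond_def)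
    show ?thesis
    proof (cases "u \<in> far \<psi>'")
      case True
      then show ?thesis using False neg by (simp add: mult_nonneg_nonpos)
    next
      case nf: False
      define t where "t = \<sigma> * \<theta> u"
      have t: "\<bar>t\<bar> < \<psi>'" using nf s by (auto simp: far_def t_def)
      \<comment> \<open>The argument \<open>\<psi> - t\<close> lies between
        \<open>\<psi> - \<psi>'\<close> and \<open>\<psi> + \<psi>'\<close>. As
        \<open>\<psi> < pi / 2\<close>, the sine on this range is smallest at the left end; past
        \<open>pi / 2\<close> one reflects.\<close>
      have "sin (\<psi> - \<psi>') \<le> sin (\<psi> - t)"
      proof (cases "\<psi> - t \<le> pi / 2")
        case True
        then show ?thesis using t psi by (intro sin_monotone_2pi_le) auto
      next
        case False
        have "sin (\<psi> - \<psi>') \<le> sin (pi - (\<psi> - t))" using t psi False by (intro sin_monotone_2pi_le) auto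
        then show ?thesis by (simp only: sin_pi_minus)
      qed
      then have "sin (\<sigma> * \<theta> u - \<psi>) \<le> - sin (\<psi> - \<psi>')"
        using sin_minus[of "\<psi> - t"] by (simp add: t_def)
      then have "a v u * sin (\<sigma> * \<theta> u - \<psi>) \<le> a v u * (- sin (\<psi> - \<psi>'))" by (rule mult_left_mono) simp
      then show ?thesis using nf False by (simp add: mult.commute)
    qed
  qed
  have "0 \<le> (\<Sum>u\<in>UNIV. a v u * sin (\<sigma> * \<theta> u - \<psi>))" by (rule nbr_beyond[OF s v])
  also have "\<dots> \<le> (\<Sum>u\<in>UNIV. (if u \<in> beyond \<sigma> \<psi> then a v u else 0)
      + (if u \<in> - far \<psi>' then - (sin (\<psi> - \<psi>') * a v u) else 0))"
    by (intro sum_mono pt)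
  also have "\<dots> = (\<Sum>u\<in>beyond \<sigma> \<psi>. a v u) - sin (\<psi> - \<psi>') * (\<Sum>u\<in>- far \<psi>'. a v u)"
    unfolding sum.distrib sum_if_set by (simp add: sum_negf sum_distrib_left)
  finally show ?thesis by simp
qed

text \<open>Each half circle costs \<open>3 * \<alpha> * d\<close> per vertex:
  \<open>2 * \<alpha> * d\<close> for edges inside the small set and 1 for a possible neighbour in
  \<open>B\<close>, absorbed by \<open>1 \<le> \<alpha> * d\<close>. Two half circles give the
  factor 6.\<close>

lemma long_edges:
  assumes psi: "1/4 \<le> \<psi>'" "\<psi>' < \<psi>" "\<psi> < pi / 2"
  shows "sin (\<psi> - \<psi>') * (\<Sum>v\<in>far \<psi> \<inter> W. \<Sum>u\<in>W - far \<psi>'. a v u) \<le> 6 * \<alpha> * d * card (far \<psi> \<inter> W)"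
proof -
  have sp: "sin (\<psi> - \<psi>') \<ge> 0" using psi by (intro sin_ge_zero) auto
  define g where "g = (\<lambda>v. sin (\<psi> - \<psi>') * (\<Sum>u\<in>W - far \<psi>'. a v u))"
  have g0: "g v \<ge> 0" for v unfolding g_def using sp by (intro mult_nonneg_nonneg sum_nonneg) auto
  have half: "(\<Sum>v\<in>beyond \<sigma> \<psi> \<inter> W. g v) \<le> 3 * \<alpha> * d * card (far \<psi> \<inter> W)" if s: "\<sigma> = 1 \<or> \<sigma> = -1" for \<sigma>
  proof -
    define P where "P = beyond \<sigma> \<psi>"
    have sub: "P \<inter> W \<subseteq> far \<psi> \<inter> W" using beyond_subset_far[OF s psi(3)] by (auto simp: P_def)
    have cP: "card (P \<inter> W) \<le> card (far \<psi> \<inter> W)" by (intro card_mono sub) simp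
    then have cP': "card (P \<inter> W) \<le> \<alpha> * N" using card_far_W[of \<psi>] psi by linarith
    have "(\<Sum>v\<in>P \<inter> W. g v) \<le> (\<Sum>v\<in>P \<inter> W. (\<Sum>u\<in>P \<inter> W. a v u) + 1)"
    proof (rule sum_mono)
      fix v assume v: "v \<in> P \<inter> W"
      have "g v \<le> sin (\<psi> - \<psi>') * (\<Sum>u\<in>- far \<psi>'. a v u)"
        unfolding g_def using sp by (intro mult_left_mono sum_mono2) auto
      also have "\<dots> \<le> (\<Sum>u\<in>P. a v u)" unfolding P_def
        using v psi by (intro long_edges_at s) (auto simp: P_def)
      also have "\<dots> \<le> (\<Sum>u\<in>(P \<inter> W) \<union> B. a v u)" using part by (intro sum_mono2) auto
      also have "\<dots> = (\<Sum>u\<in>P \<inter> W. a v u) + (\<Sum>u\<in>B. a v u)" using part by (intro sum.union_disjoint) auto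
      also have "\<dots> \<le> (\<Sum>u\<in>P \<inter> W. a v u) + 1" using B_nbr[of v] by simp
      finally show "g v \<le> (\<Sum>u\<in>P \<inter> W. a v u) + 1" .
    qed
    also have "\<dots> = (\<Sum>v\<in>P \<inter> W. \<Sum>u\<in>P \<inter> W. a v u) + card (P \<inter> W)" by (simp add: sum.distrib)
    also have "\<dots> \<le> 2 * \<alpha> * d * card (P \<inter> W) + \<alpha> * d * card (P \<inter> W)"
      using inner_edges_small[OF cP'] mult_right_mono[OF alpha_d, of "card (P \<inter> W)"] by simp
    also have "\<dots> = 3 * \<alpha> * d * card (P \<inter> W)" by simp
    also have "\<dots> \<le> 3 * \<alpha> * d * card (far \<psi> \<inter> W)" using cP alpha d_pos by (intro mult_left_mono) auto
    finally show ?thesis by (simp add: P_def)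
  qed
  have "(\<Sum>v\<in>far \<psi> \<inter> W. g v) \<le> (\<Sum>v\<in>(beyond 1 \<psi> \<inter> W) \<union> (beyond (-1) \<psi> \<inter> W). g v)"
    using far_subset_beyond[of \<psi>] psi g0 by (intro sum_mono2) auto
  also have "\<dots> \<le> (\<Sum>v\<in>beyond 1 \<psi> \<inter> W. g v) + (\<Sum>v\<in>beyond (-1) \<psi> \<inter> W. g v)"
    by (subst sum.union_inter[symmetric]) (auto intro!: add_increasing2 sum_nonneg g0)
  also have "\<dots> \<le> 6 * \<alpha> * d * card (far \<psi> \<inter> W)" using half[of 1] half[of "-1"] by simp
  finally show ?thesis by (simp add: g_def sum_distrib_left)
qed

text \<open>If few edges lead from \<open>far \<psi>\<close> directly out of \<open>far \<psi>'\<close>, expansion of \<open>far \<psi>'\<close> forces the ring between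
  them to be large.\<close>

lemma far_growth:
  assumes psi: "1/4 \<le> \<psi>'" "\<psi>' < \<psi>" "\<psi> < pi / 2" and st: "sin (\<psi> - \<psi>') \<ge> 6 * \<alpha> / \<epsilon>"
  shows "(1 + \<delta>) * card (far \<psi> \<inter> W) \<le> card (far \<psi>' \<inter> W)"
proof -
  define S where "S = far \<psi> \<inter> W"
  define S' where "S' = far \<psi>' \<inter> W"
  define R where "R = S' - S"
  have sub: "S \<subseteq> S'" using psi by (auto simp: S_def S'_def far_def)
  have cS': "real (card S') = card S + card R"
    using sub by (simp add: R_def card_Diff_subset card_mono)
  have out: "W - S' = W - far \<psi>'" by (auto simp: S'_def)
  \<comment> \<open>The lower bound on the sine is chosen so that edges jumping over the ring take
    up at most half of the boundary \<open>2 * \<epsilon> * d\<close> per vertex.\<close>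
  have "6 * \<alpha> / \<epsilon> * (\<Sum>v\<in>S. \<Sum>u\<in>W - S'. a v u) \<le> sin (\<psi> - \<psi>') * (\<Sum>v\<in>S. \<Sum>u\<in>W - S'. a v u)"
    using st by (intro mult_right_mono sum_nonneg) auto
  also have "\<dots> \<le> 6 * \<alpha> * d * card S" unfolding out S_def by (rule long_edges[OF psi])
  finally have long: "(\<Sum>v\<in>S. \<Sum>u\<in>W - S'. a v u) \<le> \<epsilon> * d * card S"
    using alpha eps by (simp add: field_simps)
  have ring: "(\<Sum>v\<in>R. \<Sum>u\<in>W - S'. a v u) \<le> dm * card R"
  proof -
    have "(\<Sum>v\<in>R. \<Sum>u\<in>W - S'. a v u) \<le> (\<Sum>v\<in>R. dm)"
    proof (rule sum_mono)
      fix v assume "v \<in> R"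
      then have "v \<in> W" by (auto simp: R_def S'_def)
      then show "(\<Sum>u\<in>W - S'. a v u) \<le> dm"
        using max_deg[of v] sum_mono2[of W "W - S'" "a v"] by force
    qed
    then show ?thesis by (simp add: mult.commute)
  qed
  have "2 * \<epsilon> * d * card S' \<le> (\<Sum>v\<in>S'. \<Sum>u\<in>W - S'. a v u)"
    using card_far_W[OF psi(1)] by (intro boundary_edges) (auto simp: S'_def)
  also have "\<dots> = (\<Sum>v\<in>R. \<Sum>u\<in>W - S'. a v u) + (\<Sum>v\<in>S. \<Sum>u\<in>W - S'. a v u)"
    unfolding R_def using sub by (intro sum.subset_diff) auto
  also have "\<dots> \<le> dm * card R + \<epsilon> * d * card S" using ring long by simp
  \<comment> \<open>The boundary of \<open>S'\<close> counts \<open>2 * \<epsilon> * d\<close> per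
    vertex of both \<open>S\<close> and the ring \<open>R\<close>. What remains is the ratio
    \<open>\<delta>\<close> between the sizes of \<open>R\<close> and \<open>S\<close>.\<close>
  finally have "\<epsilon> * d * card S \<le> (dm - 2 * \<epsilon> * d) * card R"
    unfolding cS' by (simp add: algebra_simps)
  then have "\<delta> * card S \<le> card R"
    using D_ge_2 unfolding delta by (simp add: field_simps)
  then show ?thesis using cS' by (simp add: S_def S'_def algebra_simps)
qed

text \<open>Between the angles 1/2 and 1 there is room for \<open>k\<close> steps of length
  \<open>x = 1 / (2 * k)\<close>. Since \<open>k \<le> 3 * q\<close>, a step has sine at least
  \<open>(9/10) * (1 / (6 * q))\<close>, and the constant 40 in \<open>q\<close> makes this exactly
  \<open>6 * \<alpha> / \<epsilon>\<close>.\<close>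

lemma far_one_small: "8 * (dm + 1) * card (far 1 \<inter> W) \<le> card (far (1/2) \<inter> W)"
proof -
  define q where "q = \<epsilon> / (40 * \<alpha>)"
  have q1: "q \<ge> 1" using eps_alpha alpha by (simp add: q_def)
  define k where "k = nat \<lceil>q\<rceil> + 1"
  have k: "real k \<ge> q + 1" "real k \<le> 3 * q" "k > 0" using q1 unfolding k_def by linarith+
  define x where "x = 1 / (2 * real k)"
  have x: "x > 0" "x \<le> 1/4" "x \<ge> 1 / (6 * q)"
    using k q1 by (auto simp: x_def field_simps)
  have sx: "sin x \<ge> 6 * \<alpha> / \<epsilon>"
  proof -
    have "x * x \<le> (1/4) * (1/4)" using x by (intro mult_mono) auto
    then have "x * (x * x) \<le> x * (1/16)" using x by (intro mult_left_mono) auto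
    then have "x - x ^ 3 / 6 \<ge> (9/10) * x" using x by (simp add: power3_eq_cube)
    then have "sin x \<ge> (9/10) * (1 / (6 * q))" using sin_ge_cubic[of x] x by linarith
    also have "(9/10) * (1 / (6 * q)) = 6 * \<alpha> / \<epsilon>" using alpha eps by (simp add: q_def field_simps)
    finally show ?thesis .
  qed
  have iter: "(1 + \<delta>) ^ i * card (far (1/2 + real i * x) \<inter> W) \<le> card (far (1/2) \<inter> W)" if "i \<le> k" for i
    using that
  proof (induction i)
    case (Suc i)
    have "real (Suc i) * x \<le> real k * x" using Suc.prems x by (intro mult_right_mono) auto
    also have "real k * x = 1/2" using k by (simp add: x_def)
    finally have "1/2 + real (Suc i) * x \<le> 1" by simp
    then have lt: "1/2 + real (Suc i) * x < pi / 2" using pi_gt3 by linarith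
    have "(1 + \<delta>) * card (far (1/2 + real (Suc i) * x) \<inter> W) \<le> card (far (1/2 + real i * x) \<inter> W)"
      by (rule far_growth) (use x sx lt in \<open>auto simp: algebra_simps\<close>)
    then have "(1 + \<delta>) ^ i * ((1 + \<delta>) * card (far (1/2 + real (Suc i) * x) \<inter> W))
       \<le> (1 + \<delta>) ^ i * card (far (1/2 + real i * x) \<inter> W)"
      using delta_pos by (intro mult_left_mono) auto
    also have "\<dots> \<le> card (far (1/2) \<inter> W)" using Suc by simp
    finally show ?case by (simp only: power_Suc mult_ac)
  qed simp
  have "1/2 + real k * x = 1" using k by (simp add: x_def)
  then have it: "(1 + \<delta>) ^ k * card (far 1 \<inter> W) \<le> card (far (1/2) \<inter> W)" using iter[of k] by simp
  \<comment> \<open>The growth condition yields \<open>(1 + \<delta>) powr q\<close> with a factor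
    \<open>\<delta>\<^sup>2 / (1 + \<delta>)\<close>. One additional step,
    \<open>k \<ge> q + 1\<close>, pays for replacing \<open>\<delta>\<^sup>2\<close> by
    \<open>(1 + \<delta>)\<^sup>2\<close>.\<close>
  have "8 * (dm + 1) \<le> (1 + \<delta>) ^ k"
  proof -
    have "8 * (dm + 1) * \<delta>\<^sup>2 \<le> 8 * (dm + 1) * (1 + \<delta>)\<^sup>2"
      using delta_pos dm_pos by (intro mult_left_mono power_mono) auto
    also have "\<dots> = (8 * (1 + \<delta>) * (dm + 1)) * (1 + \<delta>)" unfolding power2_eq_square by (simp only: mult_ac)
    also have "\<dots> \<le> (\<delta>\<^sup>2 * (1 + \<delta>) powr q) * (1 + \<delta>)"
      using growth' delta_pos by (intro mult_right_mono) (auto simp: q_def)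
    also have "\<dots> = \<delta>\<^sup>2 * (1 + \<delta>) powr (q + 1)" using delta_pos by (simp add: powr_add)
    also have "\<dots> \<le> \<delta>\<^sup>2 * (1 + \<delta>) powr (real k)"
      using k delta_pos by (intro mult_left_mono powr_mono) auto
    also have "\<dots> = (1 + \<delta>) ^ k * \<delta>\<^sup>2" using delta_pos by (simp add: powr_realpow)
    finally show ?thesis using delta_pos by simp
  qed
  then have "8 * (dm + 1) * card (far 1 \<inter> W) \<le> (1 + \<delta>) ^ k * card (far 1 \<inter> W)"
    by (intro mult_right_mono) auto
  then show ?thesis using it by linarith
qed

text \<open>If all neighbours of a far vertex of \<open>B\<close> were before the line, their phases
  would sum to a point before it, against \<open>nbr_beyond\<close>. So there is a far neighbour, in
  \<open>W\<close> because \<open>B\<close> is independent; choosing one is injective because no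
  vertex has two neighbours in \<open>B\<close>.\<close>

lemma card_far_B: "card (far \<psi> \<inter> B) \<le> card (far \<psi> \<inter> W)" if psi: "0 < \<psi>" "\<psi> < pi / 2"
proof -
  have "\<exists>u\<in>far \<psi> \<inter> W. a v u = 1" if v: "v \<in> far \<psi> \<inter> B" for v
  proof (rule ccontr)
    assume no: "\<not> ?thesis"
    have nb: "a v u = 0 \<or> \<bar>\<theta> u\<bar> < \<psi>" for u
    proof (cases "u \<in> B")
      case True then show ?thesis using B_indep v by auto
    next
      case False
      then have "u \<in> W" using part by auto
      then show ?thesis using no a01[of v u] by (auto simp: far_def)
    qed
    obtain \<sigma> where s: "\<sigma> = 1 \<or> \<sigma> = -1" "v \<in> beyond \<sigma> \<psi>"
      using far_subset_beyond[OF psi(1)] v by auto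
    have neg: "a v u * sin (\<sigma> * \<theta> u - \<psi>) \<le> 0 \<and> (a v u = 1 \<longrightarrow> a v u * sin (\<sigma> * \<theta> u - \<psi>) < 0)" for u
    proof (cases "a v u = 0")
      case False
      then have "\<bar>\<sigma> * \<theta> u\<bar> < \<psi>" using nb[of u] s(1) by auto
      then show ?thesis using sin_before_neg[OF _ psi(2)] a01[of v u] False by fastforce
    qed simp
    obtain u0 where u0: "a v u0 = 1" using no_iso by blast
    have "(\<Sum>u\<in>UNIV. a v u * sin (\<sigma> * \<theta> u - \<psi>)) < (\<Sum>u\<in>(UNIV :: 'n set). 0)"
    proof (rule sum_strict_mono_ex1)
      show "\<forall>u\<in>UNIV. a v u * sin (\<sigma> * \<theta> u - \<psi>) \<le> 0" using neg by auto
      show "\<exists>u\<in>UNIV. a v u * sin (\<sigma> * \<theta> u - \<psi>) < 0" using neg[of u0] u0 by blast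
    qed simp
    then show False using nbr_beyond[OF s] by simp
  qed
  then obtain f where f: "\<And>v. v \<in> far \<psi> \<inter> B \<Longrightarrow> f v \<in> far \<psi> \<inter> W \<and> a v (f v) = 1" by metis
  have "inj_on f (far \<psi> \<inter> B)"
  proof (rule inj_onI, rule ccontr)
    fix v w assume vw: "v \<in> far \<psi> \<inter> B" "w \<in> far \<psi> \<inter> B" "f v = f w" "v \<noteq> w"
    have "(\<Sum>u\<in>{v, w}. a (f v) u) \<le> (\<Sum>u\<in>B. a (f v) u)" using vw by (intro sum_mono2) auto
    moreover have "(\<Sum>u\<in>{v, w}. a (f v) u) = 2"
      using f[OF vw(1)] f[OF vw(2)] vw a_sym[of "f v"] by simp
    ultimately show False using B_nbr[of "f v"] by simp
  qed
  then show ?thesis using f by (intro card_inj_on_le[of f]) auto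
qed

section \<open>Excluding far vertices by a Poincare inequality\<close>

lemma crit_test: "(\<Sum>v\<in>UNIV. \<Sum>u\<in>UNIV. a v u * ((h u - h v) * sin (\<theta> u - \<theta> v))) = 0"
proof -
  have v0: "(\<Sum>v\<in>UNIV. \<Sum>u\<in>UNIV. h v * (a v u * sin (\<theta> u - \<theta> v))) = 0"
    using crit by (simp flip: sum_distrib_left)
  \<comment> \<open>Summation by parts: exchanging the two indices reverses the sign of the
    sine.\<close>
  have "(\<Sum>v\<in>UNIV. \<Sum>u\<in>UNIV. h u * (a v u * sin (\<theta> u - \<theta> v)))
      = (\<Sum>u\<in>UNIV. \<Sum>v\<in>UNIV. - (h u * (a u v * sin (\<theta> v - \<theta> u))))"
    by (subst sum.swap, intro sum.cong refl)
       (use a_sym sin_minus in \<open>metis minus_diff_eq mult_minus_right\<close>)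
  also have "\<dots> = 0" using v0 by (simp add: sum_negf)
  finally have u0: "(\<Sum>v\<in>UNIV. \<Sum>u\<in>UNIV. h u * (a v u * sin (\<theta> u - \<theta> v))) = 0" .
  have "(\<Sum>v\<in>UNIV. \<Sum>u\<in>UNIV. a v u * ((h u - h v) * sin (\<theta> u - \<theta> v)))
      = (\<Sum>v\<in>UNIV. \<Sum>u\<in>UNIV. h u * (a v u * sin (\<theta> u - \<theta> v)) - h v * (a v u * sin (\<theta> u - \<theta> v)))"
    by (intro sum.cong refl) (simp add: algebra_simps)
  also have "\<dots> = 0" unfolding sum_subtractf using u0 v0 by simp
  finally show ?thesis .
qed

lemma edges_touching: "(\<Sum>v\<in>UNIV. \<Sum>u\<in>UNIV. if u \<in> T \<or> v \<in> T then a v u else 0) \<le> 2 * (dm + 1) * card T"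
proof -
  have "(\<Sum>v\<in>UNIV. \<Sum>u\<in>UNIV. if u \<in> T \<or> v \<in> T then a v u else 0)
     \<le> (\<Sum>v\<in>UNIV. \<Sum>u\<in>UNIV. (if v \<in> T then a v u else 0) + (if u \<in> T then a v u else 0))"
    by (intro sum_mono) auto
  also have "\<dots> = (\<Sum>v\<in>UNIV. \<Sum>u\<in>UNIV. if v \<in> T then a v u else 0) + (\<Sum>u\<in>UNIV. \<Sum>v\<in>UNIV. if u \<in> T then a v u else 0)"
    unfolding sum.distrib by (subst (2) sum.swap) simp
  also have "(\<Sum>u\<in>UNIV. \<Sum>v\<in>UNIV. if u \<in> T then a v u else 0) = (\<Sum>v\<in>UNIV. \<Sum>u\<in>UNIV. if v \<in> T then a v u else 0)"
    using a_sym by (intro sum.cong refl) auto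
  also have "(\<Sum>v\<in>UNIV. \<Sum>u\<in>UNIV. if v \<in> T then a v u else 0) = (\<Sum>v\<in>UNIV. if v \<in> T then (\<Sum>u\<in>UNIV. a v u) else 0)"
    by (intro sum.cong refl) auto
  also have "\<dots> = (\<Sum>v\<in>T. \<Sum>u\<in>UNIV. a v u)" by (rule sum_if_set)
  finally have "(\<Sum>v\<in>UNIV. \<Sum>u\<in>UNIV. if u \<in> T \<or> v \<in> T then a v u else 0) \<le> 2 * (\<Sum>v\<in>T. \<Sum>u\<in>UNIV. a v u)" by simp
  also have "(\<Sum>v\<in>T. \<Sum>u\<in>UNIV. a v u) \<le> (\<Sum>v\<in>T. dm + 1)" by (intro sum_mono deg_le)
  also have "2 * (\<Sum>v\<in>T. dm + 1) = 2 * (dm + 1) * card T" by simp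
  finally show ?thesis by simp
qed

text \<open>Degrees contribute \<open>2 * (\<epsilon> + \<alpha>) * d\<close>, the cross terms at
  most \<open>2 * \<alpha> * d\<close>. Half of the latter is the spectral error; the other half is
  the rank one part, which the small support controls: by Cauchy-Schwarz the squared sum of
  \<open>h\<close> over \<open>W\<close> is at most \<open>\<alpha> * N\<close> times its squared
  norm there.\<close>

lemma poincare:
  assumes supp: "\<And>v. v \<notin> far (1/4) \<Longrightarrow> h v = 0"
  shows "4 * \<epsilon> * d * (\<Sum>v\<in>W. (h v)\<^sup>2) \<le> (\<Sum>v\<in>UNIV. \<Sum>u\<in>UNIV. a v u * (h u - h v)\<^sup>2)"
proof -
  define n2 where "n2 = (\<Sum>v\<in>W. (h v)\<^sup>2)"
  have n20: "n2 \<ge> 0" by (simp add: n2_def sum_nonneg)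
  let ?x = "\<lambda>v. if v \<in> W then h v else 0"
  have 1: "(\<Sum>v\<in>UNIV. \<Sum>u\<in>UNIV. a v u * ?x v * ?x u) = (\<Sum>v\<in>W. \<Sum>u\<in>W. a v u * h v * h u)"
  proof -
    have "(\<Sum>v\<in>UNIV. \<Sum>u\<in>UNIV. a v u * ?x v * ?x u) = (\<Sum>v\<in>UNIV. if v \<in> W then (\<Sum>u\<in>UNIV. if u \<in> W then a v u * h v * h u else 0) else 0)"
      by (intro sum.cong refl) (auto intro!: sum.cong)
    then show ?thesis by (simp only: sum_if_set)
  qed
  have 2: "(\<Sum>v\<in>UNIV. (?x v)\<^sup>2) = n2"
  proof -
    have "(\<Sum>v\<in>UNIV. (?x v)\<^sup>2) = (\<Sum>v\<in>UNIV. if v \<in> W then (h v)\<^sup>2 else 0)" by (intro sum.cong) auto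
    then show ?thesis by (simp only: sum_if_set n2_def)
  qed
  have 3: "(sum ?x UNIV)\<^sup>2 \<le> \<alpha> * N * n2"
  proof -
    have "sum ?x UNIV = (\<Sum>v\<in>far (1/4). ?x v)" using supp by (intro sum.mono_neutral_right) auto
    also have "\<bar>\<dots>\<bar> \<le> (\<Sum>v\<in>far (1/4). \<bar>1\<bar> * \<bar>?x v\<bar>)" by (rule order_trans[OF sum_abs]) simp
    also have "\<dots> \<le> L2_set (\<lambda>_. 1) (far (1/4)) * L2_set ?x (far (1/4))" by (rule L2_set_mult_ineq)
    finally have "(sum ?x UNIV)\<^sup>2 \<le> (L2_set (\<lambda>_. 1) (far (1/4)) * L2_set ?x (far (1/4)))\<^sup>2"
      by (intro abs_le_square_iff[THEN iffD1]) (auto simp: L2_set_nonneg)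
    also have "\<dots> = card (far (1/4)) * (\<Sum>v\<in>far (1/4). (?x v)\<^sup>2)"
      by (simp add: power_mult_distrib L2_set_def sum_nonneg)
    also have "\<dots> \<le> (\<alpha> * N) * (\<Sum>v\<in>UNIV. (?x v)\<^sup>2)"
      using card_far by (intro mult_mono sum_mono2 sum_nonneg) auto
    finally show ?thesis unfolding 2 .
  qed
  have cross: "(\<Sum>v\<in>W. \<Sum>u\<in>W. a v u * h v * h u) \<le> 2 * \<alpha> * d * n2"
  proof -
    have "(\<Sum>v\<in>W. \<Sum>u\<in>W. a v u * h v * h u) \<le> d / N * (sum ?x UNIV)\<^sup>2 + \<alpha> * d * n2"
      using quad_mix[of ?x] unfolding 1 2 by linarith
    moreover have "d / N * (sum ?x UNIV)\<^sup>2 \<le> d / N * (\<alpha> * N * n2)"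
      using 3 d_pos N_pos by (intro mult_left_mono) auto
    moreover have "d / N * (\<alpha> * N * n2) = \<alpha> * d * n2" using N_pos by simp
    ultimately show ?thesis by simp
  qed
  have diag: "2 * (\<epsilon> + \<alpha>) * d * n2 \<le> (\<Sum>v\<in>W. \<Sum>u\<in>W. a v u * (h v)\<^sup>2)"
  proof -
    have "2 * (\<epsilon> + \<alpha>) * d * n2 = (\<Sum>v\<in>W. (2 * (\<epsilon> + \<alpha>) * d) * (h v)\<^sup>2)" by (simp add: n2_def sum_distrib_left)
    also have "\<dots> \<le> (\<Sum>v\<in>W. (\<Sum>u\<in>W. a v u) * (h v)\<^sup>2)"
      using min_deg by (intro sum_mono mult_right_mono) auto
    finally show ?thesis by (simp add: sum_distrib_right)
  qed
  have diag': "(\<Sum>v\<in>W. \<Sum>u\<in>W. a v u * (h u)\<^sup>2) = (\<Sum>v\<in>W. \<Sum>u\<in>W. a v u * (h v)\<^sup>2)"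
    by (subst sum.swap, intro sum.cong refl) (metis a_sym)
  have "(\<Sum>v\<in>W. \<Sum>u\<in>W. a v u * (h u - h v)\<^sup>2)
     = (\<Sum>v\<in>W. \<Sum>u\<in>W. a v u * (h u)\<^sup>2 + a v u * (h v)\<^sup>2 - 2 * (a v u * h v * h u))"
    by (intro sum.cong refl) (simp add: power2_eq_square algebra_simps)
  also have "\<dots> = 2 * (\<Sum>v\<in>W. \<Sum>u\<in>W. a v u * (h v)\<^sup>2) - 2 * (\<Sum>v\<in>W. \<Sum>u\<in>W. a v u * h v * h u)"
    unfolding sum.distrib sum_subtractf diag' by (simp add: sum_distrib_left)
  also have "\<dots> \<ge> 4 * (\<epsilon> + \<alpha>) * d * n2 - 4 * \<alpha> * d * n2" using diag cross by linarith
  also (xtrans) have "4 * (\<epsilon> + \<alpha>) * d * n2 - 4 * \<alpha> * d * n2 = 4 * \<epsilon> * d * n2" by (simp add: algebra_simps)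
  finally have "4 * \<epsilon> * d * n2 \<le> (\<Sum>v\<in>W. \<Sum>u\<in>W. a v u * (h u - h v)\<^sup>2)" .
  also have "\<dots> \<le> (\<Sum>v\<in>UNIV. \<Sum>u\<in>W. a v u * (h u - h v)\<^sup>2)"
    by (intro sum_mono2 sum_nonneg) auto
  also have "\<dots> \<le> (\<Sum>v\<in>UNIV. \<Sum>u\<in>UNIV. a v u * (h u - h v)\<^sup>2)"
    by (intro sum_mono sum_mono2) auto
  finally show ?thesis by (simp add: n2_def)
qed

text \<open>Test criticality against a truncation of the angle supported on the small set \<open>far (1/4)\<close>: the edges
  avoiding \<open>far 1\<close> contribute a Dirichlet form, which expansion bounds below in terms of \<open>far (1/2)\<close>,
  and the others contribute at most \<open>O(dm)\<close> per vertex of the much smaller set \<open>far 1\<close>.\<close>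

lemma far_one_W_empty: "far 1 \<inter> W = {}"
proof (rule ccontr)
  assume ne: "far 1 \<inter> W \<noteq> {}"
  define t where "t = real (card (far 1 \<inter> W))"
  have t: "t > 0" using ne by (simp add: t_def card_gt_0_iff)
  have cT: "card (far 1) \<le> 2 * t"
  proof -
    have "far 1 = (far 1 \<inter> W) \<union> (far 1 \<inter> B)" using part by auto
    then have "card (far 1) \<le> card (far 1 \<inter> W) + card (far 1 \<inter> B)" by (metis card_Un_le)
    also have "\<dots> \<le> card (far 1 \<inter> W) + card (far 1 \<inter> W)" using card_far_B[of 1] pi_gt3 by simp
    finally show ?thesis by (simp add: t_def)
  qed
  \<comment> \<open>Odd and piecewise linear: 0 up to 1/4, slope 1 from 1/4 to 1, then constant 3/4.
    So the test function lives on \<open>far (1/4)\<close>, is at least 1/4 in size on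
    \<open>far (1/2)\<close>, and is never steeper than the angle.\<close>
  define g where "g = (\<lambda>s::real. max (-1) (min 1 s) - max (-1/4) (min (1/4) s))"
  have g_mono: "0 \<le> g r - g s \<and> g r - g s \<le> r - s" if "s \<le> r" for r s
    using that unfolding g_def min_def max_def by auto
  have g_bd: "\<bar>g s\<bar> \<le> 3/4" for s unfolding g_def min_def max_def by auto
  have g_0: "g s = 0" if "\<bar>s\<bar> < 1/4" for s using that unfolding g_def min_def max_def by auto
  have g_big: "1/4 \<le> \<bar>g s\<bar>" if "1/2 \<le> \<bar>s\<bar>" for s using that unfolding g_def min_def max_def by auto
  define h where "h = (\<lambda>v. g (\<theta> v))"
  have gsq: "(g r - g s)\<^sup>2 \<le> 9/4" "\<bar>g r - g s\<bar> \<le> 3/2" for r s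
  proof -
    show "\<bar>g r - g s\<bar> \<le> 3/2" using g_bd[of r] g_bd[of s] by linarith
    then have "\<bar>g r - g s\<bar>\<^sup>2 \<le> (3/2)\<^sup>2" by (rule power_mono) simp
    then show "(g r - g s)\<^sup>2 \<le> 9/4" by (simp add: power2_eq_square)
  qed
  \<comment> \<open>If an angle reaches 1, the left side is at most 3/4 and the product at least
    -3/2; together 9/4.\<close>
  have pt: "(g r - g s)\<^sup>2 / 3 \<le> (g r - g s) * sin (r - s) + (if 1 \<le> \<bar>r\<bar> \<or> 1 \<le> \<bar>s\<bar> then 9/4 else 0)" for r s
  proof (cases "1 \<le> \<bar>r\<bar> \<or> 1 \<le> \<bar>s\<bar>")
    case True
    have "\<bar>(g r - g s) * sin (r - s)\<bar> \<le> (3/2) * 1"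
      unfolding abs_mult using gsq by (intro mult_mono) auto
    then have "- ((g r - g s) * sin (r - s)) \<le> 3/2" by (simp only: abs_le_iff mult_1_right)
    then show ?thesis using gsq(1)[of r s] True by simp
  next
    case False
    have "(g r - g s) * (r - s) \<ge> 0 \<and> \<bar>g r - g s\<bar> \<le> \<bar>r - s\<bar>"
      using g_mono[of r s] g_mono[of s r]
      by (cases "r \<le> s") (auto simp: zero_le_mult_iff)
    then show ?thesis using mult_sin_ge[of "r - s" "g r - g s"] False by auto
  qed
  have "4 * \<epsilon> * d * (\<Sum>v\<in>W. (h v)\<^sup>2) \<le> (\<Sum>v\<in>UNIV. \<Sum>u\<in>UNIV. a v u * (h u - h v)\<^sup>2)"
    by (rule poincare) (auto simp: h_def far_def intro: g_0)
  also have "\<dots> \<le> (\<Sum>v\<in>UNIV. \<Sum>u\<in>UNIV. 3 * (a v u * ((h u - h v) * sin (\<theta> u - \<theta> v)))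
      + (27/4) * (if u \<in> far 1 \<or> v \<in> far 1 then a v u else 0))"
  proof (intro sum_mono)
    fix v u
    have "a v u * ((h u - h v)\<^sup>2 / 3) \<le> a v u * ((h u - h v) * sin (\<theta> u - \<theta> v) + (if 1 \<le> \<bar>\<theta> u\<bar> \<or> 1 \<le> \<bar>\<theta> v\<bar> then 9/4 else 0))"
      unfolding h_def by (intro mult_left_mono pt) simp
    then show "a v u * (h u - h v)\<^sup>2 \<le> 3 * (a v u * ((h u - h v) * sin (\<theta> u - \<theta> v)))
      + (27/4) * (if u \<in> far 1 \<or> v \<in> far 1 then a v u else 0)"
      by (auto simp: far_def algebra_simps)
  qed
  also have "\<dots> = (27/4) * (\<Sum>v\<in>UNIV. \<Sum>u\<in>UNIV. if u \<in> far 1 \<or> v \<in> far 1 then a v u else 0)"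
    unfolding sum.distrib sum_distrib_left[symmetric] crit_test by simp
  also have "\<dots> \<le> (27/4) * (2 * (dm + 1) * card (far 1))"
    by (intro mult_left_mono edges_touching) simp
  also have "\<dots> \<le> (27/4) * (2 * (dm + 1) * (2 * t))"
    using cT dm_pos by (intro mult_left_mono) auto
  also have "\<dots> = 27 * ((dm + 1) * t)" by simp
  finally have up: "4 * (\<epsilon> * d) * (\<Sum>v\<in>W. (h v)\<^sup>2) \<le> 27 * ((dm + 1) * t)" by (simp only: mult.assoc)
  have "(8 * (dm + 1) * t) * (1/16) \<le> card (far (1/2) \<inter> W) * (1/16)"
    using far_one_small by (simp add: t_def)
  also have "\<dots> = (\<Sum>v\<in>far (1/2) \<inter> W. 1/16)" by simp
  also have "\<dots> \<le> (\<Sum>v\<in>far (1/2) \<inter> W. (h v)\<^sup>2)"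
  proof (rule sum_mono)
    fix v assume "v \<in> far (1/2) \<inter> W"
    then have "1/4 \<le> \<bar>h v\<bar>" unfolding h_def by (intro g_big) (simp add: far_def)
    then have "(1/4)\<^sup>2 \<le> \<bar>h v\<bar>\<^sup>2" by (rule power_mono) simp
    then show "1/16 \<le> (h v)\<^sup>2" by (simp add: power2_eq_square)
  qed
  also have "\<dots> \<le> (\<Sum>v\<in>W. (h v)\<^sup>2)" by (intro sum_mono2) auto
  finally have low: "(dm + 1) * t / 2 \<le> (\<Sum>v\<in>W. (h v)\<^sup>2)" by (simp add: algebra_simps)
  have pos: "(dm + 1) * t > 0" using dm_pos t by simp
  \<comment> \<open>In units of \<open>(dm + 1) * t\<close> the Dirichlet form is now at least 80,
    whereas criticality allows at most 27.\<close>
  have "4 * 40 * ((dm + 1) * t / 2) \<le> 4 * (\<epsilon> * d) * (\<Sum>v\<in>W. (h v)\<^sup>2)"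
    using low eps_d_ge pos by (intro mult_mono) auto
  then show False using up pos by linarith
qed

text \<open>Once all angles are below 1, every edge term
  \<open>(\<theta> u - \<theta> v) * sin (\<theta> u - \<theta> v)\<close> is nonnegative, and they
  sum to 0; hence angles agree along edges. Expansion makes \<open>W\<close> connected, and every
  vertex of \<open>B\<close> has a neighbour in \<open>W\<close>.\<close>

lemma all_equal: "\<theta> u = \<theta> v"
proof -
  have "far 1 \<inter> B = {}" using far_one_W_empty card_far_B[of 1] pi_gt3 by simp
  then have "far 1 = {}" using far_one_W_empty part by auto
  then have small: "\<bar>\<theta> v\<bar> < 1" for v by (auto simp: far_def not_le)
  have edge: "\<theta> u = \<theta> v" if "a v u = 1" for u v
  proof -
    have nn: "a v u * ((\<theta> u - \<theta> v) * sin (\<theta> u - \<theta> v)) \<ge> a v u * ((\<theta> u - \<theta> v)\<^sup>2 / 3)" for u v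
      using small[of u] small[of v] by (intro mult_left_mono mult_sin_ge) auto
    have nn0: "a v u * ((\<theta> u - \<theta> v) * sin (\<theta> u - \<theta> v)) \<ge> 0" for u v
      by (rule order_trans[OF _ nn]) simp
    have "(\<Sum>u\<in>UNIV. a v u * ((\<theta> u - \<theta> v) * sin (\<theta> u - \<theta> v))) = 0"
      using crit_test[of \<theta>] nn0 by (subst (asm) sum_nonneg_eq_0_iff) (auto intro: sum_nonneg)
    then have "a v u * ((\<theta> u - \<theta> v) * sin (\<theta> u - \<theta> v)) = 0"
      using nn0 by (subst (asm) sum_nonneg_eq_0_iff) auto
    then have "a v u * ((\<theta> u - \<theta> v)\<^sup>2 / 3) \<le> 0" using nn[of v u] by linarith
    then show ?thesis using that by simp
  qed
  have closed_empty: "X = {}" if X: "X \<subseteq> W" "card X \<le> \<alpha> * N" "\<And>u v. v \<in> X \<Longrightarrow> u \<in> W - X \<Longrightarrow> a v u = 0" for X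
  proof -
    have "2 * \<epsilon> * d * card X \<le> 0" using boundary_edges[OF X(1,2)] X(3) by simp
    then have "real (card X) \<le> 0" using eps d_pos by (simp add: mult_le_0_iff)
    then show ?thesis by simp
  qed
  obtain w where w: "w \<in> W" using W_ne by blast
  define X where "X = {v \<in> W. \<theta> v = \<theta> w}"
  define Y where "Y = W - X"
  have XY: "a v u = 0" if "v \<in> X" "u \<in> Y" for u v
    using that edge[of v u] a01[of v u] by (auto simp: X_def Y_def)
  have Xn: "X \<noteq> {}" using w by (auto simp: X_def)
  have WX: "W - X = Y" "W - Y = X" by (auto simp: X_def Y_def)
  have "Y = {}"
  proof (rule ccontr)
    assume Yn: "Y \<noteq> {}"
    have bX: "card X > \<alpha> * N"
    proof (rule ccontr)
      assume "\<not> ?thesis"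
      then have "X = {}" using XY WX by (intro closed_empty) (auto simp: X_def)
      then show False using Xn by simp
    qed
    have bY: "card Y > \<alpha> * N"
    proof (rule ccontr)
      assume "\<not> ?thesis"
      moreover have "a v u = 0" if "v \<in> Y" "u \<in> X" for u v using XY[OF that(2,1)] a_sym[of u v] by simp
      moreover have "Y \<subseteq> W" by (auto simp: Y_def)
      ultimately have "Y = {}" using closed_empty[of Y] unfolding WX by (metis not_less)
      then show False using Yn by simp
    qed
    \<comment> \<open>Neither part of a disconnection of \<open>W\<close> can be small, by
      \<open>closed_empty\<close>; two parts larger than \<open>\<alpha> * N\<close> without an edge
      between them contradict mixing.\<close>
    let ?x = "\<lambda>v. if v \<in> X then 1 else (0::real)" and ?y = "\<lambda>v. if v \<in> Y then 1 else (0::real)"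
    have "(\<Sum>u\<in>UNIV. \<Sum>v\<in>UNIV. a u v * ?x u * ?y v) = 0"
      using XY by (intro sum.neutral ballI) auto
    moreover have "sum ?x UNIV = card X" "sum ?y UNIV = card Y" by (auto simp: sum.If_cases)
    moreover have "(\<Sum>v\<in>UNIV. (?x v)\<^sup>2) = sum ?x UNIV" "(\<Sum>v\<in>UNIV. (?y v)\<^sup>2) = sum ?y UNIV"
      by (auto intro!: sum.cong)
    ultimately have "d / N * card X * card Y \<le> \<alpha> * d * sqrt (card X) * sqrt (card Y)"
      using mix[of ?x ?y] d_pos N_pos by (simp add: abs_mult)
    also have "\<dots> = \<alpha> * d * sqrt (card X * card Y)" by (simp add: real_sqrt_mult)
    finally have m: "card X * card Y \<le> \<alpha> * N * sqrt (card X * card Y)"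
      using d_pos N_pos by (simp add: field_simps)
    have "(\<alpha> * N) * (\<alpha> * N) < real (card X) * real (card Y)"
      using bX bY alpha N_pos Xn by (intro mult_strict_mono) (auto simp: card_gt_0_iff)
    then have lt: "(\<alpha> * N)\<^sup>2 < real (card X * card Y)" by (simp add: power2_eq_square)
    have sq: "\<alpha> * N < sqrt (card X * card Y)" using lt by (rule real_less_rsqrt)
    have "\<alpha> * N * sqrt (card X * card Y) < sqrt (card X * card Y) * sqrt (card X * card Y)"
      using sq less_trans[OF mult_pos_pos[OF alpha N_pos] sq] by (intro mult_strict_right_mono)
    then show False using m by simp
  qed
  then have Weq: "\<theta> v = \<theta> w" if "v \<in> W" for v using that by (auto simp: Y_def X_def)
  have all: "\<theta> v = \<theta> w" for v
  proof (cases "v \<in> W")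
    case False
    then have vB: "v \<in> B" using part by auto
    obtain u where u: "a v u = 1" using no_iso by blast
    then have "u \<in> W" using B_indep[OF vB, of u] part by force
    then show ?thesis using edge[OF u] Weq by simp
  qed (rule Weq)
  then show ?thesis by metis
qed

end

context partitioned_expander
begin

text \<open>Rotating by the argument of the order parameter and taking angles of absolute value at
  most \<open>pi\<close> puts the state into the frame of \<open>stable_state\<close>. Equality is
  asserted for \<open>cis\<close> because the lifted angles matter only modulo
  \<open>2 * pi\<close>.\<close>

theorem stable_critical_imp_sync:
  fixes \<phi> :: "'n \<Rightarrow> real"
  assumes crit: "\<And>v. (\<Sum>u\<in>UNIV. a v u * sin (\<phi> u - \<phi> v)) = 0"
    and stable: "\<And>h. (\<Sum>u\<in>UNIV. \<Sum>v\<in>UNIV. a u v * cos (\<phi> u - \<phi> v) * (h u - h v)\<^sup>2) \<ge> 0"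
  shows "cis (\<phi> u) = cis (\<phi> v)"
proof -
  define \<rho> where "\<rho> = (\<Sum>v\<in>UNIV. cis (\<phi> v))"
  define \<beta> where "\<beta> = Arg \<rho>"
  have rho: "\<rho> = complex_of_real (cmod \<rho>) * cis \<beta>"
    using rcis_cmod_Arg[of \<rho>] by (simp add: rcis_def \<beta>_def)
  define \<theta> where "\<theta> = (\<lambda>v. Arg (cis (\<phi> v - \<beta>)))"
  have cis: "cis (\<theta> v) = cis (\<phi> v - \<beta>)" for v
    using cis_Arg[of "cis (\<phi> v - \<beta>)"] by (simp add: \<theta>_def)
  have "cis (\<theta> u - \<theta> v) = cis (\<phi> u - \<phi> v)" for u v
    using cis by (simp add: cis_divide[symmetric])
  then have eq: "sin (\<theta> u - \<theta> v) = sin (\<phi> u - \<phi> v)" "cos (\<theta> u - \<theta> v) = cos (\<phi> u - \<phi> v)" for u v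
    by (metis cis.simps)+
  have "(\<Sum>v\<in>UNIV. cis (\<theta> v)) = (\<Sum>v\<in>UNIV. cis (\<phi> v)) * cis (- \<beta>)"
    by (simp add: cis cis_mult sum_distrib_right)
  also have "\<dots> = complex_of_real (cmod \<rho>)"
    unfolding \<rho>_def[symmetric] by (subst rho) (simp add: cis_mult mult.assoc)
  finally have "(\<Sum>v\<in>UNIV. cis (\<theta> v)) = complex_of_real (cmod \<rho>)" .
  then have "Re (\<Sum>v\<in>UNIV. cis (\<theta> v)) = cmod \<rho>" "Im (\<Sum>v\<in>UNIV. cis (\<theta> v)) = 0" by auto
  then have sums: "(\<Sum>v\<in>UNIV. cos (\<theta> v)) = cmod \<rho>" "(\<Sum>v\<in>UNIV. sin (\<theta> v)) = 0"
    by (simp_all add: Re_sum Im_sum)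
  have rng: "\<bar>\<theta> v\<bar> \<le> pi" for v using Arg_bounded[of "cis (\<phi> v - \<beta>)"] by (simp add: \<theta>_def abs_le_iff)
  interpret stable_state a W B \<epsilon> \<alpha> d dm N \<delta> \<theta>
    by unfold_locales (use crit stable sums rng in \<open>auto simp: eq\<close>)
  have "cis (\<phi> u - \<beta>) = cis (\<phi> v - \<beta>)" using all_equal[of u v] cis by metis
  then show ?thesis by (simp add: cis_divide[symmetric])
qed

end

section \<open>Curves converging to strict saddles\<close>

text \<open>Eigenvectors of a symmetric map for different eigenvalues are orthogonal, so there are
  finitely many eigenvalues and some \<open>-c\<close> avoids them. A shift this small keeps a
  direction with Rayleigh quotient \<open>-l\<close> negative.\<close>

lemma exists_shift_injective:
  fixes H :: "'a::euclidean_space \<Rightarrow> 'a"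
  assumes lin: "linear H" and sym: "\<And>x y. H x \<bullet> y = x \<bullet> H y" and l: "0 < (l::real)"
  obtains c where "0 < c" "c < l" "inj (\<lambda>w. H w + c *\<^sub>R w)"
proof -
  let ?E = "\<lambda>c w. w \<noteq> 0 \<and> H w = (-c) *\<^sub>R w"
  have "\<exists>c\<in>{0<..<l}. \<forall>w. \<not> ?E c w"
  proof (rule ccontr)
    assume "\<not> ?thesis"
    then obtain w where w: "\<And>c. c \<in> {0<..<l} \<Longrightarrow> ?E c (w c)" by metis
    have orth: "w a \<bullet> w b = 0" if "a \<in> {0<..<l}" "b \<in> {0<..<l}" "a \<noteq> b" for a b
    proof -
      have "(-a) * (w a \<bullet> w b) = (-b) * (w a \<bullet> w b)"
        using sym[of "w a" "w b"] w[OF that(1)] w[OF that(2)] by simp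
      then show ?thesis using that(3) by simp
    qed
    have inj: "inj_on w {0<..<l}"
    proof (rule inj_onI)
      fix a b assume ab: "a \<in> {0<..<l}" "b \<in> {0<..<l}" "w a = w b"
      show "a = b"
      proof (rule ccontr)
        assume "a \<noteq> b"
        then have "w a \<bullet> w a = 0" using orth[OF ab(1,2)] ab(3) by simp
        then show False using w[OF ab(1)] by simp
      qed
    qed
    have "independent (w ` {0<..<l})"
    proof (rule pairwise_orthogonal_independent)
      show "pairwise orthogonal (w ` {0<..<l})"
        unfolding pairwise_def orthogonal_def using orth by (auto; metis)
      show "0 \<notin> w ` {0<..<l}" using w by auto
    qed
    then have "finite (w ` {0<..<l})" by (rule independent_imp_finite)
    then have "finite {0<..<l}" using inj by (rule finite_imageD)
    then show False using l by (simp add: infinite_Ioo)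
  qed
  then obtain c where c: "0 < c" "c < l" and no: "\<And>w. \<not> ?E c w" by auto
  have "inj (\<lambda>w. H w + c *\<^sub>R w)"
  proof (rule injI)
    fix x y assume "H x + c *\<^sub>R x = H y + c *\<^sub>R y"
    then have "H (x - y) = (-c) *\<^sub>R (x - y)"
      by (simp add: linear_diff[OF lin] algebra_simps)
    then show "x = y" using no[of "x - y"] by auto
  qed
  with c show thesis by (rule that)
qed

text \<open>\<open>V t * exp (- k * t)\<close> is nondecreasing while \<open>V\<close> is positive.
  As the differential inequality is assumed only there, a first time with \<open>V \<le> 0\<close>
  has to be excluded.\<close>

lemma exp_growth:
  fixes V :: "real \<Rightarrow> real"
  assumes der: "\<And>t. t \<ge> 0 \<Longrightarrow> (V has_real_derivative V' t) (at t within {0..})"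
    and grow: "\<And>t. t \<ge> 0 \<Longrightarrow> V t > 0 \<Longrightarrow> V' t \<ge> k * V t"
    and V0: "V 0 > 0" and k: "k \<ge> 0" and t: "t \<ge> 0"
  shows "V t \<ge> V 0 * exp (k * t)"
proof -
  define G where "G = (\<lambda>t. V t * exp (- k * t))"
  have dG: "(G has_real_derivative (V' s - k * V s) * exp (- k * s)) (at s within {0..})" if "s \<ge> 0" for s
    unfolding G_def by (rule derivative_eq_intros der[OF that] refl | simp add: algebra_simps)+
  have contV: "continuous_on {0..} V"
    using der by (auto simp: continuous_on_eq_continuous_within intro!: DERIV_continuous)
  have step: "G b \<ge> G 0" if b: "b \<ge> 0" and pos: "\<And>s. 0 \<le> s \<Longrightarrow> s < b \<Longrightarrow> V s > 0" for b
  proof (cases "b = 0")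
    case False
    with b have "b > 0" by simp
    have cont: "continuous_on {0..b} G"
      unfolding G_def by (intro continuous_intros continuous_on_subset[OF contV]) auto
    have dG': "(G has_real_derivative (V' s - k * V s) * exp (- k * s)) (at s)" if "s > 0" for s
      using dG[of s] at_within_interior[of s "{0..}"] that by simp
    obtain z where z: "0 < z" "z < b" "G b - G 0 = (b - 0) * ((V' z - k * V z) * exp (- k * z))"
    proof -
      obtain l z where "0 < z" "z < b" "DERIV G z :> l" "G b - G 0 = (b - 0) * l"
        using MVT[OF \<open>b > 0\<close> cont] dG' real_differentiable_def by metis
      then show thesis using that dG' DERIV_unique by metis
    qed
    have "V' z - k * V z \<ge> 0" using grow[of z] pos[of z] z by simp
    then show ?thesis using z \<open>b > 0\<close> by (smt (verit) mult_nonneg_nonneg exp_ge_zero)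
  qed simp
  have pos: "V s > 0" if "s \<ge> 0" for s
  proof (rule ccontr)
    assume neg: "\<not> V s > 0"
    define A where "A = {r \<in> {0..}. V r \<le> 0}"
    have cl: "closed A" unfolding A_def
      using continuous_closed_preimage[OF contV, of "{..0}"] by (simp add: vimage_def Int_def)
    have ne: "A \<noteq> {}" "bdd_below A" using neg that by (auto simp: A_def intro: bdd_belowI[of _ 0])
    define b where "b = Inf A"
    have bA: "b \<in> A" unfolding b_def by (rule closed_contains_Inf[OF ne cl])
    have "V r > 0" if "0 \<le> r" "r < b" for r
    proof (rule ccontr)
      assume "\<not> V r > 0"
      then have "r \<in> A" using that by (simp add: A_def)
      then have "b \<le> r" unfolding b_def using ne(2) by (rule cInf_lower)
      then show False using that by simp
    qed
    then have "G b \<ge> G 0" using step[of b] bA by (auto simp: A_def)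
    then have "V b > 0" using V0 by (simp add: G_def) (smt (verit) exp_gt_zero zero_less_mult_pos2)
    then show False using bA by (simp add: A_def)
  qed
  have "G t \<ge> G 0" using step[OF t] pos by blast
  then have "V 0 * exp (k * t) \<le> V t * exp (- k * t) * exp (k * t)" by (simp add: G_def mult_right_mono)
  then show ?thesis by (simp add: mult.assoc flip: exp_add)
qed

definition descent_curve :: "('a::real_normed_vector \<Rightarrow> 'a) \<Rightarrow> (real \<Rightarrow> 'a) \<Rightarrow> bool" where
  "descent_curve F x \<longleftrightarrow> (\<forall>t\<ge>0. (x has_vector_derivative (- F (x t))) (at t within {0..}))"

lemma descent_curve_shift:
  assumes "descent_curve F x" "T \<ge> 0"
  shows "descent_curve F (\<lambda>t. x (t + T))"
  unfolding descent_curve_def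
proof (intro allI impI)
  fix t :: real assume t: "t \<ge> 0"
  have "(x has_vector_derivative (- F (x (t + T)))) (at (t + T) within (\<lambda>s. s + T) ` {0..})"
  proof (rule has_vector_derivative_within_subset)
    show "(x has_vector_derivative (- F (x (t + T)))) (at (t + T) within {0..})"
      using assms t unfolding descent_curve_def by simp
    show "(\<lambda>s. s + T) ` {0..} \<subseteq> {0..}" using assms(2) by auto
  qed
  moreover have "((\<lambda>s. s + T) has_vector_derivative 1) (at t within {0..})"
    by (auto intro!: derivative_eq_intros)
  ultimately have "((x \<circ> (\<lambda>s. s + T)) has_vector_derivative (1 *\<^sub>R (- F (x (t + T))))) (at t within {0..})"
    by (intro vector_diff_chain_within) auto
  then show "((\<lambda>t. x (t + T)) has_vector_derivative - F (x (t + T))) (at t within {0..})"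
    by (simp add: o_def)
qed

text \<open>The quadratic form \<open>w \<mapsto> - w \<bullet> (H w + c w)\<close> grows exponentially along the difference of two
  solutions as long as it is positive and the linearisation at the saddle is accurate.\<close>

lemma unstable_pair:
  fixes F H :: "'a::euclidean_space \<Rightarrow> 'a"
  assumes lin: "linear H" and sym: "\<And>x y. H x \<bullet> y = x \<bullet> H y"
    and low: "\<And>w. \<kappa> * norm w \<le> norm (H w + c *\<^sub>R w)" and kpos: "\<kappa> > 0" and c: "c > 0"
    and upp: "\<And>w. norm (H w + c *\<^sub>R w) \<le> M * norm w" and eta: "\<eta> \<ge> 0" "\<eta> * M \<le> \<kappa>\<^sup>2"
    and near: "\<And>a b. a \<in> U \<Longrightarrow> b \<in> U \<Longrightarrow> norm (F a - F b - H (a - b)) \<le> \<eta> * norm (a - b)"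
    and bdd: "bounded U"
    and x: "descent_curve F x" "\<And>t. t \<ge> 0 \<Longrightarrow> x t \<in> U"
    and y: "descent_curve F y" "\<And>t. t \<ge> 0 \<Longrightarrow> y t \<in> U"
  shows "(x 0 - y 0) \<bullet> (H (x 0 - y 0) + c *\<^sub>R (x 0 - y 0)) \<ge> 0"
proof (rule ccontr)
  assume neg: "\<not> ?thesis"
  define L where "L = (\<lambda>w. H w + c *\<^sub>R w)"
  have linL: "linear L" unfolding L_def
    by (intro linear_compose_add lin linear_scale_self)
  have symL: "L a \<bullet> b = a \<bullet> L b" for a b by (simp add: L_def inner_add_left inner_add_right sym)
  define w where "w = (\<lambda>t. x t - y t)"
  define w' where "w' = (\<lambda>t. - F (x t) - (- F (y t)))"
  have dw: "(w has_vector_derivative w' t) (at t within {0..})" if "t \<ge> 0" for t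
    unfolding w_def w'_def using x(1) y(1) that unfolding descent_curve_def
    by (intro has_vector_derivative_diff) auto
  define V where "V = (\<lambda>t. - (w t \<bullet> L (w t)))"
  define V' where "V' = (\<lambda>t. - 2 * (w' t \<bullet> L (w t)))"
  have dV: "(V has_real_derivative V' t) (at t within {0..})" if "t \<ge> 0" for t
  proof -
    have bl: "bounded_linear L" using linL by (simp add: linear_conv_bounded_linear)
    have "((\<lambda>t. L (w t)) has_vector_derivative L (w' t)) (at t within {0..})"
      using bounded_linear.has_vector_derivative[OF bl dw[OF that]] .
    then have "((\<lambda>t. w t \<bullet> L (w t)) has_vector_derivative (w t \<bullet> L (w' t) + w' t \<bullet> L (w t))) (at t within {0..})"
      using bounded_bilinear.has_vector_derivative[OF bounded_bilinear_inner dw[OF that]] by blast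
    moreover have "w t \<bullet> L (w' t) = w' t \<bullet> L (w t)" by (metis inner_commute symL)
    ultimately have "((\<lambda>t. w t \<bullet> L (w t)) has_real_derivative (2 * (w' t \<bullet> L (w t)))) (at t within {0..})"
      by (simp add: has_real_derivative_iff_has_vector_derivative)
    then show ?thesis unfolding V_def V'_def by (auto intro: derivative_eq_intros)
  qed
  have grow: "V' t \<ge> 2 * c * V t" if t: "t \<ge> 0" for t
  proof -
    define e where "e = F (x t) - F (y t) - H (w t)"
    have e: "norm e \<le> \<eta> * norm (w t)"
      unfolding e_def w_def using near[OF x(2)[OF t] y(2)[OF t]] .
    \<comment> \<open>This gives \<open>V' t = 2 * (e \<bullet> L (w t)) + 2 * (norm (L (w
      t)))\<^sup>2 + 2 * c * V t\<close>. The condition on \<open>\<eta>\<close> bounds the error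
      term by the squared norm, so the first two terms together are nonnegative.\<close>
    have w'e: "w' t = - (e + (L (w t) - c *\<^sub>R w t))" by (simp add: w'_def e_def L_def)
    have "\<bar>e \<bullet> L (w t)\<bar> \<le> norm e * norm (L (w t))" by (rule Cauchy_Schwarz_ineq2)
    also have "\<dots> \<le> (\<eta> * norm (w t)) * (M * norm (w t))"
      by (intro mult_mono e) (use eta upp in \<open>auto simp: L_def\<close>)
    also have "\<dots> = (\<eta> * M) * (norm (w t))\<^sup>2" by (simp add: power2_eq_square)
    also have "\<dots> \<le> \<kappa>\<^sup>2 * (norm (w t))\<^sup>2" using eta by (simp add: mult_right_mono)
    also have "\<dots> = (\<kappa> * norm (w t))\<^sup>2" by (simp add: power_mult_distrib)
    also have "\<dots> \<le> (norm (L (w t)))\<^sup>2" using low[of "w t"] kpos by (intro power_mono) (auto simp: L_def)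
    finally have "- (L (w t) \<bullet> L (w t)) \<le> e \<bullet> L (w t)"
      by (simp add: power2_norm_eq_inner)
    then show ?thesis
      unfolding V'_def V_def w'e by (simp add: inner_add_left inner_diff_left)
  qed
  have V0: "V 0 > 0" using neg by (simp add: V_def L_def w_def)
  have Vt: "V t \<ge> V 0 * exp (2 * c * t)" if "t \<ge> 0" for t
    by (rule exp_growth[OF dV _ V0 _ that]) (use grow c in auto)
  obtain R where R: "\<And>u. u \<in> U \<Longrightarrow> norm u \<le> R" using bdd by (auto simp: bounded_iff)
  have M: "M \<ge> 0"
  proof -
    have "w 0 \<noteq> 0" using V0 by (auto simp: V_def)
    then show ?thesis using upp[of "w 0"] by (smt (verit) norm_ge_zero mult_neg_pos zero_less_norm_iff)
  qed
  have Vb: "V t \<le> (2 * R) * (M * (2 * R))" if "t \<ge> 0" for t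
  proof -
    have n: "norm (w t) \<le> 2 * R"
      using R[OF x(2)[OF that]] R[OF y(2)[OF that]] norm_triangle_ineq4[of "x t" "y t"] by (simp add: w_def)
    have "V t \<le> norm (w t) * norm (L (w t))"
      unfolding V_def using Cauchy_Schwarz_ineq2[of "w t" "L (w t)"] by linarith
    also have "\<dots> \<le> (2 * R) * (M * (2 * R))"
    proof (intro mult_mono n)
      have "M * norm (w t) \<le> M * (2 * R)" using n M by (rule mult_left_mono)
      then show "norm (L (w t)) \<le> M * (2 * R)" using upp[of "w t"] by (simp add: L_def)
    qed (use n norm_ge_zero[of "w t"] in linarith, simp)
    finally show ?thesis .
  qed
  define B where "B = (2 * R) * (M * (2 * R))"
  have "exp (2 * c * t) \<le> B / V 0" if "t \<ge> 0" for t
    using Vt[OF that] Vb[OF that] V0 by (simp add: B_def field_simps)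
  \<comment> \<open>At this time the exponential bound reads \<open>exp y \<le> B / V 0\<close> with
    \<open>y = \<bar>B / V 0\<bar>\<close>, contradicting \<open>exp y \<ge> 1 + y\<close>.\<close>
  from this[of "\<bar>B / V 0\<bar> / (2 * c)"] have "exp \<bar>B / V 0\<bar> \<le> B / V 0" using c by simp
  then show False
    using exp_ge_add_one_self[of "\<bar>B / V 0\<bar>"] abs_ge_self[of "B / V 0"] by linarith
qed

text \<open>Translates along \<open>e\<close> by different amounts are disjoint, since a common
  point would give a chord parallel to \<open>e\<close>. With steps \<open>e / N\<close>,
  \<open>N\<close> translates fit into one ball whose size does not depend on \<open>N\<close>. The
  chord condition is closed, so it passes to the closure, which is compact and hence
  measurable.\<close>

lemma negligible_if_no_chord_in_cone:
  fixes S :: "'a::euclidean_space set"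
  assumes bdd: "bounded S" and L: "linear L" and e: "e \<bullet> L e < 0"
    and S: "\<And>x y. x \<in> S \<Longrightarrow> y \<in> S \<Longrightarrow> (x - y) \<bullet> L (x - y) \<ge> 0"
  shows "negligible S"
proof -
  define K where "K = closure S"
  have contL: "continuous_on UNIV L" using L linear_continuous_on linear_conv_bounded_linear by blast
  have K: "(x - y) \<bullet> L (x - y) \<ge> 0" if "x \<in> K" "y \<in> K" for x y
  proof -
    have "(x, y) \<in> closure (S \<times> S)" using that by (simp add: K_def closure_Times)
    moreover have "continuous_on (closure (S \<times> S)) (\<lambda>p. (fst p - snd p) \<bullet> L (fst p - snd p))"
      by (intro continuous_intros continuous_on_compose2[OF contL]) auto
    ultimately show ?thesis
      using continuous_ge_on_closure[of "S \<times> S" "\<lambda>p. (fst p - snd p) \<bullet> L (fst p - snd p)" "(x, y)" 0] S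
      by auto
  qed
  have cK: "compact K" using bdd by (simp add: K_def compact_closure)
  then have mK: "K \<in> lmeasurable" by (rule lmeasurable_compact)
  obtain R where R: "\<And>u. u \<in> K \<Longrightarrow> norm u \<le> R" using compact_imp_bounded[OF cK] by (auto simp: bounded_iff)
  define b where "b = measure lebesgue (cball (0::'a) (R + norm e))"
  have bound: "real N * measure lebesgue K \<le> b" for N :: nat
  proof -
    define G where "G = (\<lambda>i. (+) ((real i / real N) *\<^sub>R e) ` K)"
    have disj: "pairwise (\<lambda>i j. disjnt (G i) (G j)) {..<N}"
    proof (clarsimp simp: pairwise_def disjnt_def G_def)
      fix i j :: nat assume ij: "i < N" "j < N" "i \<noteq> j"
      show "(+) ((real i / real N) *\<^sub>R e) ` K \<inter> (+) ((real j / real N) *\<^sub>R e) ` K = {}"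
      proof (rule ccontr)
        assume "\<not> ?thesis"
        then obtain x y where xy: "x \<in> K" "y \<in> K" "(real i / real N) *\<^sub>R e + x = (real j / real N) *\<^sub>R e + y" by auto
        then have d: "x - y = (real j / real N - real i / real N) *\<^sub>R e"
          by (simp add: algebra_simps)
        define r where "r = real j / real N - real i / real N"
        have "r \<noteq> 0" using ij by (simp add: r_def field_simps)
        have "(x - y) \<bullet> L (x - y) = r\<^sup>2 * (e \<bullet> L e)"
          unfolding d r_def[symmetric] by (simp add: linear_cmul[OF L] power2_eq_square)
        also have "\<dots> < 0" using \<open>r \<noteq> 0\<close> e by (simp add: mult_pos_neg)
        finally show False using K[OF xy(1,2)] by simp
      qed
    qed
    have mG: "G i \<in> lmeasurable" for i
      unfolding G_def by (intro lmeasurable_compact compact_translation cK)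
    have sub: "(\<Union>i<N. G i) \<subseteq> cball 0 (R + norm e)"
    proof (clarsimp simp: G_def)
      fix i u assume i: "i < N" and u: "u \<in> K"
      have "norm ((real i / real N) *\<^sub>R e + u) \<le> norm ((real i / real N) *\<^sub>R e) + norm u" by (rule norm_triangle_ineq)
      also have "norm ((real i / real N) *\<^sub>R e) \<le> norm e"
        using mult_left_le_one_le[of "norm e" "real i / real N"] i by simp
      finally show "norm ((real i / real N) *\<^sub>R e + u) \<le> R + norm e" using R[OF u] by simp
    qed
    have "real N * measure lebesgue K = (\<Sum>i<N. measure lebesgue (G i))"
      by (simp add: G_def measure_translation)
    also have "\<dots> = measure lebesgue (\<Union>i<N. G i)"
      by (rule measure_UNION'[symmetric]) (use mG disj in auto)
    also have "\<dots> \<le> b" unfolding b_def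
      by (intro measure_mono_fmeasurable sub) (use mG in auto)
    finally show ?thesis .
  qed
  have "measure lebesgue K = 0"
  proof (rule ccontr)
    assume "\<not> ?thesis"
    then have "measure lebesgue K > 0" by (simp add: zero_less_measure_iff)
    then obtain N where "real N * measure lebesgue K > b" using reals_Archimedean3 by blast
    then show False using bound[of N] by simp
  qed
  then have "negligible K" using mK by (simp add: negligible_iff_measure)
  then show ?thesis using closure_subset by (auto simp: K_def intro: negligible_subset)
qed

text \<open>The squared distance times \<open>exp (2 * L * t)\<close> is nondecreasing. Thus the
  state at time \<open>T\<close> determines the initial state in a Lipschitz manner, and null sets
  can be carried back in time.\<close>

lemma descent_curves_backward_Lipschitz:
  fixes F :: "'a::euclidean_space \<Rightarrow> 'a"
  assumes Lip: "\<And>a b. norm (F a - F b) \<le> L * norm (a - b)"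
    and x: "descent_curve F x" and y: "descent_curve F y" and T: "T \<ge> 0"
  shows "norm (x 0 - y 0) \<le> exp (L * T) * norm (x T - y T)"
proof -
  define w where "w = (\<lambda>t. x t - y t)"
  define w' where "w' = (\<lambda>t. - F (x t) - (- F (y t)))"
  have dw: "(w has_vector_derivative w' t) (at t within {0..})" if "t \<ge> 0" for t
    unfolding w_def w'_def using x y that unfolding descent_curve_def
    by (intro has_vector_derivative_diff) auto
  define D where "D = (\<lambda>t. (w t \<bullet> w t) * exp (2 * L * t))"
  define D' where "D' = (\<lambda>t. (2 * (w' t \<bullet> w t) + 2 * L * (w t \<bullet> w t)) * exp (2 * L * t))"
  have dD: "(D has_real_derivative D' t) (at t within {0..})" if "t \<ge> 0" for t
  proof -
    have "((\<lambda>t. w t \<bullet> w t) has_real_derivative (2 * (w' t \<bullet> w t))) (at t within {0..})"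
      using bounded_bilinear.has_vector_derivative[OF bounded_bilinear_inner dw[OF that] dw[OF that]]
      by (simp add: has_real_derivative_iff_has_vector_derivative inner_commute)
    moreover have "((\<lambda>t. exp (2 * L * t)) has_real_derivative exp (2 * L * t) * (2 * L)) (at t within {0..})"
      by (auto intro!: derivative_eq_intros)
    ultimately show ?thesis unfolding D_def D'_def
      by (rule DERIV_cong[OF DERIV_mult]) (simp add: algebra_simps)
  qed
  have D'pos: "D' t \<ge> 0" for t
  proof -
    have "\<bar>w' t \<bullet> w t\<bar> \<le> norm (w' t) * norm (w t)" by (rule Cauchy_Schwarz_ineq2)
    also have "norm (w' t) \<le> L * norm (w t)" using Lip[of "x t" "y t"]
      by (simp add: w'_def w_def norm_minus_commute)
    finally have "\<bar>w' t \<bullet> w t\<bar> \<le> L * (w t \<bullet> w t)"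
      by (simp add: power2_norm_eq_inner[symmetric] power2_eq_square mult_right_mono mult.assoc)
    then show ?thesis unfolding D'_def by (intro mult_nonneg_nonneg) auto
  qed
  have "D 0 \<le> D T"
  proof (cases "T = 0")
    case False
    then have "T > 0" using T by simp
    have cont: "continuous_on {0..T} D"
      by (rule DERIV_continuous_on[where D = D'], rule has_field_derivative_subset[OF dD]) auto
    have dD': "(D has_real_derivative D' s) (at s)" if "s > 0" for s
      using dD[of s] at_within_interior[of s "{0..}"] that by simp
    obtain l z where "0 < z" "z < T" "DERIV D z :> l" "D T - D 0 = (T - 0) * l"
      using MVT[OF \<open>T > 0\<close> cont] dD' real_differentiable_def by metis
    then show ?thesis using D'pos dD' DERIV_unique \<open>T > 0\<close>
      by (metis diff_ge_0_iff_ge diff_zero mult_nonneg_nonneg order_less_imp_le)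
  qed simp
  then have "(norm (w 0))\<^sup>2 \<le> (exp (L * T) * norm (w T))\<^sup>2"
    by (simp add: D_def power2_norm_eq_inner power_mult_distrib exp_double[symmetric] algebra_simps)
  then show ?thesis by (simp add: w_def power2_le_iff_abs_le)
qed

text \<open>No local stable manifold is constructed: near a strict saddle, the starting points of the
  curves that remain there have no two members differing by a vector of the unstable cone, and such
  a set has infinitely many disjoint translates inside a bounded set.\<close>

theorem negligible_converging_to_strict_saddle:
  fixes F :: "'a::euclidean_space \<Rightarrow> 'a"
  assumes Lip: "\<And>a b. norm (F a - F b) \<le> L * norm (a - b)"
    and saddle: "\<And>p. p \<in> A \<Longrightarrow> \<exists>H e. linear H \<and> (\<forall>x y. H x \<bullet> y = x \<bullet> H y) \<and> e \<bullet> H e < 0 \<and>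
       (\<forall>\<eta>>0. \<exists>r>0. \<forall>a\<in>ball p r. \<forall>b\<in>ball p r. norm (F a - F b - H (a - b)) \<le> \<eta> * norm (a - b))"
  shows "negligible {x 0 |x. descent_curve F x \<and> (\<exists>p\<in>A. (x \<longlongrightarrow> p) at_top)}"
proof -
  have "\<exists>r>0. negligible {x 0 |x. descent_curve F x \<and> (\<forall>t\<ge>0. x t \<in> ball p r)}" if pA: "p \<in> A" for p
  proof -
    obtain H e where lin: "linear H" and sym: "\<And>x y. H x \<bullet> y = x \<bullet> H y" and e: "e \<bullet> H e < 0"
      and app: "\<And>\<eta>. \<eta> > 0 \<Longrightarrow> \<exists>r>0. \<forall>a\<in>ball p r. \<forall>b\<in>ball p r. norm (F a - F b - H (a - b)) \<le> \<eta> * norm (a - b)"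
      using saddle[OF pA] by metis
    have e0: "e \<noteq> 0" using e by auto
    \<comment> \<open>Minus the Rayleigh quotient of \<open>e\<close>: for every
      \<open>c < l\<close> the vector \<open>e\<close> stays in the unstable cone of
      \<open>H + c\<close>.\<close>
    define l where "l = - (e \<bullet> H e) / (e \<bullet> e)"
    have "l > 0" using e e0 by (simp add: l_def divide_neg_pos)
    obtain c where c: "0 < c" "c < l" and inj: "inj (\<lambda>w. H w + c *\<^sub>R w)"
      using exists_shift_injective[OF lin sym \<open>l > 0\<close>] by blast
    define Lc where "Lc = (\<lambda>w. H w + c *\<^sub>R w)"
    have linL: "linear Lc" unfolding Lc_def by (intro linear_compose_add lin linear_scale_self)
    obtain \<kappa> where k: "\<kappa> > 0" "\<And>w. \<kappa> * norm w \<le> norm (Lc w)"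
      using linear_inj_bounded_below_pos[OF linL] inj by (auto simp: Lc_def)
    obtain M where M: "M > 0" "\<And>w. norm (Lc w) \<le> M * norm w"
      using linear_bounded_pos[OF linL] by blast
    obtain r where r: "r > 0" "\<And>a b. a \<in> ball p r \<Longrightarrow> b \<in> ball p r \<Longrightarrow> norm (F a - F b - H (a - b)) \<le> (\<kappa>\<^sup>2 / M) * norm (a - b)"
      using app[of "\<kappa>\<^sup>2 / M"] k M by auto
    let ?S = "{x 0 |x. descent_curve F x \<and> (\<forall>t\<ge>0. x t \<in> ball p r)}"
    have "negligible ?S"
    proof (rule negligible_if_no_chord_in_cone[OF _ linL])
      show "bounded ?S" by (rule bounded_subset[OF bounded_ball[of p r]]) auto
      have "c * (e \<bullet> e) < - (e \<bullet> H e)" using c e0 by (simp add: l_def field_simps)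
      then show "e \<bullet> Lc e < 0" by (simp add: Lc_def inner_add_right)
      fix a b assume "a \<in> ?S" "b \<in> ?S"
      then obtain x y where x: "a = x 0" "descent_curve F x" "\<And>t. t \<ge> 0 \<Longrightarrow> x t \<in> ball p r"
        and y: "b = y 0" "descent_curve F y" "\<And>t. t \<ge> 0 \<Longrightarrow> y t \<in> ball p r" by auto
      show "(a - b) \<bullet> Lc (a - b) \<ge> 0"
        unfolding x(1) y(1) Lc_def
        by (rule unstable_pair[OF lin sym k(2)[unfolded Lc_def] k(1) c(1) M(2)[unfolded Lc_def] _ _ r(2) bounded_ball x(2,3) y(2,3)])
           (use M k in auto)
    qed
    with r show ?thesis by blast
  qed
  then have "\<forall>p\<in>A. \<exists>r. r > 0 \<and> negligible {x 0 |x. descent_curve F x \<and> (\<forall>t\<ge>0. x t \<in> ball p r)}"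
    by blast
  from bchoice[OF this] obtain r where r: "\<And>p. p \<in> A \<Longrightarrow> r p > 0"
    and neg: "\<And>p. p \<in> A \<Longrightarrow> negligible {x 0 |x. descent_curve F x \<and> (\<forall>t\<ge>0. x t \<in> ball p (r p))}"
    by blast
  define S where "S = (\<lambda>p (T::nat). {x 0 |x. descent_curve F x \<and> (\<forall>t\<ge>real T. x t \<in> ball p (r p))})"
  have negS: "negligible (S p T)" if pA: "p \<in> A" for p T
  proof -
    define Y where "Y = {x (real T) |x. descent_curve F x \<and> (\<forall>t\<ge>real T. x t \<in> ball p (r p))}"
    have "Y \<subseteq> {x 0 |x. descent_curve F x \<and> (\<forall>t\<ge>0. x t \<in> ball p (r p))}"
    proof
      fix z assume "z \<in> Y"
      then obtain x where x: "z = x (real T)" "descent_curve F x" "\<forall>t\<ge>real T. x t \<in> ball p (r p)"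
        by (auto simp: Y_def)
      show "z \<in> {x 0 |x. descent_curve F x \<and> (\<forall>t\<ge>0. x t \<in> ball p (r p))}"
        by (rule CollectI, rule exI[of _ "\<lambda>t. x (t + real T)"])
           (use x descent_curve_shift[OF x(2)] in auto)
    qed
    then have nY: "negligible Y" using neg[OF pA] negligible_subset by blast
    \<comment> \<open>A choice of a curve through each point of \<open>Y\<close> at time
      \<open>T\<close>. By the backward estimate any two such curves start at the same point, so the
      image under \<open>pick\<close> covers all of \<open>S p T\<close>.\<close>
    define pick where "pick = (\<lambda>z. SOME x. z = x (real T) \<and> descent_curve F x \<and> (\<forall>t\<ge>real T. x t \<in> ball p (r p)))"
    have pick: "z = pick z (real T) \<and> descent_curve F (pick z) \<and> (\<forall>t\<ge>real T. pick z t \<in> ball p (r p))" if "z \<in> Y" for z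
    proof -
      have "\<exists>x. z = x (real T) \<and> descent_curve F x \<and> (\<forall>t\<ge>real T. x t \<in> ball p (r p))"
        using that unfolding Y_def by (rule CollectD)
      then show ?thesis unfolding pick_def by (rule someI_ex)
    qed
    have "negligible ((\<lambda>z. pick z 0) ` Y)"
    proof (rule negligible_locally_Lipschitz_image[OF order_refl nY])
      fix z assume z: "z \<in> Y"
      have "norm (pick u 0 - pick z 0) \<le> exp (L * real T) * norm (u - z)" if "u \<in> Y" for u
        using descent_curves_backward_Lipschitz[OF Lip, of "pick u" "pick z" "real T"] pick[OF z] pick[OF that]
        by (metis of_nat_0_le_iff)
      then show "\<exists>U B. open U \<and> z \<in> U \<and> (\<forall>y\<in>Y \<inter> U. norm (pick y 0 - pick z 0) \<le> B * norm (y - z))"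
        by (intro exI[of _ UNIV] exI[of _ "exp (L * real T)"]) auto
    qed
    moreover have "S p T \<subseteq> (\<lambda>z. pick z 0) ` Y"
    proof
      fix a assume "a \<in> S p T"
      then obtain x where x: "a = x 0" "descent_curve F x" "\<forall>t\<ge>real T. x t \<in> ball p (r p)" by (auto simp: S_def)
      then have xY: "x (real T) \<in> Y" by (auto simp: Y_def)
      have "norm (x 0 - pick (x (real T)) 0) \<le> exp (L * real T) * norm (x (real T) - pick (x (real T)) (real T))"
        using descent_curves_backward_Lipschitz[OF Lip x(2), of "pick (x (real T))" "real T"] pick[OF xY] by auto
      then have "x 0 = pick (x (real T)) 0" using pick[OF xY] by simp
      then show "a \<in> (\<lambda>z. pick z 0) ` Y" using xY x(1) by blast
    qed
    ultimately show ?thesis using negligible_subset by blast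
  qed
  \<comment> \<open>There may be uncountably many saddles; by Lindelof countably many of the balls
    already cover them.\<close>
  obtain C where C: "C \<subseteq> A" "countable C" "(\<Union>p\<in>C. ball p (r p)) = (\<Union>p\<in>A. ball p (r p))"
  proof -
    obtain F' where F': "F' \<subseteq> (\<lambda>p. ball p (r p)) ` A" "countable F'" "\<Union> F' = \<Union> ((\<lambda>p. ball p (r p)) ` A)"
      using Lindelof[of "(\<lambda>p. ball p (r p)) ` A"] by auto
    then obtain C where "C \<subseteq> A" "countable C" "F' = (\<lambda>p. ball p (r p)) ` C"
      using countable_subset_image[of F' "\<lambda>p. ball p (r p)" A] by auto
    then show thesis using that F' by auto
  qed
  have "negligible (\<Union>(p, T) \<in> C \<times> UNIV. S p T)"
    by (rule negligible_countable_Union) (use C negS in auto)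
  moreover have "{x 0 |x. descent_curve F x \<and> (\<exists>p\<in>A. (x \<longlongrightarrow> p) at_top)} \<subseteq> (\<Union>(p, T) \<in> C \<times> UNIV. S p T)"
  proof
    fix a assume "a \<in> {x 0 |x. descent_curve F x \<and> (\<exists>p\<in>A. (x \<longlongrightarrow> p) at_top)}"
    then obtain x p where x: "a = x 0" "descent_curve F x" and p: "p \<in> A" "(x \<longlongrightarrow> p) at_top" by auto
    have "p \<in> (\<Union>p\<in>A. ball p (r p))" using p r by force
    then obtain p' where p': "p' \<in> C" "p \<in> ball p' (r p')" using C(3) by blast
    have "eventually (\<lambda>t. x t \<in> ball p' (r p')) at_top"
      using topological_tendstoD[OF p(2) open_ball p'(2)] .
    then obtain N where N: "\<And>t. t \<ge> N \<Longrightarrow> x t \<in> ball p' (r p')" by (auto simp: eventually_at_top_linorder)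
    obtain T :: nat where "real T \<ge> N" using real_arch_simple by blast
    then have "a \<in> S p' T" unfolding S_def using x N by fastforce
    then show "a \<in> (\<Union>(p, T) \<in> C \<times> UNIV. S p T)" using p' by blast
  qed
  ultimately show ?thesis using negligible_subset by blast
qed

section \<open>Coordinates of constrained minimisers are algebraic\<close>

definition mon :: "('m::finite \<Rightarrow> nat) \<Rightarrow> ('m \<Rightarrow> real) \<Rightarrow> real" where
  "mon a z = (\<Prod>i\<in>UNIV. z i ^ a i)"

text \<open>\<open>D\<close> bounds the degree in the variables \<open>z\<close> and
  \<open>J\<close> the degree in the parameter \<open>c\<close>. The two are tracked separately
  because elimination lowers the first at the expense of the second.\<close>

inductive polyf :: "nat \<Rightarrow> nat \<Rightarrow> (real \<Rightarrow> ('m::finite \<Rightarrow> real) \<Rightarrow> real) \<Rightarrow> bool" where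
  const: "polyf 0 0 (\<lambda>c z. r)"
| param: "polyf 0 1 (\<lambda>c z. c)"
| var: "polyf 1 0 (\<lambda>c z. z i)"
| add: "polyf D J f \<Longrightarrow> polyf D J g \<Longrightarrow> polyf D J (\<lambda>c z. f c z + g c z)"
| mult: "polyf D J f \<Longrightarrow> polyf D' J' g \<Longrightarrow> polyf (D + D') (J + J') (\<lambda>c z. f c z * g c z)"
| mono: "polyf D J f \<Longrightarrow> D \<le> D' \<Longrightarrow> J \<le> J' \<Longrightarrow> polyf D' J' f"

lemma polyf_const: "polyf D J (\<lambda>c z. r)"
  using polyf.mono[OF polyf.const] by simp

lemma polyf_param: "polyf D (Suc J) (\<lambda>c z. c)"
  by (rule polyf.mono[OF polyf.param]) auto

lemma polyf_sum: "finite A \<Longrightarrow> (\<And>x. x \<in> A \<Longrightarrow> polyf D J (f x)) \<Longrightarrow> polyf D J (\<lambda>c z. \<Sum>x\<in>A. f x c z)"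
  by (induction A rule: finite_induct) (auto intro: polyf_const polyf.add)

lemma polyf_cmult: "polyf D J f \<Longrightarrow> polyf D J (\<lambda>c z. r * f c z)"
  using polyf.mult[OF polyf.const, of D J f r] by simp

lemma polyf_diff: "polyf D J f \<Longrightarrow> polyf D J g \<Longrightarrow> polyf D J (\<lambda>c z. f c z - g c z)"
  using polyf.add[OF _ polyf_cmult[of D J g "-1"], of f] by simp

lemma polyf_square: "polyf D J f \<Longrightarrow> polyf (2 * D) (2 * J) (\<lambda>c z. (f c z)\<^sup>2)"
  using polyf.mult[of D J f D J f] by (simp add: power2_eq_square mult_2)

lemma polyf_continuous: "polyf D J f \<Longrightarrow> continuous_on UNIV (\<lambda>z::real^'m::finite. f c (\<lambda>i. z $ i))"
proof (induction rule: polyf.induct)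
  case (var i)
  show ?case by (rule linear_continuous_on) (rule bounded_linear_vec_nth)
qed (auto intro: continuous_intros)

text \<open>The degree bound is kept, not lowered: the critical point equations only need a
  right-hand side of degree at most 4 against \<open>z i ^ 5\<close>.\<close>

lemma polyf_derivative:
  "polyf D J f \<Longrightarrow> \<exists>f'. polyf D J f' \<and> (\<forall>c z t. ((\<lambda>t. f c (z(i := t))) has_real_derivative f' c (z(i := t))) (at t))"
proof (induction rule: polyf.induct)
  case (const r)
  show ?case by (rule exI[of _ "\<lambda>c z. 0"]) (auto intro: polyf_const)
next
  case param
  show ?case by (rule exI[of _ "\<lambda>c z. 0"]) (auto intro: polyf_const)
next
  case (var j)
  show ?case
    by (rule exI[of _ "\<lambda>c z. if i = j then 1 else 0"]) (auto intro: polyf_const)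
next
  case (add D J f g)
  then obtain f' g' where "polyf D J f'" "polyf D J g'"
    "\<And>c z t. ((\<lambda>t. f c (z(i := t))) has_real_derivative f' c (z(i := t))) (at t)"
    "\<And>c z t. ((\<lambda>t. g c (z(i := t))) has_real_derivative g' c (z(i := t))) (at t)" by blast
  then show ?case
    by (intro exI[of _ "\<lambda>c z. f' c z + g' c z"]) (auto intro!: polyf.add DERIV_add simp del: fun_upd_apply)
next
  case (mult D J f D' J' g)
  then obtain f' g' where *: "polyf D J f'" "polyf D' J' g'"
    "\<And>c z t. ((\<lambda>t. f c (z(i := t))) has_real_derivative f' c (z(i := t))) (at t)"
    "\<And>c z t. ((\<lambda>t. g c (z(i := t))) has_real_derivative g' c (z(i := t))) (at t)" by blast
  show ?case
  proof (intro exI[of _ "\<lambda>c z. f' c z * g c z + f c z * g' c z"] conjI allI)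
    show "polyf (D + D') (J + J') (\<lambda>c z. f' c z * g c z + f c z * g' c z)"
      using * mult by (auto intro: polyf.add polyf.mult)
    show "((\<lambda>t. f c (z(i := t)) * g c (z(i := t))) has_real_derivative
        f' c (z(i := t)) * g c (z(i := t)) + f c (z(i := t)) * g' c (z(i := t))) (at t)" for c z t
      by (rule DERIV_cong[OF DERIV_mult[OF *(3,4)]]) (simp add: mult.commute)
  qed
next
  case (mono D J f D' J')
  then show ?case by (meson polyf.mono)
qed

lemma mon_add: "mon (\<lambda>i. a i + b i) z = mon a z * mon b z"
  by (simp add: mon_def power_add prod.distrib)

lemma polyf_monomials:
  "polyf D J f \<Longrightarrow> \<exists>L. (\<forall>(r, j, a)\<in>set L. j \<le> J \<and> sum a UNIV \<le> D) \<and>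
     (\<forall>c z. f c z = (\<Sum>(r, j, a)\<leftarrow>L. r * c ^ j * mon a z))"
proof (induction rule: polyf.induct)
  case (const r)
  show ?case by (rule exI[of _ "[(r, 0, \<lambda>_. 0)]"]) (simp add: mon_def)
next
  case param
  show ?case by (rule exI[of _ "[(1, 1, \<lambda>_. 0)]"]) (simp add: mon_def)
next
  case (var i)
  have "mon (\<lambda>j. if j = i then 1 else 0) z = z i" for z :: "'a \<Rightarrow> real"
    unfolding mon_def by (subst prod.remove[of _ i]) auto
  then show ?case by (intro exI[of _ "[(1, 0, \<lambda>j. if j = i then 1 else 0)]"]) simp
next
  case (add D J f g)
  then obtain L M where "\<forall>(r, j, a)\<in>set L. j \<le> J \<and> sum a UNIV \<le> D" "\<forall>(r, j, a)\<in>set M. j \<le> J \<and> sum a UNIV \<le> D"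
    "\<And>c z. f c z = (\<Sum>(r, j, a)\<leftarrow>L. r * c ^ j * mon a z)" "\<And>c z. g c z = (\<Sum>(r, j, a)\<leftarrow>M. r * c ^ j * mon a z)"
    by blast
  then show ?case by (intro exI[of _ "L @ M"]) auto
next
  case (mult D J f D' J' g)
  then obtain L M where L: "\<forall>(r, j, a)\<in>set L. j \<le> J \<and> sum a UNIV \<le> D" "\<And>c z. f c z = (\<Sum>(r, j, a)\<leftarrow>L. r * c ^ j * mon a z)"
    and M: "\<forall>(r, j, a)\<in>set M. j \<le> J' \<and> sum a UNIV \<le> D'" "\<And>c z. g c z = (\<Sum>(r, j, a)\<leftarrow>M. r * c ^ j * mon a z)"
    by blast
  let ?N = "concat (map (\<lambda>(r, j, a). map (\<lambda>(r', j', a'). (r * r', j + j', \<lambda>i. a i + a' i)) M) L)"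
  have deg: "\<forall>(r, j, a)\<in>set ?N. j \<le> J + J' \<and> sum a UNIV \<le> D + D'"
    using L(1) M(1) by (fastforce simp: sum.distrib intro: add_mono)
  have inner: "(\<Sum>(r, j, a)\<leftarrow>map (\<lambda>(r', j', a'). (r * r', j + j', \<lambda>i. a i + a' i)) M. r * c ^ j * mon a z)
     = r * c ^ j * mon a z * (\<Sum>(r, j, a)\<leftarrow>M. r * c ^ j * mon a z)" for r j a c z
    by (induction M) (auto simp: mon_add power_add algebra_simps)
  have outer: "(\<Sum>(r, j, a)\<leftarrow>concat (map (\<lambda>(r, j, a). map (\<lambda>(r', j', a'). (r * r', j + j', \<lambda>i. a i + a' i)) M) L'). r * c ^ j * mon a z)
     = (\<Sum>(r, j, a)\<leftarrow>L'. r * c ^ j * mon a z) * (\<Sum>(r, j, a)\<leftarrow>M. r * c ^ j * mon a z)" for L' c z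
    by (induction L') (auto simp: inner distrib_right simp del: map_map)
  show ?case by (rule exI[of _ ?N]) (use deg outer L(2) M(2) in auto)
next
  case (mono D J f D' J')
  then show ?case by (meson le_trans) fastforce
qed

section \<open>Normal forms for monomials when fifth powers are reducible\<close>

definition low_exps :: "('m::finite \<Rightarrow> nat) set" where "low_exps = {b. \<forall>i. b i \<le> 4}"

lemma low_exps: "finite (low_exps :: ('m::finite \<Rightarrow> nat) set)" "card (low_exps :: ('m \<Rightarrow> nat) set) = 5 ^ CARD('m)"
proof -
  have eq: "(low_exps :: ('m \<Rightarrow> nat) set) = PiE UNIV (\<lambda>_. {..4})" by (auto simp: low_exps_def PiE_def Pi_def)
  show "finite (low_exps :: ('m \<Rightarrow> nat) set)" unfolding eq by (intro finite_PiE) auto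
  show "card (low_exps :: ('m \<Rightarrow> nat) set) = 5 ^ CARD('m)" unfolding eq by (simp add: card_PiE)
qed

text \<open>On \<open>Z\<close>, \<open>f\<close> lies in a fixed space of dimension at most
  \<open>(J + 1) * 5 ^ CARD('m)\<close>. This bound is linear in \<open>J\<close>, which the
  dimension count exploits.\<close>

definition spanned :: "(real \<times> ('m::finite \<Rightarrow> real)) set \<Rightarrow> nat \<Rightarrow> (real \<Rightarrow> ('m \<Rightarrow> real) \<Rightarrow> real) \<Rightarrow> bool" where
  "spanned Z J f \<longleftrightarrow> (\<exists>q. \<forall>c z. (c, z) \<in> Z \<longrightarrow> f c z = (\<Sum>x\<in>{..J} \<times> low_exps. q x * (c ^ fst x * mon (snd x) z)))"

lemma spannedI:
  assumes "\<And>c z. (c, z) \<in> Z \<Longrightarrow> f c z = (\<Sum>x\<in>{..J} \<times> low_exps. q x * (c ^ fst x * mon (snd x) z))"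
  shows "spanned Z J f"
  using assms unfolding spanned_def by blast

lemma spanned_monomial:
  assumes jb: "j \<le> J" "b \<in> low_exps"
  shows "spanned Z J (\<lambda>c z. c ^ j * mon b z)"
proof (rule spannedI[where q = "\<lambda>x. if x = (j, b) then 1 else 0"])
  fix c :: real and z :: "'a \<Rightarrow> real"
  show "c ^ j * mon b z = (\<Sum>x\<in>{..J} \<times> low_exps. (if x = (j, b) then 1 else 0) * (c ^ fst x * mon (snd x) z))"
    using jb low_exps(1) by (subst sum.remove[of _ "(j, b)"]) (auto intro!: sum.neutral split: if_splits)
qed

lemma spanned_zero: "spanned Z J (\<lambda>c z. 0)"
  by (rule spannedI[where q = "\<lambda>_. 0"]) simp

lemma spanned_add:
  assumes "spanned Z J f" "spanned Z J g"
  shows "spanned Z J (\<lambda>c z. f c z + g c z)"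
proof -
  obtain q where q: "\<And>c z. (c, z) \<in> Z \<Longrightarrow> f c z = (\<Sum>x\<in>{..J} \<times> low_exps. q x * (c ^ fst x * mon (snd x) z))"
    using assms(1) unfolding spanned_def by blast
  obtain q' where q': "\<And>c z. (c, z) \<in> Z \<Longrightarrow> g c z = (\<Sum>x\<in>{..J} \<times> low_exps. q' x * (c ^ fst x * mon (snd x) z))"
    using assms(2) unfolding spanned_def by blast
  show ?thesis
    by (rule spannedI[where q = "\<lambda>x. q x + q' x"]) (simp add: q q' distrib_right sum.distrib)
qed

lemma spanned_cmult:
  assumes "spanned Z J f" shows "spanned Z J (\<lambda>c z. r * f c z)"
proof -
  obtain q where q: "\<And>c z. (c, z) \<in> Z \<Longrightarrow> f c z = (\<Sum>x\<in>{..J} \<times> low_exps. q x * (c ^ fst x * mon (snd x) z))"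
    using assms(1) unfolding spanned_def by blast
  show ?thesis
    by (rule spannedI[where q = "\<lambda>x. r * q x"]) (simp add: q sum_distrib_left mult.assoc)
qed

lemma spanned_sum: "finite A \<Longrightarrow> (\<And>x. x \<in> A \<Longrightarrow> spanned Z J (f x)) \<Longrightarrow> spanned Z J (\<lambda>c z. \<Sum>x\<in>A. f x c z)"
  by (induction A rule: finite_induct) (auto intro: spanned_zero spanned_add)

lemma spanned_cong: "spanned Z J f \<Longrightarrow> (\<And>c z. (c, z) \<in> Z \<Longrightarrow> f c z = g c z) \<Longrightarrow> spanned Z J g"
  unfolding spanned_def by simp

lemma spanned_param_power:
  assumes "spanned Z J f" and "J + k \<le> J'" shows "spanned Z J' (\<lambda>c z. c ^ k * f c z)"
proof -
  obtain q where q: "\<And>c z. (c, z) \<in> Z \<Longrightarrow> f c z = (\<Sum>x\<in>{..J} \<times> low_exps. q x * (c ^ fst x * mon (snd x) z))"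
    using assms(1) unfolding spanned_def by blast
  have "spanned Z J' (\<lambda>c z. \<Sum>x\<in>{..J} \<times> low_exps. q x * (c ^ (k + fst x) * mon (snd x) z))"
    using assms(2) low_exps(1) by (intro spanned_sum spanned_cmult spanned_monomial) auto
  then show ?thesis
    by (rule spanned_cong) (simp add: q sum_distrib_left power_add mult_ac)
qed

lemma spanned_sum_list: "(\<And>x. x \<in> set L \<Longrightarrow> spanned Z J (f x)) \<Longrightarrow> spanned Z J (\<lambda>c z. \<Sum>x\<leftarrow>L. f x c z)"
  by (induction L) (auto intro: spanned_zero spanned_add)

text \<open>Replacing \<open>z i ^ 5\<close> by a polynomial of degree at most 4 lowers the total
  degree by at least 1 and raises the power of \<open>c\<close> by at most 2. Hence the reduction
  terminates with a power of \<open>c\<close> at most twice the degree.\<close>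

lemma spanned_mon:
  assumes red: "\<And>i. \<exists>p. polyf 4 2 p \<and> (\<forall>(c, z)\<in>Z. z i ^ 5 = p c z)"
  shows "spanned Z (2 * sum a UNIV) (\<lambda>c z. mon a z)"
proof (induction "sum a UNIV" arbitrary: a rule: less_induct)
  case less
  show ?case
  proof (cases "a \<in> low_exps")
    case True
    then show ?thesis using spanned_monomial[of 0 "2 * sum a UNIV" a Z] by (simp only: power_0 mult_1 le0)
  next
    case False
    then obtain i where "\<not> a i \<le> 4" by (auto simp: low_exps_def)
    then have i: "a i \<ge> 5" by simp
    define a' where "a' = a(i := a i - 5)"
    have sa: "sum a UNIV = sum a' UNIV + 5"
      using i by (simp add: a'_def sum.remove[of UNIV i])
    have ma: "mon a z = mon a' z * z i ^ 5" for z
    proof -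
      have "mon a z = z i ^ a i * (\<Prod>j\<in>UNIV - {i}. z j ^ a j)" by (simp add: mon_def prod.remove[of _ i])
      moreover have "mon a' z = z i ^ (a i - 5) * (\<Prod>j\<in>UNIV - {i}. z j ^ a j)"
        unfolding mon_def by (subst prod.remove[of _ i]) (auto simp: a'_def)
      moreover have "z i ^ a i = z i ^ (a i - 5) * z i ^ 5" using i by (simp flip: power_add)
      ultimately show ?thesis by simp
    qed
    obtain p where p: "polyf 4 2 p" "\<forall>(c, z)\<in>Z. z i ^ 5 = p c z" using red by blast
    obtain L where L: "\<forall>(r, j, b)\<in>set L. j \<le> 2 \<and> sum b UNIV \<le> 4" "\<And>c z. p c z = (\<Sum>(r, j, b)\<leftarrow>L. r * c ^ j * mon b z)"
      using polyf_monomials[OF p(1)] by blast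
    have "spanned Z (2 * sum a UNIV) (\<lambda>c z. \<Sum>x\<leftarrow>L. fst x * (c ^ fst (snd x) * mon (\<lambda>i. a' i + snd (snd x) i) z))"
    proof (intro spanned_sum_list spanned_cmult)
      fix x assume "x \<in> set L"
      then have x: "fst (snd x) \<le> 2" "sum (snd (snd x)) UNIV \<le> 4" using L(1) by auto
      let ?b = "\<lambda>i. a' i + snd (snd x) i"
      have sb: "sum ?b UNIV = sum a' UNIV + sum (snd (snd x)) UNIV" by (simp add: sum.distrib)
      have "spanned Z (2 * sum ?b UNIV) (\<lambda>c z. mon ?b z)" using less[of ?b] sb x sa by simp
      then show "spanned Z (2 * sum a UNIV) (\<lambda>c z. c ^ fst (snd x) * mon ?b z)"
        by (rule spanned_param_power) (use sb x sa in simp)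
    qed
    then show ?thesis
    proof (rule spanned_cong)
      fix c z assume cz: "(c, z) \<in> Z"
      have "mon a z = mon a' z * (\<Sum>(r, j, b)\<leftarrow>L. r * c ^ j * mon b z)" using ma p(2) cz L(2) by auto
      also have "\<dots> = (\<Sum>x\<leftarrow>L. fst x * (c ^ fst (snd x) * mon (\<lambda>i. a' i + snd (snd x) i) z))"
        by (simp add: mon_add sum_list_const_mult[symmetric] case_prod_beta mult_ac)
      finally show "(\<Sum>x\<leftarrow>L. fst x * (c ^ fst (snd x) * mon (\<lambda>i. a' i + snd (snd x) i) z)) = mon a z" by simp
    qed
  qed
qed

lemma underdetermined_homogeneous_system:
  fixes A :: "'e \<Rightarrow> 'i \<Rightarrow> real"
  assumes "finite E" "finite I" "card E < card I"
  shows "\<exists>p. (\<exists>i\<in>I. p i \<noteq> 0) \<and> (\<forall>e\<in>E. (\<Sum>i\<in>I. p i * A e i) = 0)"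
  using assms
proof (induction E arbitrary: I A rule: finite_induct)
  case empty
  then obtain i where "i \<in> I" by (auto simp: card_gt_0_iff)
  then show ?case by (intro exI[of _ "\<lambda>_. 1"]) auto
next
  case (insert e E)
  show ?case
  proof (cases "\<forall>i\<in>I. A e i = 0")
    case True
    have "card E < card I" using insert by simp
    then obtain p where "\<exists>i\<in>I. p i \<noteq> 0" "\<forall>e\<in>E. (\<Sum>i\<in>I. p i * A e i) = 0" using insert by blast
    then show ?thesis using True by (intro exI[of _ p]) auto
  next
    case False
    then obtain k where k: "k \<in> I" "A e k \<noteq> 0" by blast
    \<comment> \<open>Gaussian elimination: equation \<open>e\<close> is used to express the unknown
      \<open>k\<close> by the others.\<close>
    define A' where "A' = (\<lambda>e' i. A e' i - A e' k * A e i / A e k)"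
    have "card E < card (I - {k})" using insert k by simp
    then obtain p where p: "\<exists>i\<in>I - {k}. p i \<noteq> 0" "\<And>e'. e' \<in> E \<Longrightarrow> (\<Sum>i\<in>I - {k}. p i * A' e' i) = 0"
      using insert.IH[of "I - {k}" A'] insert.prems by auto
    define s where "s = (\<Sum>i\<in>I - {k}. p i * A e i) / A e k"
    define p' where "p' = p(k := - s)"
    have split: "(\<Sum>i\<in>I. p' i * A e' i) = - s * A e' k + (\<Sum>i\<in>I - {k}. p i * A e' i)" for e'
      using k(1) insert.prems by (subst sum.remove[of I k]) (auto simp: p'_def intro!: sum.cong)
    have "(\<Sum>i\<in>I. p' i * A e' i) = 0" if "e' \<in> insert e E" for e'
    proof (cases "e' = e")
      case True
      then show ?thesis using k(2) by (simp add: split s_def)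
    next
      case False
      then have "0 = (\<Sum>i\<in>I - {k}. p i * A' e' i)" using p(2) that by simp
      also have "\<dots> = (\<Sum>i\<in>I - {k}. p i * A e' i - (p i * A e i) * (A e' k / A e k))"
        by (intro sum.cong refl) (simp add: A'_def algebra_simps)
      also have "\<dots> = (\<Sum>i\<in>I - {k}. p i * A e' i) - (\<Sum>i\<in>I - {k}. p i * A e i) * (A e' k / A e k)"
        by (simp only: sum_subtractf sum_distrib_right)
      finally show ?thesis by (simp add: split s_def)
    qed
    moreover have "\<exists>i\<in>I. p' i \<noteq> 0" using p(1) by (auto simp: p'_def)
    ultimately show ?thesis by blast
  qed
qed

text \<open>Since \<open>c ^ a * z i ^ b\<close> with \<open>a, b \<le> K\<close> are quadratically many functions in a space of dimension
  linear in \<open>K\<close>, they are linearly dependent.\<close>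

lemma coordinate_algebraic:
  fixes Z :: "(real \<times> ('m::finite \<Rightarrow> real)) set"
  assumes red: "\<And>i. \<exists>p. polyf 4 2 p \<and> (\<forall>(c, z)\<in>Z. z i ^ 5 = p c z)"
    and K: "K = 3 * 5 ^ CARD('m)"
  shows "\<exists>p. (\<forall>x\<in>{..K} \<times> {..K}. \<bar>p x\<bar> \<le> (1::real)) \<and> (\<exists>x\<in>{..K} \<times> {..K}. \<bar>p x\<bar> = 1) \<and>
    (\<forall>c z. (c, z) \<in> Z \<longrightarrow> (\<Sum>x\<in>{..K} \<times> {..K}. p x * (c ^ fst x * z i ^ snd x)) = 0)"
proof -
  define I where "I = {..K} \<times> {..K}"
  \<comment> \<open>At most \<open>K\<close> powers of \<open>c\<close> are present at the start and
    at most \<open>2 * K\<close> more arise from reducing \<open>z i ^ b\<close> with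
    \<open>b \<le> K\<close>.\<close>
  define E where "E = {..3 * K} \<times> (low_exps :: ('m \<Rightarrow> nat) set)"
  have "\<exists>q. \<forall>c z. (c, z) \<in> Z \<longrightarrow> c ^ fst x * z i ^ snd x = (\<Sum>y\<in>E. q y * (c ^ fst y * mon (snd y) z))" if "x \<in> I" for x
  proof -
    define a where "a = (\<lambda>j. if j = i then snd x else 0)"
    have sa: "sum a UNIV = snd x" by (simp add: a_def)
    have "mon a z = z i ^ snd x" for z
      unfolding mon_def a_def by (subst prod.remove[of _ i]) auto
    then have "spanned Z (2 * snd x) (\<lambda>c z. z i ^ snd x)" using spanned_mon[OF red, of a] sa by simp
    then have "spanned Z (3 * K) (\<lambda>c z. c ^ fst x * z i ^ snd x)"
      by (rule spanned_param_power) (use that in \<open>auto simp: I_def\<close>)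
    then show ?thesis by (simp add: spanned_def E_def)
  qed
  then have "\<forall>x\<in>I. \<exists>q. \<forall>c z. (c, z) \<in> Z \<longrightarrow> c ^ fst x * z i ^ snd x = (\<Sum>y\<in>E. q y * (c ^ fst y * mon (snd y) z))" by blast
  from bchoice[OF this] obtain A where
    A: "\<And>x c z. x \<in> I \<Longrightarrow> (c, z) \<in> Z \<Longrightarrow> c ^ fst x * z i ^ snd x = (\<Sum>y\<in>E. A x y * (c ^ fst y * mon (snd y) z))"
    by blast
  have fin: "finite I" "finite E" by (auto simp: I_def E_def low_exps(1))
  \<comment> \<open>With \<open>X = 5 ^ CARD('m)\<close> and \<open>K = 3 * X\<close> the comparison
    is \<open>9 * X\<^sup>2 + X < (3 * X + 1)\<^sup>2\<close>.\<close>
  have "card E < card I"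
  proof -
    define X :: nat where "X = 5 ^ CARD('m)"
    have "card E = (9 * X + 1) * X" by (simp add: E_def card_cartesian_product low_exps(2) K X_def)
    moreover have "card I = (3 * X + 1) * (3 * X + 1)" by (simp add: I_def card_cartesian_product K X_def)
    ultimately show ?thesis by (simp add: algebra_simps)
  qed
  then obtain p where p: "\<exists>x\<in>I. p x \<noteq> 0" "\<And>y. y \<in> E \<Longrightarrow> (\<Sum>x\<in>I. p x * A x y) = 0"
    using underdetermined_homogeneous_system[OF fin(2,1), of "\<lambda>y x. A x y"] by blast
  \<comment> \<open>Dividing by the largest coefficient keeps the relation bounded and away from 0,
    so that a limit of such relations remains nontrivial.\<close>
  define M where "M = Max ((\<lambda>x. \<bar>p x\<bar>) ` I)"
  have Mge: "\<bar>p x\<bar> \<le> M" if "x \<in> I" for x unfolding M_def using fin that by (intro Max_ge) auto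
  have "M \<in> (\<lambda>x. \<bar>p x\<bar>) ` I" unfolding M_def using fin p(1) by (intro Max_in) auto
  then obtain x0 where x0: "x0 \<in> I" "\<bar>p x0\<bar> = M" by auto
  have M: "M > 0" using p(1) Mge by fastforce
  have van: "(\<Sum>x\<in>I. p x * (c ^ fst x * z i ^ snd x)) = 0" if cz: "(c, z) \<in> Z" for c z
  proof -
    have "(\<Sum>x\<in>I. p x * (c ^ fst x * z i ^ snd x)) = (\<Sum>x\<in>I. \<Sum>y\<in>E. (p x * A x y) * (c ^ fst y * mon (snd y) z))"
      using A[OF _ cz] by (simp add: sum_distrib_left mult.assoc)
    also have "\<dots> = (\<Sum>y\<in>E. (\<Sum>x\<in>I. p x * A x y) * (c ^ fst y * mon (snd y) z))"
      by (subst sum.swap) (simp add: sum_distrib_right)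
    also have "\<dots> = 0" using p(2) by simp
    finally show ?thesis .
  qed
  show ?thesis
  proof (intro exI[of _ "\<lambda>x. p x / M"] conjI allI impI ballI)
    show "\<bar>p x / M\<bar> \<le> 1" if "x \<in> {..K} \<times> {..K}" for x
      using Mge[of x] M that by (simp add: I_def)
    show "\<exists>x\<in>{..K} \<times> {..K}. \<bar>p x / M\<bar> = 1"
      using x0 M by (intro bexI[of _ x0]) (auto simp: I_def)
    show "(\<Sum>x\<in>{..K} \<times> {..K}. p x / M * (c ^ fst x * z i ^ snd x)) = 0" if "(c, z) \<in> Z" for c z
    proof -
      have "(\<Sum>x\<in>I. p x / M * (c ^ fst x * z i ^ snd x)) = (\<Sum>x\<in>I. p x * (c ^ fst x * z i ^ snd x)) / M"
        by (simp add: sum_divide_distrib)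
      then show ?thesis using van[OF that] by (simp add: I_def)
    qed
  qed
qed

lemma bounded_family_convergent_subsequence:
  fixes f :: "nat \<Rightarrow> 'i \<Rightarrow> real"
  assumes "finite I" "\<And>i n. i \<in> I \<Longrightarrow> \<bar>f n i\<bar> \<le> b"
  shows "\<exists>r l. strict_mono (r :: nat \<Rightarrow> nat) \<and> (\<forall>i\<in>I. (\<lambda>n. f (r n) i) \<longlonglongrightarrow> l i)"
  using assms
proof (induction I rule: finite_induct)
  case empty
  show ?case by (intro exI[of _ id]) (auto simp: strict_mono_def)
next
  case (insert k I)
  have "\<exists>r l. strict_mono (r :: nat \<Rightarrow> nat) \<and> (\<forall>i\<in>I. (\<lambda>n. f (r n) i) \<longlonglongrightarrow> l i)"
    by (rule insert.IH) (use insert.prems in blast)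
  then obtain r l where r: "strict_mono (r :: nat \<Rightarrow> nat)" "\<And>i. i \<in> I \<Longrightarrow> (\<lambda>n. f (r n) i) \<longlonglongrightarrow> l i" by blast
  have "bounded (range (\<lambda>n. f (r n) k))" using insert.prems by (auto simp: bounded_iff)
  then obtain m s where s: "strict_mono (s :: nat \<Rightarrow> nat)" "((\<lambda>n. f (r n) k) \<circ> s) \<longlonglongrightarrow> m"
    using bounded_imp_convergent_subsequence by metis
  show ?case
  proof (intro exI[of _ "r \<circ> s"] exI[of _ "l(k := m)"] conjI ballI)
    show "strict_mono (r \<circ> s)" using r(1) s(1) by (rule strict_mono_o)
    fix i assume "i \<in> insert k I"
    then show "(\<lambda>n. f ((r \<circ> s) n) i) \<longlonglongrightarrow> (l(k := m)) i"
      using s LIMSEQ_subseq_LIMSEQ[OF r(2)[of i] s(1)] insert.hyps by (auto simp: o_def)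
  qed
qed

text \<open>Penalising the constraint and adding a small multiple of \<open>\<Sum>i. z i ^ 6\<close> puts the critical point
  equations into the form required by the elimination lemma, with a degree bound independent of the
  penalty parameter; hence the relations survive the limit.\<close>

theorem algebraic_constrained_minimisers:
  fixes g s :: "real \<Rightarrow> ('m::finite \<Rightarrow> real) \<Rightarrow> real"
  assumes g: "polyf 4 2 g" "\<And>c z. g c z \<ge> 0" and s: "polyf 4 2 s" "\<And>c z. s c z \<ge> 0"
    and proper: "\<And>c R. \<exists>b. \<forall>z i. s c z \<le> R \<longrightarrow> \<bar>z i\<bar> \<le> b"
  shows "\<exists>K p. (\<forall>i. \<exists>x\<in>{..K} \<times> {..K}. p i x \<noteq> (0::real)) \<and>
    (\<forall>c. (\<exists>z. s c z = 0) \<longrightarrow> (\<exists>z. s c z = 0 \<and> (\<forall>z'. s c z' = 0 \<longrightarrow> g c z \<le> g c z') \<and>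
      (\<forall>i. (\<Sum>x\<in>{..K} \<times> {..K}. p i x * (c ^ fst x * z i ^ snd x)) = 0)))"
proof -
  define K :: nat where "K = 3 * 5 ^ CARD('m)"
  \<comment> \<open>The exponent 6 exceeds the degree 4 of \<open>g\<close> and \<open>s\<close> by
    enough: its derivative \<open>6 * z i ^ 5\<close> dominates theirs. Being even, it also makes
    \<open>Q\<close> coercive, so a minimiser exists for every \<open>k\<close>.\<close>
  define Q where "Q = (\<lambda>k c z. g c z + real (Suc k) * s c z + (1 / real (Suc k)) * (\<Sum>i\<in>UNIV. z i ^ 6))"
  define Z where "Z = (\<lambda>k. {(c, z). \<forall>z'. Q k c z \<le> Q k c z'})"
  have red: "\<exists>p. polyf 4 2 p \<and> (\<forall>(c, z)\<in>Z k. z i ^ 5 = p c z)" for k i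
  proof -
    obtain g' where g': "polyf 4 2 g'" "\<And>c z t. ((\<lambda>t. g c (z(i := t))) has_real_derivative g' c (z(i := t))) (at t)"
      using polyf_derivative[OF g(1)] by blast
    obtain s' where s': "polyf 4 2 s'" "\<And>c z t. ((\<lambda>t. s c (z(i := t))) has_real_derivative s' c (z(i := t))) (at t)"
      using polyf_derivative[OF s(1)] by blast
    \<comment> \<open>The vanishing partial derivative of \<open>Q k c\<close> solved for
      \<open>z i ^ 5\<close>. Only the coefficients depend on \<open>k\<close>, not the
      degrees.\<close>
    define p where "p = (\<lambda>c z. (- real (Suc k) / 6) * (g' c z + real (Suc k) * s' c z))"
    have "polyf 4 2 p" unfolding p_def by (intro polyf_cmult polyf.add g' s')
    moreover have "z i ^ 5 = p c z" if cz: "(c, z) \<in> Z k" for c z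
    proof -
      define C where "C = (\<Sum>j\<in>UNIV - {i}. z j ^ 6)"
      have split: "(\<Sum>j\<in>UNIV. (z(i := t)) j ^ 6) = t ^ 6 + C" for t
        unfolding C_def by (subst sum.remove[of _ i]) (auto intro!: sum.cong)
      have d: "((\<lambda>t. Q k c (z(i := t))) has_real_derivative
         (g' c (z(i := t)) + real (Suc k) * s' c (z(i := t)) + (1 / real (Suc k)) * (6 * t ^ 5))) (at t)" for t
        unfolding Q_def split
        by (intro DERIV_add g' DERIV_cmult s') (auto intro!: derivative_eq_intros)
      have "g' c (z(i := z i)) + real (Suc k) * s' c (z(i := z i)) + (1 / real (Suc k)) * (6 * z i ^ 5) = 0"
        by (rule DERIV_local_min[OF d, of 1]) (use cz in \<open>auto simp: Z_def simp del: fun_upd_apply\<close>)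
      then show ?thesis by (simp add: p_def field_simps)
    qed
    ultimately show ?thesis by (intro exI[of _ p]) auto
  qed
  define rel where "rel = (\<lambda>k i p. (\<forall>x\<in>{..K} \<times> {..K}. \<bar>p x\<bar> \<le> (1::real)) \<and> (\<exists>x\<in>{..K} \<times> {..K}. \<bar>p x\<bar> = 1) \<and>
    (\<forall>c z. (c, z) \<in> Z k \<longrightarrow> (\<Sum>x\<in>{..K} \<times> {..K}. p x * (c ^ fst x * z i ^ snd x)) = 0))"
  have "\<exists>p. rel k i p" for k i unfolding rel_def by (rule coordinate_algebraic[OF red K_def])
  then obtain P where P: "\<And>k i. rel k i (P k i)" by metis
  have P1: "\<And>k i x. x \<in> {..K} \<times> {..K} \<Longrightarrow> \<bar>P k i x\<bar> \<le> 1"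
    and P2: "\<And>k i. \<exists>x\<in>{..K} \<times> {..K}. \<bar>P k i x\<bar> = 1"
    and P3: "\<And>k i c z. (c, z) \<in> Z k \<Longrightarrow> (\<Sum>x\<in>{..K} \<times> {..K}. P k i x * (c ^ fst x * z i ^ snd x)) = 0"
    using P unfolding rel_def by blast+
  obtain r l where r: "strict_mono (r :: nat \<Rightarrow> nat)"
    and l: "\<And>i x. x \<in> {..K} \<times> {..K} \<Longrightarrow> (\<lambda>n. P (r n) i x) \<longlonglongrightarrow> l (i, x)"
  proof -
    have "\<exists>r l. strict_mono (r :: nat \<Rightarrow> nat) \<and>
        (\<forall>y\<in>(UNIV :: 'm set) \<times> ({..K} \<times> {..K}). (\<lambda>n. P (r n) (fst y) (snd y)) \<longlonglongrightarrow> l y)"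
      by (rule bounded_family_convergent_subsequence[where b = 1]) (use P1 in auto)
    then obtain r l where r: "strict_mono (r :: nat \<Rightarrow> nat)"
      and l: "\<And>y. y \<in> (UNIV :: 'm set) \<times> ({..K} \<times> {..K}) \<Longrightarrow> (\<lambda>n. P (r n) (fst y) (snd y)) \<longlonglongrightarrow> l y" by blast
    show thesis
    proof (rule that[OF r])
      show "(\<lambda>n. P (r n) i x) \<longlonglongrightarrow> l (i, x)" if "x \<in> {..K} \<times> {..K}" for i x
        using l[of "(i, x)"] that by simp
    qed
  qed
  \<comment> \<open>Each relation has a coefficient of absolute value 1, so the sum of absolute
    values stays at least 1 in the limit.\<close>
  have nz: "\<exists>x\<in>{..K} \<times> {..K}. l (i, x) \<noteq> 0" for i
  proof (rule ccontr)
    assume "\<not> ?thesis"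
    then have "(\<lambda>n. \<Sum>x\<in>{..K} \<times> {..K}. \<bar>P (r n) i x\<bar>) \<longlonglongrightarrow> (\<Sum>x\<in>{..K} \<times> {..K}. \<bar>0\<bar>)"
      using l[of _ i] by (intro tendsto_sum tendsto_rabs) auto
    moreover have "1 \<le> (\<Sum>x\<in>{..K} \<times> {..K}. \<bar>P (r n) i x\<bar>)" for n
    proof -
      obtain x where "x \<in> {..K} \<times> {..K}" "\<bar>P (r n) i x\<bar> = 1" using P2 by blast
      then show ?thesis using member_le_sum[of x "{..K} \<times> {..K}" "\<lambda>x. \<bar>P (r n) i x\<bar>"] by simp
    qed
    ultimately have "(1::real) \<le> (\<Sum>x\<in>{..K} \<times> {..K}. \<bar>0\<bar>)" by (intro LIMSEQ_le_const) auto
    then show False by simp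
  qed
  have lim: "\<exists>z. s c z = 0 \<and> (\<forall>z'. s c z' = 0 \<longrightarrow> g c z \<le> g c z') \<and>
      (\<forall>i. (\<Sum>x\<in>{..K} \<times> {..K}. l (i, x) * (c ^ fst x * z i ^ snd x)) = 0)" if feas: "s c z0 = 0" for c z0
  proof -
    have "\<exists>z. (c, z) \<in> Z k" for k
    proof -
      define q where "q = (\<lambda>v::real^'m. Q k c (\<lambda>i. v $ i))"
      have cont: "continuous_on UNIV q"
        unfolding q_def Q_def
        by (intro continuous_intros polyf_continuous[OF g(1)] polyf_continuous[OF s(1)])
      define S where "S = {v. q v \<le> q 0}"
      have clS: "closed S" unfolding S_def using cont by (intro closed_Collect_le) auto
      define b where "b = 1 + real (Suc k) * q 0"
      have comp: "\<bar>v $ i\<bar> \<le> b" if "v \<in> S" for v i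
      proof (rule ccontr)
        assume n: "\<not> ?thesis"
        have q0: "q 0 \<ge> 0" unfolding q_def Q_def using g(2) s(2) by (intro add_nonneg_nonneg mult_nonneg_nonneg sum_nonneg) auto
        have "(1 / real (Suc k)) * (\<Sum>i\<in>UNIV. (v $ i) ^ 6) \<le> q v"
          unfolding q_def Q_def using g(2) s(2) by simp
        also have "\<dots> \<le> q 0" using that by (simp add: S_def)
        finally have "(\<Sum>i\<in>UNIV. (v $ i) ^ 6) \<le> real (Suc k) * q 0" by (simp add: field_simps)
        moreover have "(v $ i) ^ 6 \<le> (\<Sum>i\<in>UNIV. (v $ i) ^ 6)" by (rule member_le_sum) auto
        moreover have "\<bar>v $ i\<bar> ^ 1 \<le> \<bar>v $ i\<bar> ^ 6"
        proof (rule power_increasing)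
          have "real (Suc k) * q 0 \<ge> 0" using q0 by (intro mult_nonneg_nonneg) auto
          then show "1 \<le> \<bar>v $ i\<bar>" using n unfolding b_def by linarith
        qed simp
        ultimately have "\<bar>v $ i\<bar> \<le> real (Suc k) * q 0" by (simp add: power_even_abs)
        then show False using n unfolding b_def by linarith
      qed
      have "bounded S"
      proof (rule boundedI)
        fix v assume "v \<in> S"
        have "norm v \<le> (\<Sum>i\<in>UNIV. \<bar>v $ i\<bar>)" by (rule norm_le_l1_cart)
        also have "\<dots> \<le> (\<Sum>i\<in>(UNIV :: 'm set). b)" using comp[OF \<open>v \<in> S\<close>] by (intro sum_mono)
        finally show "norm v \<le> (\<Sum>i\<in>(UNIV :: 'm set). b)" .
      qed
      then have "compact S" using clS compact_eq_bounded_closed by blast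
      moreover have "S \<noteq> {}" by (auto simp: S_def)
      ultimately obtain v where v: "v \<in> S" "\<And>w. w \<in> S \<Longrightarrow> q v \<le> q w"
        using continuous_attains_inf[of S q] cont continuous_on_subset by blast
      have qmin: "q v \<le> q w" for w
        using v(2)[of w] v(1) by (cases "w \<in> S") (auto simp: S_def)
      have "Q k c (\<lambda>i. v $ i) \<le> Q k c z" for z
        using qmin[of "\<chi> i. z i"] by (simp add: q_def vec_lambda_inverse)
      then show ?thesis by (auto simp: Z_def)
    qed
    then obtain \<zeta> where zeta: "\<And>k. (c, \<zeta> k) \<in> Z k" by metis
    \<comment> \<open>Comparison of the unconstrained minimiser with a feasible point. It forces
      \<open>s\<close> to 0 along the sequence and makes the limit minimal for
      \<open>g\<close>.\<close>
    have up: "g c (\<zeta> k) + real (Suc k) * s c (\<zeta> k) \<le> g c z' + (1 / real (Suc k)) * (\<Sum>i\<in>UNIV. z' i ^ 6)"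
      if "s c z' = 0" for z' k
    proof -
      have "g c (\<zeta> k) + real (Suc k) * s c (\<zeta> k) \<le> Q k c (\<zeta> k)"
        unfolding Q_def by (simp add: sum_nonneg)
      also have "\<dots> \<le> Q k c z'" using zeta[of k] by (auto simp: Z_def)
      finally show ?thesis using that by (simp add: Q_def)
    qed
    define C where "C = (\<Sum>i\<in>UNIV. z0 i ^ 6)"
    have C0: "C \<ge> 0" by (simp add: C_def sum_nonneg)
    have ssmall: "s c (\<zeta> k) \<le> (g c z0 + C) / real (Suc k)" for k
    proof -
      have "(1 / real (Suc k)) * C \<le> 1 * C" using C0 by (intro mult_right_mono) auto
      then have "real (Suc k) * s c (\<zeta> k) \<le> g c z0 + C" using up[OF feas, of k] g(2)[of c "\<zeta> k"] by (simp add: C_def)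
      then show ?thesis by (simp add: field_simps)
    qed
    have "s c (\<zeta> k) \<le> g c z0 + C" for k
    proof -
      have "(g c z0 + C) / real (Suc k) \<le> (g c z0 + C) / 1" using g(2) C0 by (intro divide_left_mono) auto
      then show ?thesis using ssmall[of k] by simp
    qed
    then obtain b where b: "\<And>k i. \<bar>\<zeta> k i\<bar> \<le> b" using proper[of c "g c z0 + C"] by blast
    obtain t w where t: "strict_mono (t :: nat \<Rightarrow> nat)" and w: "\<And>i. (\<lambda>n. \<zeta> (r (t n)) i) \<longlonglongrightarrow> w i"
      using bounded_family_convergent_subsequence[of "UNIV :: 'm set" "\<lambda>n. \<zeta> (r n)" b] b by auto
    define u where "u = (\<lambda>n. r (t n))"
    have u: "strict_mono u" using r t by (simp add: u_def strict_mono_def)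
    have uinf: "filterlim u at_top sequentially" by (rule filterlim_subseq[OF u])
    have vlim: "(\<lambda>n. \<chi> i. \<zeta> (u n) i) \<longlonglongrightarrow> (\<chi> i. w i)"
      by (rule vec_tendstoI) (use w in \<open>simp add: u_def\<close>)
    have clim: "(\<lambda>n. f c (\<zeta> (u n))) \<longlonglongrightarrow> f c w" if "polyf D J f" for D J f
    proof -
      have "isCont (\<lambda>z::real^'m. f c (\<lambda>i. z $ i)) (\<chi> i. w i)"
        using polyf_continuous[OF that, of c] by (simp add: continuous_on_eq_continuous_at)
      from isCont_tendsto_compose[OF this vlim] show ?thesis by (simp add: vec_lambda_inverse)
    qed
    have inv0: "(\<lambda>n. 1 / real (Suc (u n))) \<longlonglongrightarrow> 0"
      using filterlim_compose[OF LIMSEQ_inverse_real_of_nat uinf] by (simp add: inverse_eq_divide)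
    have "s c w \<le> 0"
    proof (rule LIMSEQ_le[OF clim[OF s(1)]])
      show "(\<lambda>n. (g c z0 + C) * (1 / real (Suc (u n)))) \<longlonglongrightarrow> 0"
        using tendsto_mult_left[OF inv0, of "g c z0 + C"] by simp
      show "\<exists>N. \<forall>n\<ge>N. s c (\<zeta> (u n)) \<le> (g c z0 + C) * (1 / real (Suc (u n)))" using ssmall by auto
    qed
    then have s0: "s c w = 0" using s(2)[of c w] by simp
    have gmin: "g c w \<le> g c z'" if z': "s c z' = 0" for z'
    proof (rule LIMSEQ_le[OF clim[OF g(1)]])
      show "(\<lambda>n. g c z' + (1 / real (Suc (u n))) * (\<Sum>i\<in>UNIV. z' i ^ 6)) \<longlonglongrightarrow> g c z'"
        using tendsto_add[OF tendsto_const tendsto_mult_right[OF inv0], of "g c z'" "\<Sum>i\<in>UNIV. z' i ^ 6"] by simp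
      have "g c (\<zeta> k) \<le> g c z' + (1 / real (Suc k)) * (\<Sum>i\<in>UNIV. z' i ^ 6)" for k
        using up[OF z', of k] mult_nonneg_nonneg[OF of_nat_0_le_iff[of "Suc k"] s(2)[of c "\<zeta> k"]] by linarith
      then show "\<exists>N. \<forall>n\<ge>N. g c (\<zeta> (u n)) \<le> g c z' + (1 / real (Suc (u n))) * (\<Sum>i\<in>UNIV. z' i ^ 6)" by blast
    qed
    have "(\<Sum>x\<in>{..K} \<times> {..K}. l (i, x) * (c ^ fst x * w i ^ snd x)) = 0" for i
    proof -
      have "(\<lambda>n. \<Sum>x\<in>{..K} \<times> {..K}. P (u n) i x * (c ^ fst x * \<zeta> (u n) i ^ snd x))
         \<longlonglongrightarrow> (\<Sum>x\<in>{..K} \<times> {..K}. l (i, x) * (c ^ fst x * w i ^ snd x))"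
      proof (intro tendsto_sum tendsto_mult tendsto_power tendsto_const)
        show "(\<lambda>n. \<zeta> (u n) i) \<longlonglongrightarrow> w i" using w by (simp add: u_def)
        show "(\<lambda>n. P (u n) i x) \<longlonglongrightarrow> l (i, x)" if "x \<in> {..K} \<times> {..K}" for x
          using LIMSEQ_subseq_LIMSEQ[OF l[OF that, of i] t] by (simp add: o_def u_def)
      qed
      moreover have "(\<lambda>n. \<Sum>x\<in>{..K} \<times> {..K}. P (u n) i x * (c ^ fst x * \<zeta> (u n) i ^ snd x)) = (\<lambda>n. 0)"
        using P3[OF zeta] by auto
      ultimately have "(\<lambda>n. 0) \<longlonglongrightarrow> (\<Sum>x\<in>{..K} \<times> {..K}. l (i, x) * (c ^ fst x * w i ^ snd x))" by (simp only:)
      then show ?thesis by (simp only: LIMSEQ_const_iff)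
    qed
    then show ?thesis using s0 gmin by blast
  qed
  show ?thesis
    by (rule exI[of _ K], rule exI[of _ "\<lambda>i x. l (i, x)"]) (use nz lim in blast)
qed

section \<open>Branches of algebraic functions\<close>

text \<open>A \<open>real poly poly\<close> is read as a polynomial in \<open>y\<close> whose
  coefficients are polynomials in the parameter \<open>c\<close>; \<open>evc\<close> fixes the
  parameter.\<close>

definition evc :: "real poly poly \<Rightarrow> real \<Rightarrow> real poly" where
  "evc P c = map_poly (\<lambda>q. poly q c) P"

lemma coeff_evc [simp]: "coeff (evc P c) n = poly (coeff P n) c"
  by (simp add: evc_def coeff_map_poly)

lemma evc_add: "evc (P + Q) c = evc P c + evc Q c"
  by (rule poly_eqI) simp

lemma evc_mult: "evc (P * Q) c = evc P c * evc Q c"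
  by (rule poly_eqI) (simp add: coeff_mult poly_sum)

lemma evc_smult: "evc (smult q P) c = smult (poly q c) (evc P c)"
  by (rule poly_eqI) simp

lemma evc_pderiv: "evc (pderiv P) c = pderiv (evc P c)"
  by (rule poly_eqI) (simp add: coeff_pderiv)

lemma evc_eq_0: "evc P c = 0 \<Longrightarrow> poly (lead_coeff P) c = 0"
  by (metis coeff_0 coeff_evc)

text \<open>The polynomial of least degree with at least the roots of \<open>P\<close> is squarefree: otherwise divide it by
  its greatest common divisor with its derivative.\<close>

lemma squarefree_in_second_variable:
  fixes P :: "real poly poly"
  assumes P: "P \<noteq> 0"
  shows "\<exists>Q F. Q \<noteq> 0 \<and> finite F \<and> (\<forall>c. c \<notin> F \<longrightarrow> poly (lead_coeff Q) c \<noteq> 0 \<and>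
    (\<forall>y. poly (evc P c) y = 0 \<longrightarrow> poly (evc Q c) y = 0) \<and>
    (\<forall>y. poly (evc Q c) y = 0 \<longrightarrow> poly (pderiv (evc Q c)) y \<noteq> 0))"
proof -
  define A where "A = (\<lambda>Q. Q \<noteq> 0 \<and> (\<exists>F. finite F \<and> (\<forall>c. c \<notin> F \<longrightarrow> (\<forall>y. poly (evc P c) y = 0 \<longrightarrow> poly (evc Q c) y = 0))))"
  have "A P" using P by (auto simp: A_def intro: exI[of _ "{}"])
  then obtain Q where Q: "A Q" and minQ: "\<And>R. A R \<Longrightarrow> Polynomial.degree Q \<le> Polynomial.degree R"
    using ex_has_least_nat[of A P Polynomial.degree] by blast
  then obtain F where Q0: "Q \<noteq> 0" and F: "finite F"
    "\<And>c y. c \<notin> F \<Longrightarrow> poly (evc P c) y = 0 \<Longrightarrow> poly (evc Q c) y = 0" by (auto simp: A_def)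
  define Q' where "Q' = pderiv Q"
  \<comment> \<open>The ideal generated by \<open>Q\<close> and its derivative. A nonzero element of
    least degree in \<open>y\<close> serves as their greatest common divisor, up to factors
    depending on \<open>c\<close> alone.\<close>
  define Idl where "Idl = (\<lambda>D. D \<noteq> 0 \<and> (\<exists>u v. D = u * Q + v * Q'))"
  have "Idl Q" unfolding Idl_def using Q0 by (intro conjI exI[of _ 1] exI[of _ 0]) auto
  then obtain D where D: "Idl D" and minD: "\<And>R. Idl R \<Longrightarrow> Polynomial.degree D \<le> Polynomial.degree R"
    using ex_has_least_nat[of Idl Q Polynomial.degree] by blast
  obtain u v where uv: "D = u * Q + v * Q'" and D0: "D \<noteq> 0" using D by (auto simp: Idl_def)
  have div: "\<exists>l q. l \<noteq> 0 \<and> smult l R = D * q" if R: "R = a * Q + b * Q'" for R a b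
  proof -
    obtain q r where qr: "pseudo_divmod R D = (q, r)" by fastforce
    \<comment> \<open>Coefficients lie in a ring, not a field, so division by \<open>D\<close> first
      multiplies by a power of its leading coefficient.\<close>
    define l where "l = lead_coeff D ^ (Suc (Polynomial.degree R) - Polynomial.degree D)"
    have l0: "l \<noteq> 0" using D0 by (simp add: l_def)
    have eq: "smult l R = D * q + r" and deg: "r = 0 \<or> Polynomial.degree r < Polynomial.degree D"
      using pseudo_divmod[OF D0 qr] by (auto simp: l_def)
    have "r = ([:l:] * a - q * u) * Q + ([:l:] * b - q * v) * Q'"
      using eq unfolding R uv by (simp add: algebra_simps smult_add_right)
    then have "r = 0 \<or> Idl r" by (auto simp: Idl_def)
    then have "r = 0" using minD deg by fastforce
    then show ?thesis using eq l0 by auto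
  qed
  obtain l1 q1 where l1: "l1 \<noteq> 0" "smult l1 Q = D * q1" using div[of Q 1 0] by auto
  obtain l2 q2 where l2: "l2 \<noteq> 0" "smult l2 Q' = D * q2" using div[of Q' 0 1] by auto
  have q10: "q1 \<noteq> 0" using l1 Q0 by (metis mult_zero_right smult_eq_0_iff)
  have "Polynomial.degree D = 0"
  proof (rule ccontr)
    assume "Polynomial.degree D \<noteq> 0"
    moreover have "Polynomial.degree Q = Polynomial.degree D + Polynomial.degree q1"
      using degree_mult_eq[OF D0 q10] l1 by (metis degree_smult_eq)
    ultimately have lt: "Polynomial.degree q1 < Polynomial.degree Q" by simp
    define F' where "F' = F \<union> {c. poly l1 c = 0} \<union> {c. poly l2 c = 0} \<union> {c. poly (lead_coeff Q) c = 0}"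
    have "finite F'" unfolding F'_def using F(1) l1(1) l2(1) Q0 by (intro finite_UnI poly_roots_finite) auto
    moreover have "poly (evc q1 c) y = 0" if c: "c \<notin> F'" and y: "poly (evc P c) y = 0" for c y
    proof -
      define q where "q = evc Q c"
      have q0: "q \<noteq> 0" using c evc_eq_0 by (auto simp: q_def F'_def)
      have qy: "poly q y = 0" using F(2) c y by (auto simp: q_def F'_def)
      have dq: "pderiv q \<noteq> 0"
      proof
        assume "pderiv q = 0"
        then have "Polynomial.degree q = 0" by (simp add: pderiv_eq_0_iff)
        then obtain k where "q = [:k:]" by (rule degree_eq_zeroE)
        then show False using qy q0 by simp
      qed
      \<comment> \<open>\<open>q1\<close> corresponds to \<open>Q / D\<close>. A root of
        \<open>q\<close> has order one more than in its derivative, and \<open>D\<close> divides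
        both up to constants, so its order in \<open>q1\<close> is at least 1: \<open>q1\<close> has
        the same roots with smaller degree.\<close>
      have ord: "order y q = Suc (order y (pderiv q))"
        by (rule order_pderiv[OF q0 qy])
      have e1: "smult (poly l1 c) q = evc D c * evc q1 c" using l1(2) by (metis evc_mult evc_smult q_def)
      have e2: "smult (poly l2 c) (pderiv q) = evc D c * evc q2 c"
        using l2(2) by (metis evc_mult evc_smult evc_pderiv q_def Q'_def)
      have n1: "evc D c * evc q1 c \<noteq> 0" using c q0 by (simp add: e1[symmetric] F'_def)
      have n2: "evc D c * evc q2 c \<noteq> 0" using c dq by (simp add: e2[symmetric] F'_def)
      have "order y q = order y (evc D c) + order y (evc q1 c)"
        using order_mult[OF n1] order_smult[of "poly l1 c" y q] c by (simp add: e1[symmetric] F'_def)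
      moreover have "order y (pderiv q) = order y (evc D c) + order y (evc q2 c)"
        using order_mult[OF n2] order_smult[of "poly l2 c" y "pderiv q"] c by (simp add: e2[symmetric] F'_def)
      ultimately have "order y (evc q1 c) \<noteq> 0" using ord by linarith
      then show ?thesis using order_root[of "evc q1 c" y] by blast
    qed
    ultimately have "A q1" using q10 unfolding A_def by blast
    then show False using minQ[of q1] lt by simp
  qed
  \<comment> \<open>\<open>D\<close> now depends on \<open>c\<close> alone, and
    \<open>D = u * Q + v * Q'\<close> rules out common roots wherever \<open>d0\<close> does not
    vanish.\<close>
  then obtain d0 where d0: "D = [:d0:]" by (rule degree_eq_zeroE)
  define F' where "F' = F \<union> {c. poly d0 c = 0} \<union> {c. poly (lead_coeff Q) c = 0}"
  have "finite F'" unfolding F'_def using F(1) d0 D0 Q0 by (intro finite_UnI poly_roots_finite) auto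
  moreover have "poly (pderiv (evc Q c)) y \<noteq> 0" if c: "c \<notin> F'" and y: "poly (evc Q c) y = 0" for c y
  proof
    assume "poly (pderiv (evc Q c)) y = 0"
    then have "poly (evc D c) y = 0"
      unfolding uv evc_add evc_mult Q'_def evc_pderiv using y by simp
    moreover have "evc D c = [:poly d0 c:]" unfolding d0 by (rule poly_eqI) (simp add: coeff_pCons split: nat.split)
    ultimately show False using c by (simp add: F'_def)
  qed
  ultimately show ?thesis using Q0 F(2) by (intro exI[of _ Q] exI[of _ F']) (auto simp: F'_def)
qed

text \<open>Near a simple root \<open>G\<close> is strictly monotone in \<open>y\<close>, and its
  sign change across \<open>y0\<close> survives small changes of \<open>c\<close>. Stating this for
  all sufficiently small radii allows one radius to be chosen for finitely many roots at
  once.\<close>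

lemma simple_root_persists:
  fixes G Gy :: "real \<Rightarrow> real \<Rightarrow> real"
  assumes G: "continuous_on UNIV (\<lambda>p. G (fst p) (snd p))" and Gy: "continuous_on UNIV (\<lambda>p. Gy (fst p) (snd p))"
    and der: "\<And>c y. (G c has_real_derivative Gy c y) (at y)"
    and r: "G c y0 = 0" "Gy c y0 \<noteq> 0"
  shows "eventually (\<lambda>e. eventually (\<lambda>c'. \<exists>!y. \<bar>y - y0\<bar> < e \<and> G c' y = 0) (nhds c)) (at_right 0)"
proof -
  \<comment> \<open>Multiplying by the sign of the derivative makes the function increasing in both
    cases.\<close>
  define s where "s = sgn (Gy c y0)"
  have s: "s \<noteq> 0" "s * Gy c y0 > 0" using r(2) by (auto simp: s_def sgn_if)
  have "isCont (\<lambda>p. Gy (fst p) (snd p)) (c, y0)" using Gy by (simp add: continuous_on_eq_continuous_at)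
  then have "isCont (\<lambda>p. s * Gy (fst p) (snd p)) (c, y0)" by (rule continuous_mult_left)
  then have "((\<lambda>p. s * Gy (fst p) (snd p)) \<longlongrightarrow> s * Gy c y0) (nhds (c, y0))"
    unfolding isCont_def using tendsto_at_iff_tendsto_nhds[of "\<lambda>p. s * Gy (fst p) (snd p)" "(c, y0)"] by simp
  then have "eventually (\<lambda>p. s * Gy (fst p) (snd p) > 0) (nhds (c, y0))"
    using s(2) by (rule order_tendstoD(1))
  then obtain \<rho> where rho: "\<rho> > 0" "\<And>p. dist p (c, y0) < \<rho> \<Longrightarrow> s * Gy (fst p) (snd p) > 0"
    by (auto simp: eventually_nhds_metric)
  have box: "s * Gy c' y > 0" if "\<bar>c' - c\<bar> < \<rho> / 2" "\<bar>y - y0\<bar> < \<rho> / 2" for c' y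
  proof -
    have "dist (c', y) (c, y0) \<le> dist c' c + dist y y0"
      unfolding dist_Pair_Pair by (rule sqrt_sum_squares_le_sum) auto
    then show ?thesis using rho(2)[of "(c', y)"] that by (simp add: dist_real_def)
  qed
  have inc: "s * G c' y < s * G c' z" if "\<bar>c' - c\<bar> < \<rho> / 2" "\<bar>y - y0\<bar> < \<rho> / 2" "\<bar>z - y0\<bar> < \<rho> / 2" "y < z" for c' y z
  proof (rule DERIV_pos_imp_increasing[OF that(4)])
    fix x assume x: "y \<le> x" "x \<le> z"
    have "\<bar>x - y0\<bar> < \<rho> / 2" using that x by linarith
    then show "\<exists>m. ((\<lambda>y. s * G c' y) has_real_derivative m) (at x) \<and> 0 < m"
      using DERIV_cmult[OF der[of c' x], of s] box[OF that(1)] by blast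
  qed
  have main: "\<exists>\<delta>>0. \<forall>c'. \<bar>c' - c\<bar> < \<delta> \<longrightarrow> (\<exists>!y. \<bar>y - y0\<bar> < e \<and> G c' y = 0)" if e: "0 < e" "e < \<rho> / 4" for e
  proof -
    have p1: "s * G c (y0 + e) > 0" using inc[of c y0 "y0 + e"] e r(1) rho(1) by simp
    have m1: "s * G c (y0 - e) < 0" using inc[of c "y0 - e" y0] e r(1) rho(1) by simp
    have cc: "((\<lambda>c'. s * G c' y) \<longlongrightarrow> s * G c y) (nhds c)" for y
    proof -
      have "continuous_on UNIV (\<lambda>c'. G (fst (c', y)) (snd (c', y)))"
        by (rule continuous_on_compose2[OF G]) (auto intro!: continuous_intros)
      then have "isCont (\<lambda>c'. s * G c' y) c" by (intro continuous_mult_left) (simp add: continuous_on_eq_continuous_at)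
      then show ?thesis unfolding isCont_def using tendsto_at_iff_tendsto_nhds[of "\<lambda>c'. s * G c' y" c] by simp
    qed
    have "eventually (\<lambda>c'. s * G c' (y0 + e) > 0 \<and> s * G c' (y0 - e) < 0) (nhds c)"
      using order_tendstoD(1)[OF cc p1]
        order_tendstoD(2)[OF cc m1] by eventually_elim simp
    then obtain \<delta> where d: "\<delta> > 0" "\<And>c'. \<bar>c' - c\<bar> < \<delta> \<Longrightarrow> s * G c' (y0 + e) > 0 \<and> s * G c' (y0 - e) < 0"
      by (auto simp: eventually_nhds_metric dist_real_def)
    show ?thesis
    proof (intro exI[of _ "min \<delta> (\<rho> / 2)"] conjI allI impI)
      fix c' assume c': "\<bar>c' - c\<bar> < min \<delta> (\<rho> / 2)"
      have "\<exists>y. y0 - e \<le> y \<and> y \<le> y0 + e \<and> s * G c' y = 0"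
        using d(2)[of c'] c' e by (intro IVT) (auto intro!: continuous_intros DERIV_isCont[OF der])
      then obtain y where y: "y0 - e \<le> y" "y \<le> y0 + e" "s * G c' y = 0" by blast
      have "y \<noteq> y0 - e" "y \<noteq> y0 + e" using y(3) d(2)[of c'] c' by auto
      then have y': "\<bar>y - y0\<bar> < e" "G c' y = 0" using y s(1) by auto
      show "\<exists>!y. \<bar>y - y0\<bar> < e \<and> G c' y = 0"
      proof (rule ex1I[of _ y])
        fix z assume z: "\<bar>z - y0\<bar> < e \<and> G c' z = 0"
        show "z = y"
        proof (rule ccontr)
          assume "z \<noteq> y"
          then consider "z < y" | "y < z" by linarith
          then show False
            using inc[of c' z y] inc[of c' y z] z y' c' e rho(1) by cases auto
        qed
      qed (use y' in blast)
    qed (use d rho in auto)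
  qed
  show ?thesis
    unfolding eventually_at_right_field eventually_nhds_metric dist_real_def
    by (rule exI[of _ "\<rho> / 4"]) (use rho main in auto)
qed

text \<open>Implicit differentiation of a branch already known to be continuous: two mean value
  steps, first in \<open>y\<close> and then in \<open>c\<close>, express the difference quotient of
  \<open>\<xi>\<close> exactly.\<close>

lemma implicit_branch_derivative:
  fixes G Gy Gc :: "real \<Rightarrow> real \<Rightarrow> real"
  assumes Gy: "continuous_on UNIV (\<lambda>p. Gy (fst p) (snd p))" and Gc: "continuous_on UNIV (\<lambda>p. Gc (fst p) (snd p))"
    and dery: "\<And>c y. (G c has_real_derivative Gy c y) (at y)"
    and derc: "\<And>c y. ((\<lambda>c. G c y) has_real_derivative Gc c y) (at c)"
    and xi: "isCont \<xi> c" and root: "eventually (\<lambda>c'. G c' (\<xi> c') = 0) (nhds c)" and nz: "Gy c (\<xi> c) \<noteq> 0"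
  shows "(\<xi> has_real_derivative (- Gc c (\<xi> c) / Gy c (\<xi> c))) (at c)"
proof -
  have mvt: "\<exists>z. \<bar>z - a\<bar> \<le> \<bar>b - a\<bar> \<and> f b - f a = (b - a) * f' z"
    if D: "\<And>x. (f has_real_derivative f' x) (at x)" for f f' :: "real \<Rightarrow> real" and a b
  proof -
    consider "a < b" | "b < a" | "a = b" by linarith
    then show ?thesis
    proof cases
      case 1
      then obtain z where "a < z" "z < b" "f b - f a = (b - a) * f' z" using MVT2[OF 1, of f f', OF D] by blast
      then show ?thesis by (intro exI[of _ z]) auto
    next
      case 2
      then obtain z where z: "b < z" "z < a" "f a - f b = (a - b) * f' z" using MVT2[OF 2, of f f', OF D] by blast
      then have "f b - f a = (b - a) * f' z" by (simp add: algebra_simps)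
      then show ?thesis using z by (intro exI[of _ z]) auto
    qed auto
  qed
  obtain \<eta> where eta: "\<And>c'. \<bar>\<eta> c' - \<xi> c\<bar> \<le> \<bar>\<xi> c' - \<xi> c\<bar>" "\<And>c'. G c' (\<xi> c') - G c' (\<xi> c) = (\<xi> c' - \<xi> c) * Gy c' (\<eta> c')"
  proof -
    have "\<forall>c'. \<exists>z. \<bar>z - \<xi> c\<bar> \<le> \<bar>\<xi> c' - \<xi> c\<bar> \<and> G c' (\<xi> c') - G c' (\<xi> c) = (\<xi> c' - \<xi> c) * Gy c' z"
      using mvt[OF dery] by blast
    from choice[OF this] show thesis using that by blast
  qed
  obtain \<tau> where tau: "\<And>c'. \<bar>\<tau> c' - c\<bar> \<le> \<bar>c' - c\<bar>" "\<And>c'. G c' (\<xi> c) - G c (\<xi> c) = (c' - c) * Gc (\<tau> c') (\<xi> c)"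
  proof -
    have "\<forall>c'. \<exists>z. \<bar>z - c\<bar> \<le> \<bar>c' - c\<bar> \<and> G c' (\<xi> c) - G c (\<xi> c) = (c' - c) * Gc z (\<xi> c)"
      using mvt[OF derc] by blast
    from choice[OF this] show thesis using that by blast
  qed
  have xi': "(\<xi> \<longlongrightarrow> \<xi> c) (at c)" using xi by (simp add: isCont_def)
  have eta': "(\<eta> \<longlongrightarrow> \<xi> c) (at c)"
  proof (rule LIM_zero_cancel, rule Lim_null_comparison)
    show "eventually (\<lambda>c'. norm (\<eta> c' - \<xi> c) \<le> \<bar>\<xi> c' - \<xi> c\<bar>) (at c)" using eta(1) by simp
    show "((\<lambda>c'. \<bar>\<xi> c' - \<xi> c\<bar>) \<longlongrightarrow> 0) (at c)" using tendsto_rabs[OF LIM_zero[OF xi']] by simp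
  qed
  have tau': "(\<tau> \<longlongrightarrow> c) (at c)"
  proof (rule LIM_zero_cancel, rule Lim_null_comparison)
    show "eventually (\<lambda>c'. norm (\<tau> c' - c) \<le> \<bar>c' - c\<bar>) (at c)" using tau(1) by simp
    show "((\<lambda>c'. \<bar>c' - c\<bar>) \<longlongrightarrow> 0) (at c)" using tendsto_rabs[OF LIM_zero[OF tendsto_ident_at]] by simp
  qed
  have cont2: "((\<lambda>c'. H (f c') (g c')) \<longlongrightarrow> H a b) (at c)"
    if "continuous_on UNIV (\<lambda>p. H (fst p) (snd p))" "(f \<longlongrightarrow> a) (at c)" "(g \<longlongrightarrow> b) (at c)" for H :: "real \<Rightarrow> real \<Rightarrow> real" and f g :: "real \<Rightarrow> real" and a b
  proof -
    have "isCont (\<lambda>p. H (fst p) (snd p)) (a, b)" using that(1) by (simp add: continuous_on_eq_continuous_at)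
    from isCont_tendsto_compose[OF this tendsto_Pair[OF that(2,3)]] show ?thesis by simp
  qed
  have ly: "((\<lambda>c'. Gy c' (\<eta> c')) \<longlongrightarrow> Gy c (\<xi> c)) (at c)" by (rule cont2[OF Gy tendsto_ident_at eta'])
  have lc: "((\<lambda>c'. Gc (\<tau> c') (\<xi> c)) \<longlongrightarrow> Gc c (\<xi> c)) (at c)" by (rule cont2[OF Gc tau' tendsto_const])
  have quot: "((\<lambda>c'. - Gc (\<tau> c') (\<xi> c) / Gy c' (\<eta> c')) \<longlongrightarrow> - Gc c (\<xi> c) / Gy c (\<xi> c)) (at c)"
    by (intro tendsto_intros ly lc nz)
  have G0: "G c (\<xi> c) = 0" using eventually_nhds_x_imp_x[OF root] .
  have "eventually (\<lambda>c'. G c' (\<xi> c') = 0) (at c)" using root by (simp add: eventually_at_filter eventually_mono)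
  moreover have "eventually (\<lambda>c'. Gy c' (\<eta> c') \<noteq> 0) (at c)" using tendsto_imp_eventually_ne[OF ly nz] .
  moreover have "eventually (\<lambda>c'. c' \<noteq> c) (at c)" by (simp add: eventually_at_filter)
  ultimately have "eventually (\<lambda>c'. - Gc (\<tau> c') (\<xi> c) / Gy c' (\<eta> c') = (\<xi> c' - \<xi> c) / (c' - c)) (at c)"
  proof eventually_elim
    case (elim c')
    have "(\<xi> c' - \<xi> c) * Gy c' (\<eta> c') = - ((c' - c) * Gc (\<tau> c') (\<xi> c))"
      using eta(2)[of c'] tau(2)[of c'] elim G0 by simp
    then show ?case using elim by (simp add: field_simps)
  qed
  then have "((\<lambda>c'. (\<xi> c' - \<xi> c) / (c' - c)) \<longlongrightarrow> - Gc c (\<xi> c) / Gy c (\<xi> c)) (at c)"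
    by (rule Lim_transform_eventually[OF quot])
  then show ?thesis by (simp add: has_field_derivative_iff)
qed

text \<open>Simple roots persist, and no new ones appear, since by the local bound they would
  accumulate at a further root. So the number of roots is constant on the interval, and the
  \<open>j\<close>-th root in increasing order is a continuous branch.\<close>

lemma root_branches:
  fixes G Gy Gc :: "real \<Rightarrow> real \<Rightarrow> real"
  assumes G: "continuous_on UNIV (\<lambda>p. G (fst p) (snd p))"
    and Gy: "continuous_on UNIV (\<lambda>p. Gy (fst p) (snd p))" and Gc: "continuous_on UNIV (\<lambda>p. Gc (fst p) (snd p))"
    and dery: "\<And>c y. (G c has_real_derivative Gy c y) (at y)"
    and derc: "\<And>c y. ((\<lambda>c. G c y) has_real_derivative Gc c y) (at c)"
    and fin: "\<And>c. c \<in> {c0<..<c1} \<Longrightarrow> finite {y. G c y = 0}"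
    and simple: "\<And>c y. c \<in> {c0<..<c1} \<Longrightarrow> G c y = 0 \<Longrightarrow> Gy c y \<noteq> 0"
    and bdd: "\<And>c. c \<in> {c0<..<c1} \<Longrightarrow> \<exists>b. eventually (\<lambda>c'. \<forall>y. G c' y = 0 \<longrightarrow> \<bar>y\<bar> \<le> b) (nhds c)"
  shows "\<exists>N \<xi>. \<forall>c\<in>{c0<..<c1}. {y. G c y = 0} = (\<lambda>j. \<xi> j c) ` {..<N::nat} \<and>
    (\<forall>j<N. (\<xi> j has_real_derivative (- Gc c (\<xi> j c) / Gy c (\<xi> j c))) (at c))"
proof -
  define I where "I = {c0<..<c1}"
  define R where "R = (\<lambda>c. {y. G c y = 0})"
  define L where "L = (\<lambda>c. sorted_list_of_set (R c))"
  define n where "n = (\<lambda>c. card (R c))"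
  have finR: "finite (R c)" if "c \<in> I" for c using fin that by (simp add: R_def I_def)
  have opI: "eventually (\<lambda>c'. c' \<in> I) (nhds c)" if "c \<in> I" for c
    using that unfolding I_def by (intro eventually_nhds_in_open) auto
  have setL: "set (L c) = R c" "length (L c) = n c" "sorted_wrt (<) (L c)" if "c \<in> I" for c
    using finR[OF that] by (simp_all add: L_def n_def)
  have outside: "eventually (\<lambda>c'. \<forall>z. G c' z = 0 \<longrightarrow> (\<exists>y\<in>R c. \<bar>z - y\<bar> < e)) (nhds c)" if c: "c \<in> I" and e: "e > 0" for c e
  proof (rule ccontr)
    assume neg: "\<not> ?thesis"
    obtain b \<delta> where b: "\<delta> > 0" "\<And>c' y. \<bar>c' - c\<bar> < \<delta> \<Longrightarrow> G c' y = 0 \<Longrightarrow> \<bar>y\<bar> \<le> b"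
      using bdd[of c] c unfolding I_def eventually_nhds_metric dist_real_def by blast
    have "\<exists>c' z. \<bar>c' - c\<bar> < min \<delta> (1 / real (Suc m)) \<and> G c' z = 0 \<and> (\<forall>y\<in>R c. e \<le> \<bar>z - y\<bar>)" for m
    proof (rule ccontr)
      assume no: "\<not> ?thesis"
      have "min \<delta> (1 / real (Suc m)) > 0" using b by simp
      moreover have "\<forall>c'. dist c' c < min \<delta> (1 / real (Suc m)) \<longrightarrow> (\<forall>z. G c' z = 0 \<longrightarrow> (\<exists>y\<in>R c. \<bar>z - y\<bar> < e))"
        using no unfolding dist_real_def by (meson not_le)
      ultimately show False using neg unfolding eventually_nhds_metric by blast
    qed
    then obtain cs zs where cz: "\<And>m. \<bar>cs m - c\<bar> < min \<delta> (1 / real (Suc m))" "\<And>m. G (cs m) (zs m) = 0"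
      "\<And>m y. y \<in> R c \<Longrightarrow> e \<le> \<bar>zs m - y\<bar>" by metis
    have "bounded (range zs)" unfolding bounded_iff using b(2) cz(1,2) by (intro exI[of _ b]) auto
    then obtain l r where r: "strict_mono (r :: nat \<Rightarrow> nat)" "(zs \<circ> r) \<longlonglongrightarrow> l"
      using bounded_imp_convergent_subsequence by metis
    have cs: "cs \<longlonglongrightarrow> c"
    proof (rule LIM_zero_cancel, rule Lim_null_comparison)
      show "eventually (\<lambda>m. norm (cs m - c) \<le> inverse (real (Suc m))) sequentially"
        using cz(1) by (auto simp: inverse_eq_divide less_imp_le intro!: always_eventually)
    qed (rule LIMSEQ_inverse_real_of_nat)
    have "isCont (\<lambda>p. G (fst p) (snd p)) (c, l)" using G by (simp add: continuous_on_eq_continuous_at)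
    from isCont_tendsto_compose[OF this tendsto_Pair[OF LIMSEQ_subseq_LIMSEQ[OF cs r(1)] r(2)]]
    have "(\<lambda>m. 0) \<longlonglongrightarrow> G c l" using cz(2) by (simp add: o_def)
    then have "G c l = 0" by (simp add: LIMSEQ_const_iff)
    then have "e \<le> \<bar>(zs \<circ> r) m - l\<bar>" for m using cz(3) by (simp add: R_def)
    moreover have "(\<lambda>m. \<bar>(zs \<circ> r) m - l\<bar>) \<longlonglongrightarrow> 0" using tendsto_rabs[OF LIM_zero[OF r(2)]] by simp
    ultimately have "e \<le> 0" by (intro LIMSEQ_le_const) auto
    then show False using e by simp
  qed
  have near_roots: "eventually (\<lambda>c'. n c' = n c \<and> (\<forall>j<n c. \<bar>L c' ! j - L c ! j\<bar> < e)) (nhds c)" if c: "c \<in> I" and e: "e > 0" for c e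
  proof -
    have "\<forall>y\<in>R c. eventually (\<lambda>\<epsilon>. eventually (\<lambda>c'. \<exists>!z. \<bar>z - y\<bar> < \<epsilon> \<and> G c' z = 0) (nhds c)) (at_right 0)"
      using simple c by (intro ballI simple_root_persists[OF G Gy dery]) (auto simp: R_def I_def)
    then have ev1: "eventually (\<lambda>\<epsilon>. \<forall>y\<in>R c. eventually (\<lambda>c'. \<exists>!z. \<bar>z - y\<bar> < \<epsilon> \<and> G c' z = 0) (nhds c)) (at_right 0)"
      using finR[OF c] by (intro eventually_ball_finite) auto
    have "\<forall>p\<in>R c \<times> R c. eventually (\<lambda>\<epsilon>. fst p < snd p \<longrightarrow> 2 * \<epsilon> < snd p - fst p) (at_right 0)"
    proof
      fix p :: "real \<times> real"
      show "eventually (\<lambda>\<epsilon>. fst p < snd p \<longrightarrow> 2 * \<epsilon> < snd p - fst p) (at_right 0)"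
      proof (cases "fst p < snd p")
        case True
        then show ?thesis unfolding eventually_at_right_field by (intro exI[of _ "(snd p - fst p) / 2"]) auto
      qed simp
    qed
    then have ev2: "eventually (\<lambda>\<epsilon>. \<forall>p\<in>R c \<times> R c. fst p < snd p \<longrightarrow> 2 * \<epsilon> < snd p - fst p) (at_right 0)"
      using finR[OF c] by (intro eventually_ball_finite) auto
    have ev3: "eventually (\<lambda>\<epsilon>. 0 < \<epsilon> \<and> \<epsilon> < e) (at_right (0::real))"
      unfolding eventually_at_right_field using e by blast
    obtain \<epsilon> where eps: "0 < \<epsilon>" "\<epsilon> < e"
      and sep: "\<And>y z. y \<in> R c \<Longrightarrow> z \<in> R c \<Longrightarrow> y < z \<Longrightarrow> 2 * \<epsilon> < z - y"
      and uniq: "\<forall>y\<in>R c. eventually (\<lambda>c'. \<exists>!z. \<bar>z - y\<bar> < \<epsilon> \<and> G c' z = 0) (nhds c)"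
      using eventually_happens[OF eventually_conj[OF ev1 eventually_conj[OF ev2 ev3]]] by fastforce
    have "eventually (\<lambda>c'. \<forall>y\<in>R c. \<exists>!z. \<bar>z - y\<bar> < \<epsilon> \<and> G c' z = 0) (nhds c)"
      using uniq finR[OF c] by (intro eventually_ball_finite) auto
    then show ?thesis using outside[OF c eps(1)] opI[OF c]
    proof eventually_elim
      case (elim c')
      define r where "r = (\<lambda>j. THE z. \<bar>z - L c ! j\<bar> < \<epsilon> \<and> G c' z = 0)"
      have memL: "L c ! j \<in> R c" if "j < n c" for j using setL[OF c] that nth_mem by metis
      have r: "\<bar>r j - L c ! j\<bar> < \<epsilon> \<and> G c' (r j) = 0" if "j < n c" for j
        unfolding r_def by (rule theI') (use elim(1) memL[OF that] in blast)
      \<comment> \<open>The radius is below half of every gap between roots, so the perturbed roots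
        keep their order.\<close>
      have mono: "r i < r j" if "i < j" "j < n c" for i j
      proof -
        have "L c ! i < L c ! j" using setL[OF c] that by (simp add: sorted_wrt_nth_less)
        then have "2 * \<epsilon> < L c ! j - L c ! i" using sep memL that by auto
        then show ?thesis using r[of i] r[of j] that by fastforce
      qed
      have R': "R c' = r ` {..<n c}"
      proof
        show "r ` {..<n c} \<subseteq> R c'" using r by (auto simp: R_def)
        show "R c' \<subseteq> r ` {..<n c}"
        proof
          fix z assume z: "z \<in> R c'"
          then obtain y where y: "y \<in> R c" "\<bar>z - y\<bar> < \<epsilon>" using elim(2) by (auto simp: R_def)
          then obtain j where j: "j < n c" "y = L c ! j" using setL[OF c] by (metis in_set_conv_nth)
          have "z = r j" using elim(1)[rule_format, OF y(1)] y z r[OF j(1)] j(2) by (auto simp: R_def)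
          then show "z \<in> r ` {..<n c}" using j by blast
        qed
      qed
      \<comment> \<open>A sorted list of distinct elements is determined by its set; the
        \<open>j\<close>-th root at \<open>c'\<close> is therefore the one close to the
        \<open>j\<close>-th root at \<open>c\<close>.\<close>
      have "L c' = map r [0..<n c]"
      proof (rule sorted_distinct_set_unique)
        have st: "sorted_wrt (<) (map r [0..<n c])"
          unfolding sorted_wrt_iff_nth_less using mono by auto
        then show "sorted (map r [0..<n c])" "distinct (map r [0..<n c])"
          by (auto simp: strict_sorted_iff)
        show "set (L c') = set (map r [0..<n c])" using setL[OF elim(3)] R' by (auto simp: atLeast0LessThan)
      qed (use finR[OF elim(3)] in \<open>auto simp: L_def\<close>)
      moreover from this have "n c' = n c" using setL(2)[OF elim(3)] by simp
      ultimately show ?case using r eps(2) by fastforce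
    qed
  qed
  show ?thesis
  proof (cases "I = {}")
    case True
    then show ?thesis by (intro exI[of _ 0]) (auto simp: I_def)
  next
    case False
    then obtain a where a: "a \<in> I" by blast
    have conn: "connected I" unfolding I_def by simp
    have const: "n c = n a" if "c \<in> I" for c
    proof (rule connected_local_const[OF conn that a])
      show "\<forall>x\<in>I. eventually (\<lambda>b. n x = n b) (at x within I)"
      proof
        fix x assume x: "x \<in> I"
        have "eventually (\<lambda>b. n x = n b) (nhds x)" using near_roots[OF x zero_less_one] by eventually_elim auto
        then show "eventually (\<lambda>b. n x = n b) (at x within I)" unfolding eventually_at_filter by eventually_elim auto
      qed
    qed
    define \<xi> where "\<xi> = (\<lambda>j c. L c ! j)"
    have img: "R c = (\<lambda>j. \<xi> j c) ` {..<n a}" if c: "c \<in> I" for c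
      using setL(1,2)[OF c] const[OF c] by (auto simp: \<xi>_def set_conv_nth)
    have "(\<xi> j has_real_derivative (- Gc c (\<xi> j c) / Gy c (\<xi> j c))) (at c)" if c: "c \<in> I" and j: "j < n a" for c j
    proof (rule implicit_branch_derivative[OF Gy Gc dery derc])
      show "isCont (\<xi> j) c"
        unfolding isCont_def tendsto_at_iff_tendsto_nhds
      proof (rule tendstoI)
        fix e :: real assume "e > 0"
        from near_roots[OF c this] show "eventually (\<lambda>x. dist (\<xi> j x) (\<xi> j c) < e) (nhds c)"
          by eventually_elim (use j const[OF c] in \<open>auto simp: \<xi>_def dist_real_def\<close>)
      qed
      show "eventually (\<lambda>c'. G c' (\<xi> j c') = 0) (nhds c)"
        using opI[OF c] by eventually_elim (use img j in \<open>auto simp: R_def\<close>)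
      have "\<xi> j c \<in> R c" using img[OF c] j by blast
      then show "Gy c (\<xi> j c) \<noteq> 0" using simple c by (auto simp: R_def I_def)
    qed
    then show ?thesis using img by (intro exI[of _ "n a"] exI[of _ \<xi>]) (auto simp: I_def R_def)
  qed
qed

section \<open>Roots of bivariate polynomials\<close>

lemma poly_evc: "poly (evc P c) y = (\<Sum>b\<le>Polynomial.degree P. poly (coeff P b) c * y ^ b)"
proof -
  have "Polynomial.degree (evc P c) \<le> Polynomial.degree P"
    by (rule degree_le) (simp add: coeff_eq_0)
  then have "(\<Sum>b\<le>Polynomial.degree P. coeff (evc P c) b * y ^ b) = (\<Sum>b\<le>Polynomial.degree (evc P c). coeff (evc P c) b * y ^ b)"
    by (intro sum.mono_neutral_right) (auto simp: coeff_eq_0 simp del: coeff_evc)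
  then show ?thesis by (simp add: poly_altdef[of "evc P c"])
qed

lemma continuous_poly_evc: "continuous_on UNIV (\<lambda>p. poly (evc P (fst p)) (snd p))"
  unfolding poly_evc
  by (intro continuous_intros continuous_on_compose2[OF continuous_on_poly[OF continuous_on_id]]) auto

lemma poly_evc_deriv_param:
  "((\<lambda>c. poly (evc P c) y) has_real_derivative poly (evc (map_poly pderiv P) c) y) (at c)"
proof -
  have "poly (evc (map_poly pderiv P) c) y = (\<Sum>b\<le>Polynomial.degree P. poly (pderiv (coeff P b)) c * y ^ b)"
  proof -
    have "Polynomial.degree (map_poly pderiv P) \<le> Polynomial.degree P" 
      by (rule degree_le) (simp add: coeff_map_poly coeff_eq_0)
    moreover have "pderiv (coeff P i) = 0" if "Polynomial.degree (map_poly pderiv P) < i" for i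
      using coeff_eq_0[OF that] by (simp add: coeff_map_poly)
    ultimately have "(\<Sum>b\<le>Polynomial.degree P. poly (pderiv (coeff P b)) c * y ^ b)
       = (\<Sum>b\<le>Polynomial.degree (map_poly pderiv P). poly (coeff (map_poly pderiv P) b) c * y ^ b)"
      by (intro sum.mono_neutral_cong_right) (auto simp: coeff_map_poly not_le)
    then show ?thesis by (simp add: poly_evc)
  qed
  then show ?thesis unfolding poly_evc[of P]
    by (auto intro!: derivative_eq_intros poly_DERIV)
qed

text \<open>Cauchy's bound: a root of absolute value above 1 is at most the sum of the absolute
  lower coefficients divided by that of the leading one, a function continuous at
  \<open>c\<close>.\<close>

lemma roots_locally_bounded:
  fixes Q :: "real poly poly"
  assumes lc: "poly (lead_coeff Q) c \<noteq> 0"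
  shows "\<exists>b. eventually (\<lambda>c'. \<forall>y. poly (evc Q c') y = 0 \<longrightarrow> \<bar>y\<bar> \<le> b) (nhds c)"
proof -
  define n where "n = Polynomial.degree Q"
  define S where "S = (\<lambda>c'. (\<Sum>b<n. \<bar>poly (coeff Q b) c'\<bar>) / \<bar>poly (lead_coeff Q) c'\<bar>)"
  have "isCont S c" unfolding S_def using lc by (intro continuous_intros) auto
  then have tS: "(S \<longlongrightarrow> S c) (nhds c)"
    unfolding isCont_def using tendsto_at_iff_tendsto_nhds[of S c] by simp
  have "isCont (\<lambda>c'. poly (lead_coeff Q) c') c" by (intro continuous_intros)
  then have tl: "((\<lambda>c'. poly (lead_coeff Q) c') \<longlongrightarrow> poly (lead_coeff Q) c) (nhds c)"
    unfolding isCont_def using tendsto_at_iff_tendsto_nhds[of "\<lambda>c'. poly (lead_coeff Q) c'" c] by simp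
  have "eventually (\<lambda>c'. S c' < S c + 1) (nhds c)" using order_tendstoD(2)[OF tS, of "S c + 1"] by simp
  moreover have "eventually (\<lambda>c'. poly (lead_coeff Q) c' \<noteq> 0) (nhds c)"
    using tendsto_imp_eventually_ne[OF tl lc] .
  ultimately have "eventually (\<lambda>c'. \<forall>y. poly (evc Q c') y = 0 \<longrightarrow> \<bar>y\<bar> \<le> max 1 (S c + 1)) (nhds c)"
  proof eventually_elim
    case (elim c')
    show ?case
    proof (intro allI impI)
      fix y assume y: "poly (evc Q c') y = 0"
      show "\<bar>y\<bar> \<le> max 1 (S c + 1)"
      proof (cases "\<bar>y\<bar> \<le> 1")
        case False
        have "0 = (\<Sum>b\<in>insert n {..<n}. poly (coeff Q b) c' * y ^ b)"
          using y unfolding poly_evc n_def[symmetric] by (simp add: lessThan_Suc_atMost[symmetric] lessThan_Suc)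
        then have "poly (coeff Q n) c' * y ^ n = - (\<Sum>b<n. poly (coeff Q b) c' * y ^ b)" by simp
        then have "\<bar>poly (coeff Q n) c'\<bar> * \<bar>y\<bar> ^ n = \<bar>\<Sum>b<n. poly (coeff Q b) c' * y ^ b\<bar>"
          by (metis abs_minus_cancel abs_mult power_abs)
        also have "\<dots> \<le> (\<Sum>b<n. \<bar>poly (coeff Q b) c'\<bar> * \<bar>y\<bar> ^ (n - 1))"
        proof (rule order_trans[OF sum_abs], rule sum_mono)
          fix b assume "b \<in> {..<n}"
          then show "\<bar>poly (coeff Q b) c' * y ^ b\<bar> \<le> \<bar>poly (coeff Q b) c'\<bar> * \<bar>y\<bar> ^ (n - 1)"
            using False by (auto simp: abs_mult power_abs intro!: mult_left_mono power_increasing)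
        qed
        also have "\<dots> = (\<Sum>b<n. \<bar>poly (coeff Q b) c'\<bar>) * \<bar>y\<bar> ^ (n - 1)" by (simp add: sum_distrib_right)
        finally have le: "\<bar>poly (coeff Q n) c'\<bar> * \<bar>y\<bar> ^ n \<le> (\<Sum>b<n. \<bar>poly (coeff Q b) c'\<bar>) * \<bar>y\<bar> ^ (n - 1)" .
        have lpos: "\<bar>poly (coeff Q n) c'\<bar> > 0" using elim(2) by (simp add: n_def)
        have npos: "n > 0"
        proof (rule ccontr)
          assume "\<not> n > 0"
          then show False using le lpos by simp
        qed
        have yp: "\<bar>y\<bar> ^ (n - 1) > 0" using False by (intro zero_less_power) simp
        have "\<bar>y\<bar> ^ n = \<bar>y\<bar> * \<bar>y\<bar> ^ (n - 1)" using npos by (simp add: power_eq_if)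
        then have "(\<bar>poly (coeff Q n) c'\<bar> * \<bar>y\<bar>) * \<bar>y\<bar> ^ (n - 1) \<le> (\<Sum>b<n. \<bar>poly (coeff Q b) c'\<bar>) * \<bar>y\<bar> ^ (n - 1)"
          using le by (simp add: mult.assoc)
        then have "\<bar>poly (coeff Q n) c'\<bar> * \<bar>y\<bar> \<le> (\<Sum>b<n. \<bar>poly (coeff Q b) c'\<bar>)" using yp by simp
        then have "\<bar>y\<bar> \<le> S c'" using lpos by (simp add: S_def n_def[symmetric] le_divide_eq mult.commute)
        then show ?thesis using elim(1) by simp
      qed simp
    qed
  qed
  then show ?thesis by blast
qed

text \<open>Exchange the roles of the variables: for fixed \<open>y\<close> the polynomial
  \<open>S y\<close> in \<open>c\<close> has degree at most \<open>M\<close>, whatever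
  \<open>y\<close> is. It vanishes identically only if \<open>y\<close> is a root for every
  \<open>c\<close>, in particular for one at which the leading coefficient is nonzero.\<close>

lemma few_parameters_with_given_root:
  fixes Q :: "real poly poly"
  assumes "Q \<noteq> 0"
  shows "\<exists>M X. finite X \<and> (\<forall>y. y \<notin> X \<longrightarrow> finite {c. poly (evc Q c) y = 0} \<and> card {c. poly (evc Q c) y = 0} \<le> M)"
proof -
  define S where "S = (\<lambda>y. \<Sum>b\<le>Polynomial.degree Q. smult (y ^ b) (coeff Q b))"
  have S: "poly (S y) c = poly (evc Q c) y" for y c
    by (simp add: S_def poly_evc poly_sum mult.commute)
  define M where "M = Max ((\<lambda>b. Polynomial.degree (coeff Q b)) ` {..Polynomial.degree Q})"
  have deg: "Polynomial.degree (S y) \<le> M" for y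
    unfolding S_def
  proof (rule degree_sum_le)
    fix b assume "b \<in> {..Polynomial.degree Q}"
    then have "Polynomial.degree (coeff Q b) \<le> M" unfolding M_def by (intro Max_ge) auto
    then show "Polynomial.degree (smult (y ^ b) (coeff Q b)) \<le> M" using degree_smult_le le_trans by blast
  qed simp
  have "finite {c. poly (lead_coeff Q) c = 0}" using assms by (intro poly_roots_finite) simp
  then obtain c where c: "poly (lead_coeff Q) c \<noteq> 0" using infinite_UNIV_char_0[where 'a = real]
    by (metis (mono_tags, lifting) UNIV_eq_I mem_Collect_eq)
  have "finite {y. S y = 0}"
  proof (rule finite_subset)
    show "{y. S y = 0} \<subseteq> {y. poly (evc Q c) y = 0}" using S[of _ c] by (metis (mono_tags, lifting) mem_Collect_eq poly_0 subsetI)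
    show "finite {y. poly (evc Q c) y = 0}" using c evc_eq_0 by (intro poly_roots_finite) blast
  qed
  moreover have "finite {c. poly (evc Q c) y = 0} \<and> card {c. poly (evc Q c) y = 0} \<le> M" if "y \<notin> {y. S y = 0}" for y
    using that card_poly_roots_bound[of "S y"] deg[of y] poly_roots_finite[of "S y"] by (auto simp: S intro: order_trans)
  ultimately show ?thesis by blast
qed

text \<open>\<open>F\<close> contains the parameters at which roots may collide or escape,
  \<open>X\<close> the values for which a whole horizontal line is a solution, and \<open>M\<close>
  bounds how often a branch takes any other value. All three are independent of the interval, so the
  interval can be chosen after them.\<close>

theorem algebraic_function_branches:
  fixes p :: "nat \<times> nat \<Rightarrow> real"
  assumes nz: "\<exists>x\<in>{..K} \<times> {..K}. p x \<noteq> 0"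
  shows "\<exists>F M X. finite F \<and> finite X \<and> (\<forall>c0 c1. {c0<..<c1} \<inter> F = {} \<longrightarrow>
    (\<exists>N \<xi> \<xi>'. (\<forall>c\<in>{c0<..<c1}. \<forall>y. (\<Sum>x\<in>{..K} \<times> {..K}. p x * (c ^ fst x * y ^ snd x)) = 0 \<longrightarrow> (\<exists>j<N. y = \<xi> j c)) \<and>
      (\<forall>j<N::nat. (\<forall>c\<in>{c0<..<c1}. (\<xi> j has_real_derivative \<xi>' j c) (at c)) \<and> continuous_on {c0<..<c1} (\<xi>' j) \<and>
        (\<forall>y. y \<notin> X \<longrightarrow> finite {c\<in>{c0<..<c1}. \<xi> j c = y} \<and> card {c\<in>{c0<..<c1}. \<xi> j c = y} \<le> M))))"
proof -
  define P :: "real poly poly" where "P = (\<Sum>x\<in>{..K} \<times> {..K}. monom (monom (p x) (fst x)) (snd x))"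
  have evP: "poly (evc P c) y = (\<Sum>x\<in>{..K} \<times> {..K}. p x * (c ^ fst x * y ^ snd x))" for c y
  proof -
    have "evc (sum f A) c = (\<Sum>x\<in>A. evc (f x) c)" for f and A :: "(nat \<times> nat) set"
      by (rule poly_eqI) (simp add: coeff_sum poly_sum)
    moreover have "evc (monom q m) c = monom (poly q c) m" for q m by (rule poly_eqI) simp
    ultimately show ?thesis by (simp add: P_def poly_sum poly_monom mult.assoc)
  qed
  have P0: "P \<noteq> 0"
  proof
    assume "P = 0"
    obtain a b where ab: "a \<le> K" "b \<le> K" "p (a, b) \<noteq> 0" using nz by auto
    have "coeff (coeff P b) a = (\<Sum>x\<in>{..K} \<times> {..K}. if x = (a, b) then p x else 0)"
      unfolding P_def coeff_sum by (intro sum.cong refl) auto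
    also have "\<dots> = p (a, b)" using ab by simp
    finally show False using ab \<open>P = 0\<close> by simp
  qed
  obtain Q F where Q0: "Q \<noteq> 0" and F: "finite F"
    and lc: "\<And>c. c \<notin> F \<Longrightarrow> poly (lead_coeff Q) c \<noteq> 0"
    and rt: "\<And>c y. c \<notin> F \<Longrightarrow> poly (evc P c) y = 0 \<Longrightarrow> poly (evc Q c) y = 0"
    and sq: "\<And>c y. c \<notin> F \<Longrightarrow> poly (evc Q c) y = 0 \<Longrightarrow> poly (pderiv (evc Q c)) y \<noteq> 0"
    using squarefree_in_second_variable[OF P0] by metis
  obtain M X where X: "finite X"
    and M: "\<And>y. y \<notin> X \<Longrightarrow> finite {c. poly (evc Q c) y = 0} \<and> card {c. poly (evc Q c) y = 0} \<le> M"
    using few_parameters_with_given_root[OF Q0] by metis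
  define Gc where "Gc = (\<lambda>c y. poly (evc (map_poly pderiv Q) c) y)"
  define Gy where "Gy = (\<lambda>c y. poly (evc (pderiv Q) c) y)"
  have main: "\<exists>N \<xi> \<xi>'. (\<forall>c\<in>{c0<..<c1}. \<forall>y. (\<Sum>x\<in>{..K} \<times> {..K}. p x * (c ^ fst x * y ^ snd x)) = 0 \<longrightarrow> (\<exists>j<N. y = \<xi> j c)) \<and>
      (\<forall>j<N::nat. (\<forall>c\<in>{c0<..<c1}. (\<xi> j has_real_derivative \<xi>' j c) (at c)) \<and> continuous_on {c0<..<c1} (\<xi>' j) \<and>
        (\<forall>y. y \<notin> X \<longrightarrow> finite {c\<in>{c0<..<c1}. \<xi> j c = y} \<and> card {c\<in>{c0<..<c1}. \<xi> j c = y} \<le> M))"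
    if dis: "{c0<..<c1} \<inter> F = {}" for c0 c1
  proof -
    define I where "I = {c0<..<c1}"
    have nF: "c \<notin> F" if "c \<in> I" for c using dis that by (auto simp: I_def)
    have "\<exists>N \<xi>. \<forall>c\<in>{c0<..<c1}. {y. poly (evc Q c) y = 0} = (\<lambda>j. \<xi> j c) ` {..<N::nat} \<and>
      (\<forall>j<N. (\<xi> j has_real_derivative (- Gc c (\<xi> j c) / Gy c (\<xi> j c))) (at c))"
    proof (rule root_branches)
      show "continuous_on UNIV (\<lambda>p. poly (evc Q (fst p)) (snd p))" by (rule continuous_poly_evc)
      show "continuous_on UNIV (\<lambda>p. Gy (fst p) (snd p))" unfolding Gy_def by (rule continuous_poly_evc)
      show "continuous_on UNIV (\<lambda>p. Gc (fst p) (snd p))" unfolding Gc_def by (rule continuous_poly_evc)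
      show "(poly (evc Q c) has_real_derivative Gy c y) (at y)" for c y
        unfolding Gy_def evc_pderiv by (rule poly_DERIV)
      show "((\<lambda>c. poly (evc Q c) y) has_real_derivative Gc c y) (at c)" for c y
        unfolding Gc_def by (rule poly_evc_deriv_param)
      fix c assume c: "c \<in> {c0<..<c1}"
      then have cF: "c \<notin> F" using nF by (simp add: I_def)
      show "finite {y. poly (evc Q c) y = 0}" using lc[OF cF] evc_eq_0 by (intro poly_roots_finite) blast
      show "\<exists>b. eventually (\<lambda>c'. \<forall>y. poly (evc Q c') y = 0 \<longrightarrow> \<bar>y\<bar> \<le> b) (nhds c)"
        by (rule roots_locally_bounded[OF lc[OF cF]])
      show "Gy c y \<noteq> 0" if "poly (evc Q c) y = 0" for y
        unfolding Gy_def evc_pderiv by (rule sq[OF cF that])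
    qed
    then obtain N \<xi> where img: "\<And>c. c \<in> I \<Longrightarrow> {y. poly (evc Q c) y = 0} = (\<lambda>j. \<xi> j c) ` {..<N::nat}"
      and der: "\<And>c j. c \<in> I \<Longrightarrow> j < N \<Longrightarrow> (\<xi> j has_real_derivative (- Gc c (\<xi> j c) / Gy c (\<xi> j c))) (at c)"
      unfolding I_def by blast
    define \<xi>' where "\<xi>' = (\<lambda>j c. - Gc c (\<xi> j c) / Gy c (\<xi> j c))"
    have root: "poly (evc Q c) (\<xi> j c) = 0" if "c \<in> I" "j < N" for c j using img[OF that(1)] that(2) by blast
    have cont: "continuous_on I (\<xi> j)" if "j < N" for j
      using der that by (auto intro!: continuous_at_imp_continuous_on DERIV_isCont)
    have cont': "continuous_on I (\<xi>' j)" if j: "j < N" for j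
    proof -
      have c2: "continuous_on I (\<lambda>c. poly (evc R c) (\<xi> j c))" for R
        using continuous_on_compose2[OF continuous_poly_evc[of R] continuous_on_Pair[OF continuous_on_id cont[OF j]]] by simp
      show ?thesis unfolding \<xi>'_def Gc_def Gy_def
        by (intro continuous_intros c2) (use sq[OF nF root[OF _ j]] in \<open>auto simp: evc_pderiv\<close>)
    qed
    show ?thesis
    proof (rule exI[of _ N], rule exI[of _ \<xi>], rule exI[of _ \<xi>'], intro conjI ballI allI impI)
      fix c y assume c: "c \<in> {c0<..<c1}" and y: "(\<Sum>x\<in>{..K} \<times> {..K}. p x * (c ^ fst x * y ^ snd x)) = 0"
      then have "poly (evc Q c) y = 0" using rt[of c y] nF[of c] evP by (simp add: I_def)
      then have "y \<in> (\<lambda>j. \<xi> j c) ` {..<N}" using img[of c] c unfolding I_def by blast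
      then show "\<exists>j<N. y = \<xi> j c" by auto
    next
      fix j c assume "j < N" "c \<in> {c0<..<c1}"
      then show "(\<xi> j has_real_derivative \<xi>' j c) (at c)" unfolding \<xi>'_def by (intro der) (simp_all add: I_def)
    next
      fix j assume "j < N"
      then show "continuous_on {c0<..<c1} (\<xi>' j)" using cont' by (simp add: I_def)
    next
      fix j y assume j: "j < N" and y: "y \<notin> X"
      have sub: "{c \<in> {c0<..<c1}. \<xi> j c = y} \<subseteq> {c. poly (evc Q c) y = 0}" using root j by (auto simp: I_def)
      then show "finite {c \<in> {c0<..<c1}. \<xi> j c = y}" using M[OF y] finite_subset by blast
      show "card {c \<in> {c0<..<c1}. \<xi> j c = y} \<le> M" using card_mono[OF _ sub] M[OF y] by linarith
    qed
  qed
  show ?thesis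
    by (rule exI[of _ F], rule exI[of _ M], rule exI[of _ X]) (use F X main in blast)
qed

text \<open>Total variation is the integral over \<open>y\<close> of the number of crossings of the level \<open>y\<close>.\<close>

lemma variation_bound:
  fixes \<eta> \<eta>' :: "real \<Rightarrow> real"
  assumes ab: "a \<le> b" and B: "B \<ge> 0"
    and der: "\<And>t. t \<in> {a..b} \<Longrightarrow> (\<eta> has_real_derivative \<eta>' t) (at t)"
    and cont: "continuous_on {a..b} \<eta>'" and bdd: "\<And>t. t \<in> {a..b} \<Longrightarrow> \<bar>\<eta> t\<bar> \<le> B"
    and X: "finite X" and lev: "\<And>y. y \<notin> X \<Longrightarrow> finite {t\<in>{a..b}. \<eta> t = y} \<and> card {t\<in>{a..b}. \<eta> t = y} \<le> M"
  shows "integral {a..b} (\<lambda>t. \<bar>\<eta>' t\<bar>) \<le> 2 * B * real M"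
proof (rule field_le_epsilon)
  fix e0 :: real assume e0: "e0 > 0"
  define e where "e = e0 / (b - a + 1)"
  have e: "e > 0" "e * (b - a) \<le> e0" using e0 ab by (auto simp: e_def field_simps)
  have unif: "uniformly_continuous_on {a..b} \<eta>'" using cont by (rule compact_uniformly_continuous) simp
  then obtain \<delta> where d: "\<delta> > 0" "\<And>s t. s \<in> {a..b} \<Longrightarrow> t \<in> {a..b} \<Longrightarrow> dist t s < \<delta> \<Longrightarrow> dist (\<eta>' t) (\<eta>' s) < e"
    using e(1) unfolding uniformly_continuous_on_def by metis
  obtain n :: nat where n: "real n > (b - a) / \<delta>" "n > 0" using reals_Archimedean2[of "max ((b - a) / \<delta>) 0"]
    by (metis max_less_iff_conj of_nat_0_less_iff)
  define h where "h = (b - a) / real n"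
  have h: "h \<ge> 0" "h < \<delta>" "real n * h = b - a" using n ab d(1) by (auto simp: h_def field_simps)
  define u where "u = (\<lambda>k. a + real k * h)"
  have u0: "u 0 = a" "u n = b" using h by (auto simp: u_def)
  have us: "u (Suc k) = u k + h" for k by (simp add: u_def algebra_simps)
  have mono: "u i \<le> u j" if "i \<le> j" for i j using that h unfolding u_def by (simp add: mult_right_mono)
  have inI: "u k \<in> {a..b}" if "k \<le> n" for k using mono[of 0 k] mono[of k n] that u0 by simp
  have contA: "continuous_on {a..b} (\<lambda>t. \<bar>\<eta>' t\<bar>)" using cont by (intro continuous_intros)
  have intA: "(\<lambda>t. \<bar>\<eta>' t\<bar>) integrable_on {x..y}" if "a \<le> x" "y \<le> b" for x y
    by (rule integrable_continuous_real, rule continuous_on_subset[OF contA]) (use that in auto)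
  have cell: "integral {u k..u (Suc k)} (\<lambda>t. \<bar>\<eta>' t\<bar>) \<le> \<bar>\<eta> (u (Suc k)) - \<eta> (u k)\<bar> + e * h" if k: "k < n" for k
  proof (cases "h = 0")
    case True then show ?thesis by (simp add: us)
  next
    case False
    then have lt: "u k < u (Suc k)" using h by (simp add: us)
    have sub: "t \<in> {a..b}" if "u k \<le> t" "t \<le> u (Suc k)" for t
      using that inI[of k] inI[of "Suc k"] k by simp
    obtain z where z: "u k < z" "z < u (Suc k)" "\<eta> (u (Suc k)) - \<eta> (u k) = (u (Suc k) - u k) * \<eta>' z"
      using MVT2[OF lt, of \<eta> \<eta>'] der sub by blast
    \<comment> \<open>On a cell shorter than \<open>\<delta>\<close> the derivative differs by less
      than \<open>e\<close> from its value at the mean value point, so the integral is close to the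
      increment.\<close>
    have "integral {u k..u (Suc k)} (\<lambda>t. \<bar>\<eta>' t\<bar>) \<le> integral {u k..u (Suc k)} (\<lambda>t. \<bar>\<eta>' z\<bar> + e)"
    proof (rule integral_le)
      show "(\<lambda>t. \<bar>\<eta>' t\<bar>) integrable_on {u k..u (Suc k)}" using inI[of k] inI[of "Suc k"] k by (intro intA) auto
      fix t assume t: "t \<in> {u k..u (Suc k)}"
      have "\<bar>t - z\<bar> \<le> h" using t z(1,2) us[of k] by auto
      then have "dist t z < \<delta>" using h(2) by (simp add: dist_real_def)
      then have "dist (\<eta>' t) (\<eta>' z) < e" using d(2) sub t z by simp
      then show "\<bar>\<eta>' t\<bar> \<le> \<bar>\<eta>' z\<bar> + e" by (simp add: dist_real_def)
    qed auto
    also have "\<dots> = h * (\<bar>\<eta>' z\<bar> + e)" using h by (simp add: us)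
    also have "\<dots> = \<bar>\<eta> (u (Suc k)) - \<eta> (u k)\<bar> + e * h" using z(3) h by (simp add: us abs_mult algebra_simps)
    finally show ?thesis .
  qed
  have split: "integral {a..u k} (\<lambda>t. \<bar>\<eta>' t\<bar>) = (\<Sum>i<k. integral {u i..u (Suc i)} (\<lambda>t. \<bar>\<eta>' t\<bar>))" if "k \<le> n" for k
    using that
  proof (induction k)
    case 0 then show ?case by (simp add: u0)
  next
    case (Suc k)
    have "integral {a..u k} (\<lambda>t. \<bar>\<eta>' t\<bar>) + integral {u k..u (Suc k)} (\<lambda>t. \<bar>\<eta>' t\<bar>) = integral {a..u (Suc k)} (\<lambda>t. \<bar>\<eta>' t\<bar>)"
      using inI[of k] inI[of "Suc k"] Suc.prems mono[of k "Suc k"] by (intro Henstock_Kurzweil_Integration.integral_combine intA) auto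
    then show ?case using Suc by simp
  qed
  \<comment> \<open>The values strictly between those at the ends of cell \<open>k\<close>. Each
    cell with \<open>y \<in> J k\<close> contains an interior solution of
    \<open>\<eta> t = y\<close>, and interiors of different cells are disjoint.\<close>
  define J where "J = (\<lambda>k. {min (\<eta> (u k)) (\<eta> (u (Suc k)))<..<max (\<eta> (u k)) (\<eta> (u (Suc k)))})"
  have cross: "(\<Sum>k<n. indicat_real (J k) y) \<le> real M" if y: "y \<notin> X" for y
  proof -
    define S where "S = {k\<in>{..<n}. y \<in> J k}"
    have "\<exists>t. u k < t \<and> t < u (Suc k) \<and> \<eta> t = y" if "k \<in> S" for k
    proof -
      have k: "k < n" and yJ: "y \<in> J k" using that by (auto simp: S_def)
      have sub: "t \<in> {a..b}" if "u k \<le> t" "t \<le> u (Suc k)" for t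
        using that inI[of k] inI[of "Suc k"] k by simp
      have ck: "\<forall>t. u k \<le> t \<and> t \<le> u (Suc k) \<longrightarrow> isCont \<eta> t" using der sub DERIV_isCont by blast
      have le: "u k \<le> u (Suc k)" using mono by simp
      have "\<exists>t. u k \<le> t \<and> t \<le> u (Suc k) \<and> \<eta> t = y"
      proof (cases "\<eta> (u k) \<le> \<eta> (u (Suc k))")
        case True
        then show ?thesis using IVT[of \<eta> "u k" y "u (Suc k)"] yJ ck le by (auto simp: J_def)
      next
        case False
        then show ?thesis using IVT2[of \<eta> "u (Suc k)" y "u k"] yJ ck le by (auto simp: J_def)
      qed
      then obtain t where t: "u k \<le> t" "t \<le> u (Suc k)" "\<eta> t = y" by blast
      have "t \<noteq> u k" "t \<noteq> u (Suc k)" using t yJ by (auto simp: J_def min_def max_def split: if_splits)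
      then show ?thesis using t by (intro exI[of _ t]) auto
    qed
    then obtain \<tau> where tau: "\<And>k. k \<in> S \<Longrightarrow> u k < \<tau> k \<and> \<tau> k < u (Suc k) \<and> \<eta> (\<tau> k) = y" by metis
    have lt: "\<tau> i < \<tau> j" if "i \<in> S" "j \<in> S" "i < j" for i j
      using tau[OF that(1)] tau[OF that(2)] mono[of "Suc i" j] that(3) by simp
    have "inj_on \<tau> S" by (rule inj_onI) (metis lt less_irrefl nat_neq_iff)
    moreover have "\<tau> ` S \<subseteq> {t\<in>{a..b}. \<eta> t = y}"
    proof
      fix t assume "t \<in> \<tau> ` S"
      then obtain k where k: "k \<in> S" "t = \<tau> k" by blast
      then show "t \<in> {t\<in>{a..b}. \<eta> t = y}" using tau[OF k(1)] inI[of k] inI[of "Suc k"] by (auto simp: S_def)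
    qed
    ultimately have "card S \<le> card {t\<in>{a..b}. \<eta> t = y}" using lev[OF y] by (intro card_inj_on_le[of \<tau>]) auto
    also have "\<dots> \<le> M" using lev[OF y] by simp
    finally have "real (card S) \<le> real M" by simp
    moreover have "(\<Sum>k<n. indicat_real (J k) y) = real (card S)"
      by (simp add: indicator_def S_def sum.If_cases Int_def conj_commute)
    ultimately show ?thesis by simp
  qed
  have J_int: "(indicat_real (J k) has_integral \<bar>\<eta> (u (Suc k)) - \<eta> (u k)\<bar>) {-B..B}" if k: "k < n" for k
  proof -
    have "\<bar>\<eta> (u k)\<bar> \<le> B" "\<bar>\<eta> (u (Suc k))\<bar> \<le> B" using bdd inI k by auto
    then have sub: "J k \<subseteq> {-B..B}" by (auto simp: J_def min_def max_def split: if_splits)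
    have "((\<lambda>_. 1::real) has_integral \<bar>\<eta> (u (Suc k)) - \<eta> (u k)\<bar>) (cbox (min (\<eta> (u k)) (\<eta> (u (Suc k)))) (max (\<eta> (u k)) (\<eta> (u (Suc k)))))"
      using has_integral_const_real[of "1::real" "min (\<eta> (u k)) (\<eta> (u (Suc k)))" "max (\<eta> (u k)) (\<eta> (u (Suc k)))"]
      by (auto simp: min_def max_def abs_if split: if_splits)
    then have "((\<lambda>_. 1::real) has_integral \<bar>\<eta> (u (Suc k)) - \<eta> (u k)\<bar>) (J k)"
      using has_integral_Icc_iff_Ioo[of "\<lambda>_. 1::real"] unfolding J_def by (simp add: box_real)
    then have "((\<lambda>x. if x \<in> J k then 1 else 0::real) has_integral \<bar>\<eta> (u (Suc k)) - \<eta> (u k)\<bar>) {-B..B}"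
      by (simp add: has_integral_restrict[OF sub])
    moreover have "indicat_real (J k) = (\<lambda>x. if x \<in> J k then 1 else 0)" by (auto simp: indicator_def fun_eq_iff)
    ultimately show ?thesis by simp
  qed
  have "(\<Sum>k<n. \<bar>\<eta> (u (Suc k)) - \<eta> (u k)\<bar>) \<le> 2 * B * real M"
  proof -
    have 1: "((\<lambda>y. \<Sum>k<n. indicat_real (J k) y) has_integral (\<Sum>k<n. \<bar>\<eta> (u (Suc k)) - \<eta> (u k)\<bar>)) {-B..B}"
      using J_int by (intro has_integral_sum) auto
    have 2: "((\<lambda>y. if y \<in> X then 0 else (\<Sum>k<n. indicat_real (J k) y)) has_integral (\<Sum>k<n. \<bar>\<eta> (u (Suc k)) - \<eta> (u k)\<bar>)) {-B..B}"
      by (rule has_integral_spike_finite[OF X _ 1]) auto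
    have 3: "((\<lambda>y. real M) has_integral (B - (- B)) * real M) {-B..B}"
      using has_integral_const_real[of "real M" "-B" B] B by simp
    show ?thesis using has_integral_le[OF 2 3] cross by simp
  qed
  moreover have "integral {a..b} (\<lambda>t. \<bar>\<eta>' t\<bar>) \<le> (\<Sum>k<n. \<bar>\<eta> (u (Suc k)) - \<eta> (u k)\<bar> + e * h)"
    using split[of n] u0 cell by (auto intro!: sum_mono)
  moreover have "(\<Sum>k<n. \<bar>\<eta> (u (Suc k)) - \<eta> (u k)\<bar> + e * h) = (\<Sum>k<n. \<bar>\<eta> (u (Suc k)) - \<eta> (u k)\<bar>) + e * (b - a)"
    using h(3) by (simp add: sum.distrib mult.left_commute)
  ultimately show "integral {a..b} (\<lambda>t. \<bar>\<eta>' t\<bar>) \<le> 2 * B * real M + e0" using e(2) by linarith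
qed

section \<open>Gradient flow of the Kuramoto energy\<close>

lemma mono_bounded_converges:
  fixes f :: "real \<Rightarrow> real"
  assumes mono: "\<And>s t. a \<le> s \<Longrightarrow> s \<le> t \<Longrightarrow> f s \<le> f t" and bdd: "\<And>t. a \<le> t \<Longrightarrow> f t \<le> b"
  shows "\<exists>l. (f \<longlongrightarrow> l) at_top"
proof
  define l where "l = Sup (f ` {a..})"
  have bd: "bdd_above (f ` {a..})" using bdd by (intro bdd_aboveI[of _ b]) auto
  show "(f \<longlongrightarrow> l) at_top"
  proof (rule order_tendstoI)
    fix y assume "y < l"
    then obtain s where s: "a \<le> s" "y < f s" unfolding l_def using less_cSup_iff[OF _ bd] by auto
    show "eventually (\<lambda>t. y < f t) at_top"
      using eventually_ge_at_top[of s] by eventually_elim (use s mono in \<open>meson less_le_trans\<close>)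
  next
    fix y assume y: "l < y"
    have "f t \<le> l" if "a \<le> t" for t unfolding l_def using bd that by (intro cSup_upper) auto
    then show "eventually (\<lambda>t. f t < y) at_top"
      by (intro eventually_mono[OF eventually_ge_at_top[of a]] le_less_trans[OF _ y])
  qed
qed

text \<open>Allows a constraint to be differentiated along a branch although it is known to hold
  only at a sequence of parameters.\<close>

lemma accumulated_zeros:
  fixes \<phi> :: "real \<Rightarrow> real"
  assumes der: "(\<phi> has_real_derivative D) (at c)" and cs: "cs \<longlonglongrightarrow> c" "\<And>k. cs k \<noteq> c" and z: "\<And>k. \<phi> (cs k) = 0"
  shows "\<phi> c = 0" "D = 0"
proof -
  have "(\<lambda>k. \<phi> (cs k)) \<longlonglongrightarrow> \<phi> c" using isCont_tendsto_compose[OF DERIV_isCont[OF der] cs(1)] .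
  then show 0: "\<phi> c = 0" using z by (simp add: LIMSEQ_const_iff)
  have lim: "((\<lambda>x. (\<phi> x - \<phi> c) / (x - c)) \<longlongrightarrow> D) (at c)" using der by (simp add: has_field_derivative_iff)
  have "filterlim cs (at c) sequentially" using cs by (auto simp: filterlim_at intro!: always_eventually)
  from filterlim_compose[OF lim this] have "(\<lambda>k. 0) \<longlonglongrightarrow> D" using z 0 by simp
  then show "D = 0" by (simp add: LIMSEQ_const_iff)
qed

text \<open>Gronwall argument with the weight \<open>exp (- 2 * L * t)\<close>: the weighted squared
  distance is nonincreasing and starts at 0.\<close>

lemma descent_curve_forward_unique:
  fixes F :: "'a::euclidean_space \<Rightarrow> 'a"
  assumes Lip: "\<And>a b. norm (F a - F b) \<le> L * norm (a - b)"
    and x: "descent_curve F x" and y: "descent_curve F y" and T: "T \<ge> 0" and eq: "x 0 = y 0"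
  shows "x T = y T"
proof -
  define w where "w = (\<lambda>t. x t - y t)"
  define w' where "w' = (\<lambda>t. - F (x t) - (- F (y t)))"
  have dw: "(w has_vector_derivative w' t) (at t within {0..})" if "t \<ge> 0" for t
    unfolding w_def w'_def using x y that unfolding descent_curve_def
    by (intro has_vector_derivative_diff) auto
  define D where "D = (\<lambda>t. (w t \<bullet> w t) * exp (- 2 * L * t))"
  define D' where "D' = (\<lambda>t. (2 * (w' t \<bullet> w t) - 2 * L * (w t \<bullet> w t)) * exp (- 2 * L * t))"
  have dD: "(D has_real_derivative D' t) (at t within {0..})" if "t \<ge> 0" for t
  proof -
    have "((\<lambda>t. w t \<bullet> w t) has_real_derivative (2 * (w' t \<bullet> w t))) (at t within {0..})"
      using bounded_bilinear.has_vector_derivative[OF bounded_bilinear_inner dw[OF that] dw[OF that]]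
      by (simp add: has_real_derivative_iff_has_vector_derivative inner_commute)
    moreover have "((\<lambda>t. exp (- 2 * L * t)) has_real_derivative exp (- 2 * L * t) * (- 2 * L)) (at t within {0..})"
      by (auto intro!: derivative_eq_intros)
    ultimately show ?thesis unfolding D_def D'_def
      by (rule DERIV_cong[OF DERIV_mult]) (simp add: algebra_simps)
  qed
  have D'neg: "D' t \<le> 0" for t
  proof -
    have "\<bar>w' t \<bullet> w t\<bar> \<le> norm (w' t) * norm (w t)" by (rule Cauchy_Schwarz_ineq2)
    also have "norm (w' t) \<le> L * norm (w t)" using Lip[of "x t" "y t"]
      by (simp add: w'_def w_def norm_minus_commute)
    finally have "\<bar>w' t \<bullet> w t\<bar> \<le> L * (w t \<bullet> w t)"
      by (simp add: power2_norm_eq_inner[symmetric] power2_eq_square mult_right_mono mult.assoc)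
    then show ?thesis unfolding D'_def by (intro mult_nonpos_nonneg) auto
  qed
  have "D T \<le> D 0"
  proof (cases "T = 0")
    case False
    then have "T > 0" using T by simp
    have cont: "continuous_on {0..T} D"
      by (rule DERIV_continuous_on[where D = D'], rule has_field_derivative_subset[OF dD]) auto
    have dD': "(D has_real_derivative D' s) (at s)" if "s > 0" for s
      using dD[of s] at_within_interior[of s "{0..}"] that by simp
    obtain l z where "0 < z" "z < T" "DERIV D z :> l" "D T - D 0 = (T - 0) * l"
      using MVT[OF \<open>T > 0\<close> cont] dD' real_differentiable_def by metis
    then have "D T - D 0 = T * D' z" using dD' DERIV_unique by (metis diff_zero)
    then show ?thesis using D'neg[of z] \<open>T > 0\<close> by (smt (verit) mult_pos_pos mult_nonneg_nonpos)
  qed simp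
  moreover have "D 0 = 0" using eq by (simp add: D_def w_def)
  ultimately have "w T \<bullet> w T \<le> 0" by (simp add: D_def mult_le_0_iff)
  then have "w T = 0" by (metis inner_eq_zero_iff inner_ge_zero order_antisym)
  then show ?thesis by (simp add: w_def)
qed

lemma sin_diff_mvt: "\<exists>s. \<bar>s - b\<bar> \<le> \<bar>a - b\<bar> \<and> sin a - sin b = (a - b) * cos s" for a b :: real
proof -
  consider "a < b" | "b < a" | "a = b" by linarith
  then show ?thesis
  proof cases
    case 1
    then obtain z where "a < z" "z < b" "sin b - sin a = (b - a) * cos z"
      using MVT2[OF 1, of sin cos] DERIV_sin by blast
    then show ?thesis by (intro exI[of _ z]) (auto simp: algebra_simps)
  next
    case 2
    then obtain z where "b < z" "z < a" "sin a - sin b = (a - b) * cos z"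
      using MVT2[OF 2, of sin cos] DERIV_sin by blast
    then show ?thesis by (intro exI[of _ z]) auto
  qed auto
qed

lemma sin_Lipschitz: "\<bar>sin a - sin b\<bar> \<le> \<bar>a - b\<bar>" for a b :: real
proof -
  obtain s where "sin a - sin b = (a - b) * cos s" using sin_diff_mvt by blast
  then show ?thesis using mult_left_mono[OF abs_cos_le_one[of s], of "\<bar>a - b\<bar>"] by (simp add: abs_mult)
qed

lemma cos_Lipschitz: "\<bar>cos a - cos b\<bar> \<le> \<bar>a - b\<bar>" for a b :: real
  using sin_Lipschitz[of "pi / 2 - a" "pi / 2 - b"] by (simp add: sin_diff)

section \<open>Energy, force and Hessian\<close>

locale weighted_graph =
  fixes a :: "'n::finite \<Rightarrow> 'n \<Rightarrow> real"
  assumes a_nonneg: "a u v \<ge> 0" and a_sym: "a u v = a v u"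
begin

definition force :: "real^'n \<Rightarrow> real^'n" where
  "force x = (\<chi> u. \<Sum>v\<in>UNIV. a u v * sin (x $ u - x $ v))"

definition energy :: "real^'n \<Rightarrow> real" where
  "energy x = (1/2) * (\<Sum>u\<in>UNIV. \<Sum>v\<in>UNIV. a u v * (1 - cos (x $ u - x $ v)))"

lemma energy_nonneg: "energy x \<ge> 0"
  unfolding energy_def by (intro mult_nonneg_nonneg sum_nonneg) (auto simp: a_nonneg)

lemma energy_has_derivative: "(energy has_derivative (\<lambda>h. force x \<bullet> h)) (at x)"
proof -
  have "(energy has_derivative (\<lambda>h. (1/2) * (\<Sum>u\<in>UNIV. \<Sum>v\<in>UNIV. a u v * (sin (x $ u - x $ v) * (h $ u - h $ v))))) (at x)"
    unfolding energy_def
    by (auto intro!: derivative_eq_intros bounded_linear.has_derivative[OF bounded_linear_vec_nth] simp: algebra_simps)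
  moreover have "(1/2) * (\<Sum>u\<in>UNIV. \<Sum>v\<in>UNIV. a u v * (sin (x $ u - x $ v) * (h $ u - h $ v))) = force x \<bullet> h" for h
  proof -
    have "(\<Sum>u\<in>UNIV. \<Sum>v\<in>UNIV. a u v * (sin (x $ u - x $ v) * (h $ u - h $ v)))
       = (\<Sum>u\<in>UNIV. \<Sum>v\<in>UNIV. a u v * sin (x $ u - x $ v) * h $ u) - (\<Sum>u\<in>UNIV. \<Sum>v\<in>UNIV. a u v * sin (x $ u - x $ v) * h $ v)"
      by (simp add: sum_subtractf right_diff_distrib mult.assoc)
    also have "(\<Sum>u\<in>UNIV. \<Sum>v\<in>UNIV. a u v * sin (x $ u - x $ v) * h $ v) = (\<Sum>v\<in>UNIV. \<Sum>u\<in>UNIV. - (a v u * sin (x $ v - x $ u) * h $ v))"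
    proof (subst sum.swap, intro sum.cong refl)
      fix v u
      have "sin (x $ u - x $ v) = - sin (x $ v - x $ u)" using sin_minus[of "x $ v - x $ u"] by simp
      then show "a u v * sin (x $ u - x $ v) * h $ v = - (a v u * sin (x $ v - x $ u) * h $ v)" by (simp add: a_sym[of u v])
    qed
    finally have "(\<Sum>u\<in>UNIV. \<Sum>v\<in>UNIV. a u v * (sin (x $ u - x $ v) * (h $ u - h $ v)))
       = 2 * (\<Sum>u\<in>UNIV. \<Sum>v\<in>UNIV. a u v * sin (x $ u - x $ v) * h $ u)" by (simp add: sum_negf)
    then show ?thesis by (simp add: force_def inner_vec_def sum_distrib_right)
  qed
  ultimately show ?thesis by simp
qed

lemma continuous_force: "continuous_on UNIV force"
  unfolding force_def by (intro continuous_intros)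

definition hess :: "real^'n \<Rightarrow> real^'n \<Rightarrow> real^'n" where
  "hess p w = (\<chi> u. \<Sum>v\<in>UNIV. a u v * cos (p $ u - p $ v) * (w $ u - w $ v))"

lemma linear_hess: "linear (hess p)"
  unfolding hess_def
  by (rule linearI) (auto simp: vec_eq_iff algebra_simps sum.distrib[symmetric] sum_subtractf[symmetric] sum_distrib_left intro!: sum.cong)

lemma inner_hess: "hess p w \<bullet> h = (1/2) * (\<Sum>u\<in>UNIV. \<Sum>v\<in>UNIV. a u v * cos (p $ u - p $ v) * ((w $ u - w $ v) * (h $ u - h $ v)))"
proof -
  let ?k = "\<lambda>u v. a u v * cos (p $ u - p $ v)"
  have ks: "?k u v = ?k v u" for u v using cos_minus[of "p $ u - p $ v"] by (simp add: a_sym[of u v])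
  have "(\<Sum>u\<in>UNIV. \<Sum>v\<in>UNIV. ?k u v * ((w $ u - w $ v) * (h $ u - h $ v)))
     = (\<Sum>u\<in>UNIV. \<Sum>v\<in>UNIV. ?k u v * (w $ u - w $ v) * h $ u) + (\<Sum>u\<in>UNIV. \<Sum>v\<in>UNIV. ?k u v * (w $ v - w $ u) * h $ v)"
    unfolding sum.distrib[symmetric] by (intro sum.cong refl) (simp add: algebra_simps)
  also have "(\<Sum>u\<in>UNIV. \<Sum>v\<in>UNIV. ?k u v * (w $ v - w $ u) * h $ v) = (\<Sum>u\<in>UNIV. \<Sum>v\<in>UNIV. ?k u v * (w $ u - w $ v) * h $ u)"
    by (subst sum.swap, intro sum.cong refl) (metis ks)
  finally show ?thesis by (simp add: hess_def inner_vec_def sum_distrib_right)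
qed

lemma hess_sym: "hess p w \<bullet> h = w \<bullet> hess p h"
  unfolding inner_commute[of w] inner_hess by (simp add: mult.commute mult.left_commute)

definition total_weight :: real where "total_weight = (\<Sum>u\<in>UNIV. \<Sum>v\<in>UNIV. a u v)"

lemma total_weight_nonneg: "total_weight \<ge> 0" unfolding total_weight_def by (intro sum_nonneg a_nonneg)

lemma component_sum_bound:
  assumes "\<And>u v. \<bar>k u v\<bar> \<le> a u v * (2 * r)"
  shows "norm (\<chi> u. \<Sum>v\<in>UNIV. k u v) \<le> total_weight * (2 * r)"
proof -
  have "norm (\<chi> u. \<Sum>v\<in>UNIV. k u v) \<le> (\<Sum>u\<in>UNIV. \<bar>\<Sum>v\<in>UNIV. k u v\<bar>)"
    using norm_le_l1_cart[of "\<chi> u. \<Sum>v\<in>UNIV. k u v"] by simp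
  also have "\<dots> \<le> (\<Sum>u\<in>UNIV. \<Sum>v\<in>UNIV. \<bar>k u v\<bar>)" by (intro sum_mono sum_abs)
  also have "\<dots> \<le> (\<Sum>u\<in>UNIV. \<Sum>v\<in>UNIV. a u v * (2 * r))" by (intro sum_mono assms)
  also have "\<dots> = total_weight * (2 * r)" by (simp add: total_weight_def sum_distrib_right)
  finally show ?thesis .
qed

lemma diff_component_le: "\<bar>(x $ u - x $ v) - (y $ u - y $ v)\<bar> \<le> 2 * norm (x - y)" for x y :: "real^'n"
  using component_le_norm_cart[of "x - y" u] component_le_norm_cart[of "x - y" v] by simp

lemma force_Lipschitz: "norm (force x - force y) \<le> (2 * total_weight) * norm (x - y)"
proof -
  have "force x - force y = (\<chi> u. \<Sum>v\<in>UNIV. a u v * (sin (x $ u - x $ v) - sin (y $ u - y $ v)))"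
    by (simp add: force_def vec_eq_iff sum_subtractf right_diff_distrib)
  moreover have "norm (\<chi> u. \<Sum>v\<in>UNIV. a u v * (sin (x $ u - x $ v) - sin (y $ u - y $ v))) \<le> total_weight * (2 * norm (x - y))"
  proof (rule component_sum_bound)
    fix u v
    show "\<bar>a u v * (sin (x $ u - x $ v) - sin (y $ u - y $ v))\<bar> \<le> a u v * (2 * norm (x - y))"
      unfolding abs_mult
      using order_trans[OF sin_Lipschitz[of "x $ u - x $ v" "y $ u - y $ v"] diff_component_le[of x u v y]] a_nonneg[of u v]
      by (intro mult_mono) auto
  qed
  ultimately show ?thesis by simp
qed

text \<open>Strict differentiability, comparing two arbitrary points near \<open>p\<close>: the
  saddle argument linearises the difference of two trajectories. On each edge the error is
  \<open>(A - B) * (cos s - cos C)\<close> with a mean value \<open>s\<close> close to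
  \<open>C\<close>.\<close>

lemma force_strictly_differentiable:
  assumes "\<eta> > 0"
  shows "\<exists>r>0. \<forall>x\<in>ball p r. \<forall>y\<in>ball p r. norm (force x - force y - hess p (x - y)) \<le> \<eta> * norm (x - y)"
proof -
  \<comment> \<open>An edge contributes at most its weight times
    \<open>16 * r * norm (x - y)\<close>; adding 1 to the total weight avoids division by 0.\<close>
  define r where "r = \<eta> / (16 * (total_weight + 1))"
  have r: "r > 0" using assms total_weight_nonneg by (simp add: r_def)
  have "norm (force x - force y - hess p (x - y)) \<le> \<eta> * norm (x - y)" if x: "x \<in> ball p r" and y: "y \<in> ball p r" for x y
  proof -
    let ?d = "\<lambda>u v. sin (x $ u - x $ v) - sin (y $ u - y $ v) - cos (p $ u - p $ v) * ((x $ u - x $ v) - (y $ u - y $ v))"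
    have "force x - force y - hess p (x - y) = (\<chi> u. \<Sum>v\<in>UNIV. a u v * ?d u v)"
      unfolding vec_eq_iff
    proof
      fix u
      show "(force x - force y - hess p (x - y)) $ u = (\<chi> u. \<Sum>v\<in>UNIV. a u v * ?d u v) $ u"
        unfolding force_def hess_def vector_minus_component vec_lambda_beta sum_subtractf[symmetric]
        by (intro sum.cong refl) (simp add: algebra_simps)
    qed
    moreover have "norm (\<chi> u. \<Sum>v\<in>UNIV. a u v * ?d u v) \<le> total_weight * (2 * (8 * r * norm (x - y)))"
    proof (rule component_sum_bound)
      fix u v
      define A where "A = x $ u - x $ v"
      define B where "B = y $ u - y $ v"
      define C where "C = p $ u - p $ v"
      have AB: "\<bar>A - B\<bar> \<le> 2 * norm (x - y)" unfolding A_def B_def by (rule diff_component_le)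
      have AC: "\<bar>A - C\<bar> \<le> 2 * r" "\<bar>B - C\<bar> \<le> 2 * r"
        using diff_component_le[of x u v p] diff_component_le[of y u v p] x y
        by (auto simp: A_def B_def C_def dist_norm norm_minus_commute)
      obtain s where s: "\<bar>s - B\<bar> \<le> \<bar>A - B\<bar>" "sin A - sin B = (A - B) * cos s" using sin_diff_mvt by blast
      have "\<bar>s - C\<bar> \<le> 8 * r" using s(1) AC by linarith
      then have "\<bar>cos s - cos C\<bar> \<le> 8 * r" using cos_Lipschitz[of s C] by linarith
      then have "\<bar>A - B\<bar> * \<bar>cos s - cos C\<bar> \<le> (2 * norm (x - y)) * (8 * r)" using AB by (intro mult_mono) auto
      moreover have "sin A - sin B - cos C * (A - B) = (A - B) * (cos s - cos C)" using s(2) by (simp add: algebra_simps)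
      ultimately have "\<bar>sin A - sin B - cos C * (A - B)\<bar> \<le> 2 * (8 * r * norm (x - y))" by (simp add: abs_mult mult_ac)
      then show "\<bar>a u v * ?d u v\<bar> \<le> a u v * (2 * (8 * r * norm (x - y)))"
        unfolding abs_mult A_def[symmetric] B_def[symmetric] C_def[symmetric] using a_nonneg[of u v]
        by (intro mult_mono) auto
    qed
    moreover have "total_weight * (2 * (8 * r * norm (x - y))) \<le> \<eta> * norm (x - y)"
    proof -
      have "total_weight * (16 * r) \<le> \<eta>" using total_weight_nonneg assms by (simp add: r_def field_simps)
      then show ?thesis using mult_right_mono[of "total_weight * (16 * r)" \<eta> "norm (x - y)"] by simp
    qed
    ultimately show ?thesis by simp
  qed
  then show ?thesis using r by blast
qed

text \<open>Polynomial counterparts of the energy, the force and its squared norm in the coordinates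
  \<open>z (v, True) = cos \<theta>\<^sub>v\<close>, \<open>z (v, False) = sin \<theta>\<^sub>v\<close>; \<open>ts c\<close> vanishes exactly on the energy level \<open>c\<close> of
  the torus.\<close>

definition tf :: "('n \<times> bool \<Rightarrow> real) \<Rightarrow> real" where
  "tf z = (1/2) * (\<Sum>u\<in>UNIV. \<Sum>v\<in>UNIV. a u v * (1 - (z (u, True) * z (v, True) + z (u, False) * z (v, False))))"

definition tF :: "('n \<times> bool \<Rightarrow> real) \<Rightarrow> 'n \<Rightarrow> real" where
  "tF z u = (\<Sum>v\<in>UNIV. a u v * (z (u, False) * z (v, True) - z (u, True) * z (v, False)))"

definition tg :: "('n \<times> bool \<Rightarrow> real) \<Rightarrow> real" where
  "tg z = (\<Sum>u\<in>UNIV. (tF z u)\<^sup>2)"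

definition ts :: "real \<Rightarrow> ('n \<times> bool \<Rightarrow> real) \<Rightarrow> real" where
  "ts c z = (tf z - c)\<^sup>2 + (\<Sum>v\<in>UNIV. ((z (v, True))\<^sup>2 + (z (v, False))\<^sup>2 - 1)\<^sup>2)"

definition embed :: "real^'n \<Rightarrow> 'n \<times> bool \<Rightarrow> real" where
  "embed x i = (if snd i then cos (x $ fst i) else sin (x $ fst i))"

lemma tf_embed: "tf (embed x) = energy x"
  by (simp add: tf_def energy_def embed_def cos_diff)

lemma tF_embed: "tF (embed x) u = force x $ u"
  by (simp add: tF_def force_def embed_def sin_diff)

lemma tg_embed: "tg (embed x) = (norm (force x))\<^sup>2"
  by (simp add: tg_def tF_embed norm_vec_def L2_set_def sum_nonneg)

lemma ts_embed: "ts (energy x) (embed x) = 0"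
  by (simp add: ts_def tf_embed) (simp add: embed_def)

lemma ts_eq_0_iff: "ts c z = 0 \<longleftrightarrow> tf z = c \<and> (\<forall>v. (z (v, True))\<^sup>2 + (z (v, False))\<^sup>2 = 1)"
proof -
  have "(\<Sum>v\<in>UNIV. ((z (v, True))\<^sup>2 + (z (v, False))\<^sup>2 - 1)\<^sup>2) = 0 \<longleftrightarrow> (\<forall>v. (z (v, True))\<^sup>2 + (z (v, False))\<^sup>2 = 1)"
    by (subst sum_nonneg_eq_0_iff) auto
  moreover have "ts c z = 0 \<longleftrightarrow> (tf z - c)\<^sup>2 = 0 \<and> (\<Sum>v\<in>UNIV. ((z (v, True))\<^sup>2 + (z (v, False))\<^sup>2 - 1)\<^sup>2) = 0"
    unfolding ts_def by (intro add_nonneg_eq_0_iff sum_nonneg) auto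
  ultimately show ?thesis by simp
qed

lemma polyf_tg: "polyf 4 2 (\<lambda>c z. tg z)"
proof -
  have m: "polyf 2 0 (\<lambda>c z. z i * z j)" for i j :: "'n \<times> bool"
    using polyf.mult[OF polyf.var[of i] polyf.var[of j]] by (simp add: numeral_2_eq_2)
  have "polyf 2 0 (\<lambda>c z. tF z u)" for u
    unfolding tF_def by (intro polyf_sum polyf_cmult polyf_diff m) auto
  then have "polyf 4 0 (\<lambda>c z. (tF z u)\<^sup>2)" for u
    using polyf_square[of 2 0 "\<lambda>c z. tF z u"] by simp
  then have "polyf 4 0 (\<lambda>c z. tg z)" unfolding tg_def by (intro polyf_sum) auto
  then show ?thesis by (rule polyf.mono) auto
qed

text \<open>A sum of squares of quadratic expressions, hence degree 4 in \<open>z\<close>; the level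
  enters through \<open>(tf z - c)\<^sup>2\<close>.\<close>

lemma polyf_ts: "polyf 4 2 ts"
proof -
  have m: "polyf 2 0 (\<lambda>c z. z i * z j)" for i j :: "'n \<times> bool"
    using polyf.mult[OF polyf.var[of i] polyf.var[of j]] by (simp add: numeral_2_eq_2)
  have "polyf 2 0 (\<lambda>c z. tf z)"
    unfolding tf_def by (intro polyf_cmult polyf_sum polyf_diff polyf.add m polyf_const) auto
  then have "polyf 2 1 (\<lambda>c z. tf z)" by (rule polyf.mono) auto
  moreover have "polyf 2 1 (\<lambda>c (z :: 'n \<times> bool \<Rightarrow> real). c)" using polyf_param[of 2 0] by simp
  ultimately have 1: "polyf 4 2 (\<lambda>c z. (tf z - c)\<^sup>2)"
    using polyf_square[OF polyf_diff, of 2 1 "\<lambda>c z. tf z" "\<lambda>c z. c"] by simp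
  have sq: "polyf 2 0 (\<lambda>c z. (z i)\<^sup>2)" for i :: "'n \<times> bool" using m[of i i] by (simp add: power2_eq_square)
  have "polyf 2 0 (\<lambda>c z. (z (v, True))\<^sup>2 + (z (v, False))\<^sup>2 - 1)" for v :: 'n
    by (intro polyf_diff polyf.add sq polyf_const)
  then have "polyf 4 0 (\<lambda>c z. ((z (v, True))\<^sup>2 + (z (v, False))\<^sup>2 - 1)\<^sup>2)" for v :: 'n
    using polyf_square[of 2 0] by fastforce
  then have "polyf 4 0 (\<lambda>c z. \<Sum>v\<in>(UNIV :: 'n set). ((z (v, True))\<^sup>2 + (z (v, False))\<^sup>2 - 1)\<^sup>2)" by (intro polyf_sum) auto
  then have 2: "polyf 4 2 (\<lambda>c z. \<Sum>v\<in>(UNIV :: 'n set). ((z (v, True))\<^sup>2 + (z (v, False))\<^sup>2 - 1)\<^sup>2)" by (rule polyf.mono) auto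
  have "polyf 4 2 (\<lambda>c z. ts c z)" unfolding ts_def using polyf.add[OF 1 2] .
  then show ?thesis by simp
qed

lemma ts_proper: "ts c z \<le> R \<Longrightarrow> \<bar>z i\<bar> \<le> R + 3"
proof -
  assume R: "ts c z \<le> R"
  obtain v b where i: "i = (v, b)" by fastforce
  define q where "q = (z (v, True))\<^sup>2 + (z (v, False))\<^sup>2 - 1"
  have "q\<^sup>2 \<le> (\<Sum>v\<in>UNIV. ((z (v, True))\<^sup>2 + (z (v, False))\<^sup>2 - 1)\<^sup>2)"
    unfolding q_def by (rule member_le_sum) auto
  also have "\<dots> \<le> R" using R zero_le_power2[of "tf z - c"] unfolding ts_def by linarith
  finally have "q\<^sup>2 \<le> R" .
  moreover have "0 \<le> (q - 1/2)\<^sup>2" by simp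
  ultimately have "q \<le> R + 1" by (simp add: power2_eq_square algebra_simps)
  moreover have "(z i)\<^sup>2 \<le> q + 1" unfolding q_def i by (cases b) auto
  moreover have "\<bar>z i\<bar> \<le> (z i)\<^sup>2 + 1"
  proof -
    have "0 \<le> (\<bar>z i\<bar> - 1/2)\<^sup>2" by simp
    then show ?thesis by (simp add: power2_eq_square algebra_simps)
  qed
  ultimately show "\<bar>z i\<bar> \<le> R + 3" by linarith
qed

text \<open>The talweg (valley line) of D'Acunto and Kurdyka.\<close>

lemma talweg:
  "\<exists>K p. (\<forall>i. \<exists>x\<in>{..K} \<times> {..K}. p i x \<noteq> (0::real)) \<and>
    (\<forall>c. (\<exists>x. energy x = c) \<longrightarrow> (\<exists>z. ts c z = 0 \<and> (\<forall>y. energy y = c \<longrightarrow> tg z \<le> (norm (force y))\<^sup>2) \<and>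
      (\<forall>i. (\<Sum>x\<in>{..K} \<times> {..K}. p i x * (c ^ fst x * z i ^ snd x)) = 0)))"
proof -
  have tg0: "tg z \<ge> 0" for z by (simp add: tg_def sum_nonneg)
  have ts0: "ts c z \<ge> 0" for c z by (simp add: ts_def sum_nonneg)
  have pr: "\<exists>b. \<forall>z i. ts c z \<le> R \<longrightarrow> \<bar>z i\<bar> \<le> b" for c R using ts_proper by blast
  obtain K p where nz: "\<forall>i. \<exists>x\<in>{..K} \<times> {..K}. p i x \<noteq> (0::real)"
    and m: "\<And>c z0. ts c z0 = 0 \<Longrightarrow> \<exists>z. ts c z = 0 \<and> (\<forall>z'. ts c z' = 0 \<longrightarrow> tg z \<le> tg z') \<and>
      (\<forall>i. (\<Sum>x\<in>{..K} \<times> {..K}. p i x * (c ^ fst x * z i ^ snd x)) = 0)"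
    using algebraic_constrained_minimisers[OF polyf_tg tg0 polyf_ts ts0 pr] by blast
  have "\<exists>z. ts c z = 0 \<and> (\<forall>y. energy y = c \<longrightarrow> tg z \<le> (norm (force y))\<^sup>2) \<and>
      (\<forall>i. (\<Sum>x\<in>{..K} \<times> {..K}. p i x * (c ^ fst x * z i ^ snd x)) = 0)" if c: "energy x = c" for c x
  proof -
    have "ts c (embed x) = 0" using ts_embed[of x] c by simp
    from m[OF this] obtain z where z: "ts c z = 0" "\<And>z'. ts c z' = 0 \<Longrightarrow> tg z \<le> tg z'"
      "\<forall>i. (\<Sum>x\<in>{..K} \<times> {..K}. p i x * (c ^ fst x * z i ^ snd x)) = 0" by blast
    have "tg z \<le> (norm (force y))\<^sup>2" if "energy y = c" for y
      using z(2)[of "embed y"] ts_embed[of y] tg_embed[of y] that by simp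
    then show ?thesis using z by blast
  qed
  then show ?thesis using nz by blast
qed

text \<open>Along the branch the energy equals the parameter, so velocity and gradient have inner
  product 1, and a small gradient forces a large velocity. The branch is on the torus and on its
  level only at the parameters \<open>cs k\<close>, which suffices by
  \<open>accumulated_zeros\<close>.\<close>

lemma talweg_slope:
  fixes \<gamma> :: "'n \<times> bool \<Rightarrow> real \<Rightarrow> real"
  assumes der: "\<And>i. (\<gamma> i has_real_derivative \<gamma>' i) (at c)"
    and cs: "cs \<longlonglongrightarrow> c" "\<And>k. cs k \<noteq> c" and on: "\<And>k. ts (cs k) (\<lambda>i. \<gamma> i (cs k)) = 0"
  shows "1 \<le> (\<Sum>i\<in>UNIV. \<bar>\<gamma>' i\<bar>) * sqrt (tg (\<lambda>i. \<gamma> i c))" "\<bar>\<gamma> i c\<bar> \<le> 1"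
proof -
  define T where "T = (\<lambda>u. \<gamma> (u, True) c)"
  define F where "F = (\<lambda>u. \<gamma> (u, False) c)"
  define T' where "T' = (\<lambda>u. \<gamma>' (u, True))"
  define F' where "F' = (\<lambda>u. \<gamma>' (u, False))"
  have circ: "(T u)\<^sup>2 + (F u)\<^sup>2 = 1" "T u * T' u + F u * F' u = 0" for u
  proof -
    define \<phi> where "\<phi> = (\<lambda>s. (\<gamma> (u, True) s)\<^sup>2 + (\<gamma> (u, False) s)\<^sup>2 - 1)"
    have d: "(\<phi> has_real_derivative (2 * (T u * T' u + F u * F' u))) (at c)"
      unfolding \<phi>_def T_def F_def T'_def F'_def
      by (auto intro!: derivative_eq_intros der simp: algebra_simps)
    have z: "\<phi> (cs k) = 0" for k using on[of k] by (simp add: \<phi>_def ts_eq_0_iff)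
    show "(T u)\<^sup>2 + (F u)\<^sup>2 = 1" using accumulated_zeros(1)[OF d cs z] by (simp add: \<phi>_def T_def F_def)
    show "T u * T' u + F u * F' u = 0" using accumulated_zeros(2)[OF d cs z] by simp
  qed
  have le1: "\<bar>T u\<bar> \<le> 1" "\<bar>F u\<bar> \<le> 1" for u
    unfolding abs_square_le_1[symmetric]
    using circ(1)[of u] zero_le_power2[of "T u"] zero_le_power2[of "F u"] by linarith+
  show "\<bar>\<gamma> i c\<bar> \<le> 1" using le1 by (cases i, cases "snd i") (auto simp: T_def F_def)
  \<comment> \<open>The angular velocity at \<open>u\<close>: a vector tangent to the unit circle is
    a multiple of the rotated position.\<close>
  define \<beta> where "\<beta> = (\<lambda>u. T u * F' u - F u * T' u)"
  have T'b: "T' u = - \<beta> u * F u" and F'b: "F' u = \<beta> u * T u" for u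
    using circ[of u] unfolding \<beta>_def by algebra+
  \<comment> \<open>Energy minus level; its vanishing derivative at \<open>c\<close> is the
    normalisation that brings in the 1.\<close>
  define \<psi> where "\<psi> = (\<lambda>s. tf (\<lambda>i. \<gamma> i s) - s)"
  have d: "(\<psi> has_real_derivative ((1/2) * (\<Sum>u\<in>UNIV. \<Sum>v\<in>UNIV. a u v * (- (T' u * T v + T u * T' v + (F' u * F v + F u * F' v)))) - 1)) (at c)"
    unfolding \<psi>_def tf_def T_def F_def T'_def F'_def
    by (auto intro!: derivative_eq_intros der simp: algebra_simps)
  have z: "\<psi> (cs k) = 0" for k using on[of k] by (simp add: \<psi>_def ts_eq_0_iff)
  have "(1/2) * (\<Sum>u\<in>UNIV. \<Sum>v\<in>UNIV. a u v * (- (T' u * T v + T u * T' v + (F' u * F v + F u * F' v)))) = 1"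
    using accumulated_zeros(2)[OF d cs z] by simp
  also have "(\<Sum>u\<in>UNIV. \<Sum>v\<in>UNIV. a u v * (- (T' u * T v + T u * T' v + (F' u * F v + F u * F' v))))
     = (\<Sum>u\<in>UNIV. \<Sum>v\<in>UNIV. - (a u v * (T' u * T v + F' u * F v))) + (\<Sum>u\<in>UNIV. \<Sum>v\<in>UNIV. - (a u v * (T' v * T u + F' v * F u)))"
    unfolding sum.distrib[symmetric] by (intro sum.cong refl) (simp add: algebra_simps)
  also have "(\<Sum>u\<in>UNIV. \<Sum>v\<in>UNIV. - (a u v * (T' v * T u + F' v * F u))) = (\<Sum>u\<in>UNIV. \<Sum>v\<in>UNIV. - (a u v * (T' u * T v + F' u * F v)))"
    by (subst sum.swap, intro sum.cong refl) (simp add: a_sym)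
  also have "(\<Sum>u\<in>UNIV. \<Sum>v\<in>UNIV. - (a u v * (T' u * T v + F' u * F v))) = (\<Sum>u\<in>UNIV. \<beta> u * tF (\<lambda>i. \<gamma> i c) u)"
    unfolding tF_def T'b F'b sum_distrib_left T_def[symmetric]
    by (intro sum.cong refl) (simp add: T_def F_def algebra_simps)
  finally have one: "(\<Sum>u\<in>UNIV. \<beta> u * tF (\<lambda>i. \<gamma> i c) u) = 1" by simp
  have tFb: "\<bar>tF (\<lambda>i. \<gamma> i c) u\<bar> \<le> sqrt (tg (\<lambda>i. \<gamma> i c))" for u
  proof -
    have "(tF (\<lambda>i. \<gamma> i c) u)\<^sup>2 \<le> tg (\<lambda>i. \<gamma> i c)" unfolding tg_def by (rule member_le_sum) auto
    then show ?thesis by (metis real_sqrt_abs real_sqrt_le_mono)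
  qed
  have bb: "\<bar>\<beta> u\<bar> \<le> \<bar>T' u\<bar> + \<bar>F' u\<bar>" for u
  proof -
    have "\<bar>\<beta> u\<bar> \<le> \<bar>T u\<bar> * \<bar>F' u\<bar> + \<bar>F u\<bar> * \<bar>T' u\<bar>"
      unfolding \<beta>_def using abs_triangle_ineq4[of "T u * F' u" "F u * T' u"] by (simp add: abs_mult)
    also have "\<dots> \<le> 1 * \<bar>F' u\<bar> + 1 * \<bar>T' u\<bar>" using le1[of u] by (intro add_mono mult_right_mono) auto
    finally show ?thesis by simp
  qed
  have "1 = \<bar>\<Sum>u\<in>UNIV. \<beta> u * tF (\<lambda>i. \<gamma> i c) u\<bar>" using one by simp
  also have "\<dots> \<le> (\<Sum>u\<in>UNIV. \<bar>\<beta> u\<bar> * \<bar>tF (\<lambda>i. \<gamma> i c) u\<bar>)" by (rule order_trans[OF sum_abs]) (simp add: abs_mult)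
  also have "\<dots> \<le> (\<Sum>u\<in>UNIV. (\<bar>T' u\<bar> + \<bar>F' u\<bar>) * sqrt (tg (\<lambda>i. \<gamma> i c)))"
    using bb tFb by (intro sum_mono mult_mono) auto
  also have "\<dots> = (\<Sum>u\<in>UNIV. \<bar>T' u\<bar> + \<bar>F' u\<bar>) * sqrt (tg (\<lambda>i. \<gamma> i c))" by (simp only: sum_distrib_right)
  also have "(\<Sum>u\<in>UNIV. \<bar>T' u\<bar> + \<bar>F' u\<bar>) = (\<Sum>i\<in>UNIV. \<bar>\<gamma>' i\<bar>)"
  proof -
    have "(\<Sum>i\<in>(UNIV :: ('n \<times> bool) set). \<bar>\<gamma>' i\<bar>) = (\<Sum>u\<in>UNIV. \<Sum>b\<in>UNIV. \<bar>\<gamma>' (u, b)\<bar>)"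
      by (simp add: sum.cartesian_product UNIV_Times_UNIV[symmetric] del: UNIV_Times_UNIV)
    then show ?thesis by (simp add: UNIV_bool T'_def F'_def add.commute)
  qed
  finally show "1 \<le> (\<Sum>i\<in>UNIV. \<bar>\<gamma>' i\<bar>) * sqrt (tg (\<lambda>i. \<gamma> i c))" .
qed

end

section \<open>Convergence of the gradient flow\<close>

context weighted_graph
begin

lemma energy_along_curve:
  assumes "descent_curve force x" "t \<ge> 0"
  shows "((\<lambda>t. energy (x t)) has_real_derivative - (norm (force (x t)))\<^sup>2) (at t within {0..})"
proof -
  have "(x has_derivative (\<lambda>h. h *\<^sub>R - force (x t))) (at t within {0..})"
    using assms unfolding descent_curve_def has_vector_derivative_def by simp
  from has_derivative_compose[OF this energy_has_derivative]
  have "((\<lambda>t. energy (x t)) has_derivative (\<lambda>h. force (x t) \<bullet> (h *\<^sub>R - force (x t)))) (at t within {0..})" .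
  then show ?thesis
    unfolding has_field_derivative_def
    by (rule has_derivative_eq_rhs) (simp add: fun_eq_iff power2_norm_eq_inner)
qed

lemma converges_from_equilibrium:
  assumes x: "descent_curve force x" and t0: "t0 \<ge> 0" "force (x t0) = 0"
  shows "(x \<longlongrightarrow> x t0) at_top"
proof -
  have "descent_curve force (\<lambda>t. x t0)" unfolding descent_curve_def using t0(2) by simp
  from descent_curve_forward_unique[OF force_Lipschitz descent_curve_shift[OF x t0(1)] this]
  have "x (t + t0) = x t0" if "t \<ge> 0" for t using that by simp
  then have "x t = x t0" if "t \<ge> t0" for t using that by (metis diff_add_cancel diff_ge_0_iff_ge)
  then have "eventually (\<lambda>t. x t = x t0) at_top" by (intro eventually_mono[OF eventually_ge_at_top[of t0]])
  then show ?thesis by (rule tendsto_eventually)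
qed

text \<open>Increments over unit time tend to 0, but by the mean value theorem each component of
  them is minus the force at a later time and tends to that of \<open>- force p\<close>.\<close>

lemma limit_is_equilibrium:
  assumes x: "descent_curve force x" and lim: "(x \<longlongrightarrow> p) at_top"
  shows "force p = 0"
proof (rule ccontr)
  assume "force p \<noteq> 0"
  then obtain v where v: "force p $ v \<noteq> 0" by (auto simp: vec_eq_iff)
  have "isCont force p" using continuous_force by (simp add: continuous_on_eq_continuous_at)
  from isCont_tendsto_compose[OF this lim] have "((\<lambda>t. force (x t)) \<longlongrightarrow> force p) at_top" .
  then have fl: "((\<lambda>t. - force (x t) $ v) \<longlongrightarrow> - force p $ v) at_top" by (intro tendsto_intros)
  have xl: "((\<lambda>t. x t $ v) \<longlongrightarrow> p $ v) at_top" using lim by (intro tendsto_intros)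
  have sh: "filterlim (\<lambda>t::real. t + 1) at_top at_top"
    by (rule filterlim_at_top_mono[OF filterlim_ident]) auto
  have "((\<lambda>t. x (t + 1) $ v - x t $ v) \<longlongrightarrow> p $ v - p $ v) at_top"
    by (intro tendsto_diff filterlim_compose[OF xl sh] xl)
  then have d0: "((\<lambda>t. x (t + 1) $ v - x t $ v) \<longlongrightarrow> 0) at_top" by simp
  have "\<exists>s\<ge>t. x (t + 1) $ v - x t $ v = - force (x s) $ v" if t: "t > 0" for t
  proof -
    have der: "((\<lambda>s. x s $ v) has_real_derivative - force (x s) $ v) (at s)" if "s > 0" for s
    proof -
      have "(x has_vector_derivative - force (x s)) (at s within {0..})" using x that unfolding descent_curve_def by simp
      then have "(x has_vector_derivative - force (x s)) (at s)" using at_within_interior[of s "{0..}"] that by simp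
      from bounded_linear.has_vector_derivative[OF bounded_linear_vec_nth this, of v]
      show ?thesis by (simp add: has_real_derivative_iff_has_vector_derivative)
    qed
    have "\<exists>s>t. s < t + 1 \<and> x (t + 1) $ v - x t $ v = (t + 1 - t) * (- force (x s) $ v)"
      by (rule MVT2) (use der t in auto)
    then obtain s where "t < s" "x (t + 1) $ v - x t $ v = - force (x s) $ v" by auto
    then show ?thesis by (intro exI[of _ s]) auto
  qed
  then obtain s where s: "\<And>t. t > 0 \<Longrightarrow> s t \<ge> t \<and> x (t + 1) $ v - x t $ v = - force (x (s t)) $ v" by metis
  have "filterlim s at_top at_top"
    by (rule filterlim_at_top_mono[OF filterlim_ident])
       (use s in \<open>auto intro!: eventually_mono[OF eventually_gt_at_top[of 0]]\<close>)
  from filterlim_compose[OF fl this] have "((\<lambda>t. - force (x (s t)) $ v) \<longlongrightarrow> - force p $ v) at_top" .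
  moreover have "eventually (\<lambda>t. - force (x (s t)) $ v = x (t + 1) $ v - x t $ v) at_top"
    using s by (auto intro!: eventually_mono[OF eventually_gt_at_top[of 0]])
  ultimately have "((\<lambda>t. x (t + 1) $ v - x t $ v) \<longlongrightarrow> - force p $ v) at_top"
    by (rule Lim_transform_eventually)
  from tendsto_unique[OF _ this d0] v show False by simp
qed

text \<open>With \<open>L\<close> the arc length from \<open>t0\<close>, each
  \<open>x t $ v + L t\<close> is nondecreasing and bounded, and so is \<open>L\<close>; both
  converge, hence so does every coordinate.\<close>

lemma converges_if_finite_length:
  assumes x: "descent_curve force x" and t0: "t0 > 0"
    and len: "\<And>T. T \<ge> t0 \<Longrightarrow> integral {t0..T} (\<lambda>t. norm (force (x t))) \<le> C"
  shows "\<exists>p. (x \<longlongrightarrow> p) at_top"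
proof -
  have dx: "(x has_vector_derivative - force (x t)) (at t)" if "t > 0" for t
  proof -
    have "(x has_vector_derivative - force (x t)) (at t within {0..})" using x that unfolding descent_curve_def by simp
    then show ?thesis using at_within_interior[of t "{0..}"] that by simp
  qed
  have cx: "continuous_on {t0..} x"
    using t0 by (intro continuous_at_imp_continuous_on ballI has_vector_derivative_continuous[OF dx]) auto
  have cF: "continuous_on {t0..} (\<lambda>t. force (x t))"
    by (rule continuous_on_compose2[OF continuous_force cx]) auto
  define L where "L = (\<lambda>T. integral {t0..T} (\<lambda>t. norm (force (x t))))"
  have int: "(\<lambda>t. norm (force (x t))) integrable_on {s..t}" if "t0 \<le> s" for s t
    by (rule integrable_continuous_real, intro continuous_on_norm continuous_on_subset[OF cF]) (use that in auto)
  have Ldiff: "L t - L s = integral {s..t} (\<lambda>t. norm (force (x t)))" if "t0 \<le> s" "s \<le> t" for s t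
    unfolding L_def
    using Henstock_Kurzweil_Integration.integral_combine[of t0 s t "\<lambda>t. norm (force (x t))"] that int[of t0 t] by simp
  have step: "\<bar>x t $ v - x s $ v\<bar> \<le> L t - L s" if st: "t0 \<le> s" "s \<le> t" for s t v
  proof -
    have hi: "((\<lambda>t. - force (x t)) has_integral (x t - x s)) {s..t}"
      by (rule fundamental_theorem_of_calculus[OF st(2)])
         (use dx t0 st in \<open>auto intro: has_vector_derivative_at_within\<close>)
    have "norm (x t - x s) \<le> integral {s..t} (\<lambda>t. norm (force (x t)))"
    proof -
      have "norm (integral {s..t} (\<lambda>t. - force (x t))) \<le> integral {s..t} (\<lambda>t. norm (force (x t)))"
        by (rule integral_norm_bound_integral) (use hi int[OF st(1)] in auto)
      then show ?thesis by (simp only: integral_unique[OF hi])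
    qed
    then show ?thesis using component_le_norm_cart[of "x t - x s" v] Ldiff[OF st] by simp
  qed
  have Lmono: "L s \<le> L t" if "t0 \<le> s" "s \<le> t" for s t using step[OF that, of undefined] by linarith
  have LC: "L t \<le> C" if "t0 \<le> t" for t using len that by (simp add: L_def)
  obtain l where l: "(L \<longlongrightarrow> l) at_top" using mono_bounded_converges[of t0 L C] Lmono LC by blast
  have "\<exists>q. ((\<lambda>t. x t $ v) \<longlongrightarrow> q) at_top" for v
  proof -
    have "\<exists>m. ((\<lambda>t. x t $ v + L t) \<longlongrightarrow> m) at_top"
    proof (rule mono_bounded_converges)
      fix s t assume "t0 \<le> s" "s \<le> t"
      then show "x s $ v + L s \<le> x t $ v + L t" using step[of s t v] by linarith
    next
      fix t assume t: "t0 \<le> t"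
      have "L t0 = 0" by (simp add: L_def)
      then show "x t $ v + L t \<le> x t0 $ v + C + C" using step[of t0 t v] LC[OF t] t by linarith
    qed
    then obtain m where "((\<lambda>t. x t $ v + L t) \<longlongrightarrow> m) at_top" by blast
    from tendsto_diff[OF this l] show ?thesis by auto
  qed
  then obtain q where q: "\<And>v. ((\<lambda>t. x t $ v) \<longlongrightarrow> q v) at_top" by metis
  have "(x \<longlongrightarrow> (\<chi> v. q v)) at_top" by (rule vec_tendstoI) (use q in simp)
  then show ?thesis by blast
qed

text \<open>Talweg points are chosen level by level, so the branches carrying them may jump. For
  levels decreasing to that of \<open>x t\<close> there are finitely many combinations of branches,
  one of which recurs infinitely often; \<open>talweg_slope\<close> applies to it, and the
  comparison of gradients passes to the limit.\<close>

lemma slope_bound_along_curve: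
  assumes x: "descent_curve force x"
    and dec: "\<And>s t. 0 \<le> s \<Longrightarrow> s < t \<Longrightarrow> energy (x t) < energy (x s)"
    and tw: "\<And>c. (\<exists>y. energy y = c) \<Longrightarrow> \<exists>z. ts c z = 0 \<and> (\<forall>y. energy y = c \<longrightarrow> tg z \<le> (norm (force y))\<^sup>2) \<and> (\<forall>i. is_rt i c (z i))"
    and br: "\<And>i c y. c \<in> I \<Longrightarrow> is_rt i c y \<Longrightarrow> \<exists>j<N i. y = \<xi> i j c"
    and der: "\<And>i j c. j < N i \<Longrightarrow> c \<in> I \<Longrightarrow> (\<xi> i j has_real_derivative \<xi>' i j c) (at c)"
    and I: "open I" "energy (x t) \<in> I" and t: "t > 0"
  shows "\<exists>\<sigma>. (\<forall>i. \<sigma> i < (N i :: nat)) \<and> (\<forall>i. \<bar>\<xi> i (\<sigma> i) (energy (x t))\<bar> \<le> 1) \<and>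
     1 \<le> (\<Sum>i\<in>UNIV. \<bar>\<xi>' i (\<sigma> i) (energy (x t))\<bar>) * norm (force (x t))"
proof -
  define e where "e = (\<lambda>t. energy (x t))"
  define c where "c = e t"
  define tk where "tk = (\<lambda>k::nat. t + inverse (real (Suc k)))"
  have tk: "tk \<longlonglongrightarrow> t" unfolding tk_def using tendsto_add[OF tendsto_const LIMSEQ_inverse_real_of_nat, of t] by simp
  have dx: "(x has_vector_derivative - force (x t)) (at t)"
  proof -
    have "(x has_vector_derivative - force (x t)) (at t within {0..})" using x t unfolding descent_curve_def by simp
    then show ?thesis using at_within_interior[of t "{0..}"] t by simp
  qed
  have xt: "(\<lambda>k. x (tk k)) \<longlonglongrightarrow> x t"
    using isCont_tendsto_compose[OF has_vector_derivative_continuous[OF dx] tk] .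
  have contE: "isCont energy p" for p using has_derivative_continuous[OF energy_has_derivative] .
  have cs0: "(\<lambda>k. e (tk k)) \<longlonglongrightarrow> c" unfolding e_def c_def using isCont_tendsto_compose[OF contE xt] .
  have ne: "e (tk k) < c" for k unfolding c_def e_def by (rule dec) (use t in \<open>auto simp: tk_def\<close>)
  obtain k0 where k0: "\<And>k. k \<ge> k0 \<Longrightarrow> e (tk k) \<in> I"
    using topological_tendstoD[OF cs0 I(1)] I(2) by (auto simp: c_def e_def eventually_sequentially)
  define s where "s = (\<lambda>k. tk (k + k0))"
  define cs where "cs = (\<lambda>k. e (s k))"
  have csI: "cs k \<in> I" for k unfolding cs_def s_def by (rule k0) simp
  have cs: "cs \<longlonglongrightarrow> c" unfolding cs_def s_def using LIMSEQ_ignore_initial_segment[OF cs0, of k0] .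
  have csne: "cs k \<noteq> c" for k using ne[of "k + k0"] by (simp add: cs_def s_def)
  have xs: "(\<lambda>k. x (s k)) \<longlonglongrightarrow> x t" unfolding s_def using LIMSEQ_ignore_initial_segment[OF xt, of k0] .
  have "\<exists>z \<sigma>. ts (cs k) z = 0 \<and> tg z \<le> (norm (force (x (s k))))\<^sup>2 \<and> (\<forall>i. \<sigma> i < N i \<and> z i = \<xi> i (\<sigma> i) (cs k))" for k
  proof -
    obtain z where z: "ts (cs k) z = 0" "\<And>y. energy y = cs k \<Longrightarrow> tg z \<le> (norm (force y))\<^sup>2" "\<And>i. is_rt i (cs k) (z i)"
      using tw[of "cs k"] by (auto simp: cs_def e_def)
    have "\<forall>i. \<exists>j. j < N i \<and> z i = \<xi> i j (cs k)" using br[OF csI z(3)] by blast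
    then obtain \<sigma> where "\<forall>i. \<sigma> i < N i \<and> z i = \<xi> i (\<sigma> i) (cs k)" by metis
    then show ?thesis using z by (auto simp: cs_def e_def)
  qed
  then obtain z \<sigma> where z: "\<And>k. ts (cs k) (z k) = 0" "\<And>k. tg (z k) \<le> (norm (force (x (s k))))\<^sup>2"
    and \<sigma>: "\<And>k i. \<sigma> k i < N i" "\<And>k i. z k i = \<xi> i (\<sigma> k i) (cs k)" by metis
  have "range \<sigma> \<subseteq> PiE UNIV (\<lambda>i. {..<N i})" using \<sigma>(1) by auto
  then have "finite (range \<sigma>)" by (rule finite_subset) (intro finite_PiE, auto)
  \<comment> \<open>Pigeonhole over the finitely many choices of one branch for each
    coordinate.\<close>
  then obtain k1 where "infinite {k. \<sigma> k = \<sigma> k1}"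
    using pigeonhole_infinite[of "UNIV :: nat set" \<sigma>] by auto
  then obtain r :: "nat \<Rightarrow> nat" where r: "strict_mono r" "\<And>n. \<sigma> (r n) = \<sigma> k1"
    using infinite_enumerate by blast
  define \<gamma> where "\<gamma> = (\<lambda>i. \<xi> i (\<sigma> k1 i))"
  have zr: "z (r n) = (\<lambda>i. \<gamma> i (cs (r n)))" for n using \<sigma>(2)[of "r n"] r(2)[of n] by (auto simp: \<gamma>_def)
  have derg: "(\<gamma> i has_real_derivative \<xi>' i (\<sigma> k1 i) c) (at c)" for i
    unfolding \<gamma>_def using \<sigma>(1) I(2) by (intro der) (auto simp: c_def e_def)
  have csr: "(\<lambda>n. cs (r n)) \<longlonglongrightarrow> c" using LIMSEQ_subseq_LIMSEQ[OF cs r(1)] by (simp add: o_def)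
  have on: "ts (cs (r n)) (\<lambda>i. \<gamma> i (cs (r n))) = 0" for n using z(1)[of "r n"] zr by simp
  note slope = talweg_slope[OF derg csr csne on]
  have gl: "(\<lambda>n. \<gamma> i (cs (r n))) \<longlonglongrightarrow> \<gamma> i c" for i using isCont_tendsto_compose[OF DERIV_isCont[OF derg] csr] .
  have "(\<lambda>n. tg (\<lambda>i. \<gamma> i (cs (r n)))) \<longlonglongrightarrow> tg (\<lambda>i. \<gamma> i c)"
    unfolding tg_def tF_def by (intro tendsto_intros gl)
  moreover have "(\<lambda>n. (norm (force (x (s (r n)))))\<^sup>2) \<longlonglongrightarrow> (norm (force (x t)))\<^sup>2"
  proof -
    have "isCont force (x t)" using continuous_force by (simp add: continuous_on_eq_continuous_at)
    moreover have "(\<lambda>n. x (s (r n))) \<longlonglongrightarrow> x t" using LIMSEQ_subseq_LIMSEQ[OF xs r(1)] by (simp add: o_def)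
    ultimately show ?thesis by (intro tendsto_intros isCont_tendsto_compose[of "x t" force])
  qed
  moreover have "tg (\<lambda>i. \<gamma> i (cs (r n))) \<le> (norm (force (x (s (r n)))))\<^sup>2" for n using z(2)[of "r n"] zr by simp
  ultimately have "tg (\<lambda>i. \<gamma> i c) \<le> (norm (force (x t)))\<^sup>2" by (intro LIMSEQ_le) auto
  then have "sqrt (tg (\<lambda>i. \<gamma> i c)) \<le> norm (force (x t))" by (intro real_le_lsqrt) (auto simp: tg_def sum_nonneg)
  then have "(\<Sum>i\<in>UNIV. \<bar>\<xi>' i (\<sigma> k1 i) c\<bar>) * sqrt (tg (\<lambda>i. \<gamma> i c)) \<le> (\<Sum>i\<in>UNIV. \<bar>\<xi>' i (\<sigma> k1 i) c\<bar>) * norm (force (x t))"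
    by (intro mult_left_mono sum_nonneg) auto
  then have one: "1 \<le> (\<Sum>i\<in>UNIV. \<bar>\<xi>' i (\<sigma> k1 i) c\<bar>) * norm (force (x t))" using slope(1) by linarith
  have ce: "energy (x t) = c" by (simp add: c_def e_def)
  show ?thesis unfolding ce
    by (rule exI[of _ "\<sigma> k1"]) (use one \<sigma>(1) slope(2) in \<open>auto simp: \<gamma>_def\<close>)
qed

lemma interval_above_avoiding_finite:
  fixes c0 :: real
  assumes "finite S"
  shows "\<exists>c1>c0. {c0<..<c1} \<inter> S = {}"
proof -
  define A where "A = insert (c0 + 1) {s\<in>S. c0 < s}"
  have A: "finite A" "A \<noteq> {}" using assms by (auto simp: A_def)
  have "Min A > c0" using A by (subst Min_gr_iff) (auto simp: A_def)
  moreover have "{c0<..<Min A} \<inter> S = {}"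
  proof (rule ccontr)
    assume "\<not> ?thesis"
    then obtain s where s: "c0 < s" "s < Min A" "s \<in> S" by auto
    then have "Min A \<le> s" using A by (intro Min_le) (auto simp: A_def)
    then show False using s by simp
  qed
  ultimately show ?thesis by blast
qed

text \<open>The length of a curve of steepest descent is dominated by the length of the talweg, whose coordinates
  are branches of algebraic functions and hence of bounded variation.\<close>

theorem descent_curve_converges:
  assumes x: "descent_curve force x"
  shows "\<exists>p. (x \<longlongrightarrow> p) at_top \<and> force p = 0"
proof -
  have "\<exists>p. (x \<longlongrightarrow> p) at_top"
  proof (cases "\<exists>t0\<ge>0. force (x t0) = 0")
    case True
    then show ?thesis using converges_from_equilibrium[OF x] by blast
  next
    case False
    then have nz: "force (x t) \<noteq> 0" if "t \<ge> 0" for t using that by blast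
    define e where "e = (\<lambda>t. energy (x t))"
    have de: "(e has_real_derivative - (norm (force (x t)))\<^sup>2) (at t)" if "t > 0" for t
      using energy_along_curve[OF x, of t] at_within_interior[of t "{0..}"] that by (simp add: e_def)
    have ce: "continuous_on {0..} e"
      unfolding e_def by (rule DERIV_continuous_on[OF energy_along_curve[OF x]]) auto
    have dec: "e t < e s" if st: "0 \<le> s" "s < t" for s t
    proof (rule DERIV_neg_imp_decreasing_open[OF st(2)])
      fix r assume "s < r" "r < t"
      then show "\<exists>y. DERIV e r :> y \<and> y < 0"
        using de[of r] nz[of r] st by (intro exI[of _ "- (norm (force (x r)))\<^sup>2"]) auto
    qed (use st in \<open>auto intro: continuous_on_subset[OF ce]\<close>)
    obtain l where l: "((\<lambda>t. - e t) \<longlongrightarrow> l) at_top"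
    proof -
      have "\<exists>l. ((\<lambda>t. - e t) \<longlongrightarrow> l) at_top"
      proof (rule mono_bounded_converges[of 0 _ 0])
        fix s t :: real assume "0 \<le> s" "s \<le> t"
        then show "- e s \<le> - e t" using dec[of s t] by (cases "s = t") auto
      qed (simp add: e_def energy_nonneg)
      then show thesis using that by blast
    qed
    define c0 where "c0 = - l"
    have lim: "(e \<longlongrightarrow> c0) at_top" using tendsto_minus[OF l] by (simp add: c0_def)
    have gt: "c0 < e t" if t: "t \<ge> 0" for t
    proof -
      have "eventually (\<lambda>s. e s \<le> e (t + 1)) at_top"
        using eventually_ge_at_top[of "t + 1"]
      proof eventually_elim
        case (elim s)
        then show ?case using dec[of "t + 1" s] t by (cases "s = t + 1") auto
      qed
      then have "c0 \<le> e (t + 1)" using tendsto_upperbound[OF lim] by simp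
      also have "e (t + 1) < e t" using dec[of t "t + 1"] t by simp
      finally show ?thesis .
    qed
    obtain K p where pnz: "\<And>i. \<exists>x\<in>{..K} \<times> {..K}. p i x \<noteq> (0::real)"
      and tw: "\<And>c. (\<exists>x. energy x = c) \<Longrightarrow> \<exists>z. ts c z = 0 \<and> (\<forall>y. energy y = c \<longrightarrow> tg z \<le> (norm (force y))\<^sup>2) \<and>
        (\<forall>i. (\<Sum>x\<in>{..K} \<times> {..K}. p i x * (c ^ fst x * z i ^ snd x)) = 0)"
      using talweg by blast
    define is_rt where "is_rt = (\<lambda>i c y. (\<Sum>x\<in>{..K} \<times> {..K}. p i x * (c ^ fst x * y ^ snd x)) = 0)"
    have twr: "\<exists>z. ts c z = 0 \<and> (\<forall>y. energy y = c \<longrightarrow> tg z \<le> (norm (force y))\<^sup>2) \<and> (\<forall>i. is_rt i c (z i))"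
      if "\<exists>x. energy x = c" for c using tw[OF that] unfolding is_rt_def .
    define BR where "BR = (\<lambda>i c0 c1 (M::nat) X (N::nat) \<xi> \<xi>'. (\<forall>c\<in>{c0<..<c1}. \<forall>y. is_rt i c y \<longrightarrow> (\<exists>j<N. y = \<xi> j c)) \<and>
      (\<forall>j<N. (\<forall>c\<in>{c0<..<c1::real}. (\<xi> j has_real_derivative \<xi>' j c) (at c)) \<and> continuous_on {c0<..<c1} (\<xi>' j) \<and>
        (\<forall>y. y \<notin> X \<longrightarrow> finite {c\<in>{c0<..<c1}. \<xi> j c = (y::real)} \<and> card {c\<in>{c0<..<c1}. \<xi> j c = y} \<le> M)))"
    have "\<exists>F M X. finite F \<and> finite X \<and> (\<forall>c0 c1. {c0<..<c1} \<inter> F = {} \<longrightarrow> (\<exists>N \<xi> \<xi>'. BR i c0 c1 M X N \<xi> \<xi>'))" for i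
      unfolding BR_def is_rt_def by (rule algebraic_function_branches[OF pnz])
    then obtain Fs Ms Xs where Fs: "\<And>i. finite (Fs i)" and Xs: "\<And>i. finite (Xs i)"
      and br0: "\<And>i c0 c1. {c0<..<c1} \<inter> Fs i = {} \<Longrightarrow> \<exists>N \<xi> \<xi>'. BR i c0 c1 (Ms i) (Xs i) N \<xi> \<xi>'" by metis
    \<comment> \<open>The energy strictly decreases to \<open>c0\<close>, so eventually it stays in
      an interval above \<open>c0\<close> free of exceptional levels.\<close>
    obtain c1 where c1: "c1 > c0" "{c0<..<c1} \<inter> (\<Union>i. Fs i) = {}"
      using interval_above_avoiding_finite[of "\<Union>i. Fs i" c0] Fs by auto
    define I where "I = {c0<..<c1}"
    have "\<exists>N \<xi> \<xi>'. BR i c0 c1 (Ms i) (Xs i) N \<xi> \<xi>'" for i using c1(2) by (intro br0) blast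
    then obtain N \<xi> \<xi>' where BR: "\<And>i. BR i c0 c1 (Ms i) (Xs i) (N i) (\<xi> i) (\<xi>' i)" by metis
    have br: "\<exists>j<N i. y = \<xi> i j c" if "c \<in> I" "is_rt i c y" for i c y
      using BR[of i] that unfolding BR_def I_def by blast
    have der: "(\<xi> i j has_real_derivative \<xi>' i j c) (at c)" if "j < N i" "c \<in> I" for i j c
      using BR[of i] that unfolding BR_def I_def by blast
    have cont: "continuous_on I (\<xi>' i j)" if "j < N i" for i j
      using BR[of i] that unfolding BR_def I_def by blast
    have lev: "finite {c\<in>I. \<xi> i j c = y} \<and> card {c\<in>I. \<xi> i j c = y} \<le> Ms i" if "j < N i" "y \<notin> Xs i" for i j y
      using BR[of i] that unfolding BR_def I_def by blast
    have "eventually (\<lambda>t. e t < c1) at_top" using order_tendstoD(2)[OF lim c1(1)] .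
    then obtain t1 where t1: "\<And>t. t \<ge> t1 \<Longrightarrow> e t < c1" by (auto simp: eventually_at_top_linorder)
    define t0 where "t0 = max t1 1"
    have t0: "t0 > 0" "\<And>t. t \<ge> t0 \<Longrightarrow> e t \<in> I" using t1 gt by (auto simp: t0_def I_def)
    \<comment> \<open>Branches may be unbounded on the interval; \<open>arctan\<close> bounds them
      by \<open>pi / 2\<close> without changing how often values are attained. On the branches that
      carry the talweg, where \<open>\<xi>\<close> is at most 1 in absolute value, it costs a factor
      of at most 2.\<close>
    define \<eta> where "\<eta> = (\<lambda>i j t. arctan (\<xi> i j (e t)))"
    define \<eta>' where "\<eta>' = (\<lambda>i j t. inverse (1 + (\<xi> i j (e t))\<^sup>2) * (\<xi>' i j (e t) * (- (norm (force (x t)))\<^sup>2)))"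
    have deta: "(\<eta> i j has_real_derivative \<eta>' i j t) (at t)" if "j < N i" "t \<ge> t0" for i j t
    proof -
      have "((\<lambda>t. \<xi> i j (e t)) has_real_derivative \<xi>' i j (e t) * (- (norm (force (x t)))\<^sup>2)) (at t)"
        using DERIV_chain2[OF der[OF that(1) t0(2)[OF that(2)]] de[of t]] t0(1) that(2) by simp
      from DERIV_chain2[OF DERIV_arctan this] show ?thesis unfolding \<eta>_def \<eta>'_def .
    qed
    have key: "norm (force (x t)) \<le> 2 * (\<Sum>i\<in>UNIV. \<Sum>j<N i. \<bar>\<eta>' i j t\<bar>)" if t: "t \<ge> t0" for t
    proof -
      define c where "c = e t"
      define f where "f = norm (force (x t))"
      have "\<exists>\<sigma>. (\<forall>i. \<sigma> i < N i) \<and> (\<forall>i. \<bar>\<xi> i (\<sigma> i) (energy (x t))\<bar> \<le> 1) \<and>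
         1 \<le> (\<Sum>i\<in>UNIV. \<bar>\<xi>' i (\<sigma> i) (energy (x t))\<bar>) * norm (force (x t))"
      proof (rule slope_bound_along_curve[OF x dec[unfolded e_def] twr br der])
        show "open I" by (simp add: I_def)
        show "energy (x t) \<in> I" using t0(2)[OF t] by (simp add: e_def)
        show "t > 0" using t t0(1) by simp
      qed
      then obtain \<sigma> where s: "\<And>i. \<sigma> i < N i" "\<And>i. \<bar>\<xi> i (\<sigma> i) c\<bar> \<le> 1" "1 \<le> (\<Sum>i\<in>UNIV. \<bar>\<xi>' i (\<sigma> i) c\<bar>) * f"
        by (auto simp: c_def e_def f_def)
      have f0: "f \<ge> 0" by (simp add: f_def)
      \<comment> \<open>Multiplying the slope bound by the speed \<open>f\<close>: the energy
        changes at rate \<open>f\<^sup>2\<close>, so \<open>\<bar>\<xi>'\<bar> * f\<^sup>2\<close>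
        is the speed of the branch in time.\<close>
      have "f * 1 \<le> f * ((\<Sum>i\<in>UNIV. \<bar>\<xi>' i (\<sigma> i) c\<bar>) * f)" using s(3) f0 by (rule mult_left_mono)
      also have "\<dots> = (\<Sum>i\<in>UNIV. \<bar>\<xi>' i (\<sigma> i) c\<bar> * f\<^sup>2)" by (simp add: sum_distrib_right power2_eq_square mult_ac sum_distrib_left)
      also have "\<dots> \<le> (\<Sum>i\<in>UNIV. 2 * (\<Sum>j<N i. \<bar>\<eta>' i j t\<bar>))"
      proof (rule sum_mono)
        fix i
        define q where "q = (\<xi> i (\<sigma> i) c)\<^sup>2"
        have q: "0 \<le> q" "q \<le> 1" using s(2)[of i] by (auto simp: q_def abs_square_le_1)
        have "\<bar>\<eta>' i (\<sigma> i) t\<bar> = inverse (1 + q) * (\<bar>\<xi>' i (\<sigma> i) c\<bar> * f\<^sup>2)"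
          using q by (simp add: \<eta>'_def q_def c_def f_def abs_mult)
        moreover have "1/2 \<le> inverse (1 + q)" using q by (simp add: inverse_eq_divide field_simps)
        then have "(1/2) * (\<bar>\<xi>' i (\<sigma> i) c\<bar> * f\<^sup>2) \<le> inverse (1 + q) * (\<bar>\<xi>' i (\<sigma> i) c\<bar> * f\<^sup>2)"
          by (rule mult_right_mono) simp
        ultimately have "\<bar>\<xi>' i (\<sigma> i) c\<bar> * f\<^sup>2 \<le> 2 * \<bar>\<eta>' i (\<sigma> i) t\<bar>" by simp
        also have "\<bar>\<eta>' i (\<sigma> i) t\<bar> \<le> (\<Sum>j<N i. \<bar>\<eta>' i j t\<bar>)" using s(1)[of i] by (intro member_le_sum) auto
        finally show "\<bar>\<xi>' i (\<sigma> i) c\<bar> * f\<^sup>2 \<le> 2 * (\<Sum>j<N i. \<bar>\<eta>' i j t\<bar>)" by simp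
      qed
      finally show ?thesis by (simp add: f_def sum_distrib_left)
    qed
    have dx: "(x has_vector_derivative - force (x t)) (at t)" if "t > 0" for t
    proof -
      have "(x has_vector_derivative - force (x t)) (at t within {0..})" using x that unfolding descent_curve_def by simp
      then show ?thesis using at_within_interior[of t "{0..}"] that by simp
    qed
    have cx: "continuous_on {t0..T} x" for T
      using t0 by (intro continuous_at_imp_continuous_on ballI has_vector_derivative_continuous[OF dx]) auto
    have cF: "continuous_on {t0..T} (\<lambda>t. force (x t))" for T
      by (rule continuous_on_compose2[OF continuous_force cx]) auto
    have ce': "continuous_on {t0..T} e" for T using t0(1) by (intro continuous_on_subset[OF ce]) auto
    have ceta': "continuous_on {t0..T} (\<eta>' i j)" if j: "j < N i" for i j T
    proof -
      have cxi: "continuous_on I (\<xi> i j)"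
        using der[OF j] by (auto intro!: continuous_at_imp_continuous_on DERIV_isCont)
      have "continuous_on {t0..T} (\<lambda>t. \<xi> i j (e t))" "continuous_on {t0..T} (\<lambda>t. \<xi>' i j (e t))"
        using t0(2) by (auto intro!: continuous_on_compose2[OF cxi ce'] continuous_on_compose2[OF cont[OF j] ce'])
      moreover have "1 + y\<^sup>2 \<noteq> 0" for y :: real by (smt (verit) zero_le_power2)
      ultimately show ?thesis unfolding \<eta>'_def by (intro continuous_intros cF) auto
    qed
    have var: "integral {t0..T} (\<lambda>t. \<bar>\<eta>' i j t\<bar>) \<le> 2 * (pi / 2) * real (Ms i)" if j: "j < N i" and T: "T \<ge> t0" for i j T
    proof (rule variation_bound[OF T, where X = "arctan ` Xs i"])
      show "(\<eta> i j has_real_derivative \<eta>' i j t) (at t)" if "t \<in> {t0..T}" for t using deta[OF j] that by simp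
      show "\<bar>\<eta> i j t\<bar> \<le> pi / 2" for t
        unfolding \<eta>_def using arctan_bounded[of "\<xi> i j (e t)"] by linarith
      fix y assume y: "y \<notin> arctan ` Xs i"
      define S where "S = {t\<in>{t0..T}. \<eta> i j t = y}"
      have "finite S \<and> card S \<le> Ms i"
      proof (cases "S = {}")
        case False
        then obtain s where "\<eta> i j s = y" by (auto simp: S_def)
        then have y': "y = arctan (\<xi> i j (e s))" by (simp add: \<eta>_def)
        then have nX: "\<xi> i j (e s) \<notin> Xs i" using y by blast
        have sub: "e ` S \<subseteq> {c\<in>I. \<xi> i j c = \<xi> i j (e s)}"
          using t0(2) y' by (auto simp: S_def \<eta>_def arctan_eq_iff)
        \<comment> \<open>Times correspond one to one to energy levels, so the bound on level
          crossings carries over from the branch to its time parametrisation.\<close>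
        have inj: "inj_on e S"
        proof (rule inj_onI, rule ccontr)
          fix s t assume st: "s \<in> S" "t \<in> S" "e s = e t" "s \<noteq> t"
          then have "0 \<le> s" "0 \<le> t" using t0(1) by (auto simp: S_def)
          then show False using dec[of s t] dec[of t s] st by linarith
        qed
        have "finite S" using finite_imageD[OF finite_subset[OF sub] inj] lev[OF j nX] by blast
        moreover have "card S \<le> Ms i"
          using card_inj_on_le[OF inj sub] lev[OF j nX] by linarith
        ultimately show ?thesis by blast
      qed simp
      then show "finite {t\<in>{t0..T}. \<eta> i j t = y} \<and> card {t\<in>{t0..T}. \<eta> i j t = y} \<le> Ms i" by (simp add: S_def)
    qed (use ceta'[OF j] Xs in auto)
    define C where "C = 2 * (\<Sum>i\<in>UNIV. \<Sum>j<N i. 2 * (pi / 2) * real (Ms i))"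
    have "integral {t0..T} (\<lambda>t. norm (force (x t))) \<le> C" if T: "T \<ge> t0" for T
    proof -
      have ii: "(\<lambda>t. \<bar>\<eta>' i j t\<bar>) integrable_on {t0..T}" if "j < N i" for i j
        by (intro integrable_continuous_real continuous_on_rabs ceta'[OF that])
      have "integral {t0..T} (\<lambda>t. norm (force (x t))) \<le> integral {t0..T} (\<lambda>t. 2 * (\<Sum>i\<in>UNIV. \<Sum>j<N i. \<bar>\<eta>' i j t\<bar>))"
      proof (rule integral_le)
        show "(\<lambda>t. norm (force (x t))) integrable_on {t0..T}"
          by (intro integrable_continuous_real continuous_on_norm cF)
        show "(\<lambda>t. 2 * (\<Sum>i\<in>UNIV. \<Sum>j<N i. \<bar>\<eta>' i j t\<bar>)) integrable_on {t0..T}"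
          by (intro integrable_continuous_real continuous_intros ceta') auto
      qed (use key in auto)
      also have "\<dots> = 2 * (\<Sum>i\<in>UNIV. \<Sum>j<N i. integral {t0..T} (\<lambda>t. \<bar>\<eta>' i j t\<bar>))"
      proof -
        have "integral {t0..T} (\<lambda>t. \<Sum>j<N i. \<bar>\<eta>' i j t\<bar>) = (\<Sum>j<N i. integral {t0..T} (\<lambda>t. \<bar>\<eta>' i j t\<bar>))" for i
          by (rule integral_sum) (use ii in auto)
        moreover have "integral {t0..T} (\<lambda>t. \<Sum>i\<in>UNIV. \<Sum>j<N i. \<bar>\<eta>' i j t\<bar>)
            = (\<Sum>i\<in>UNIV. integral {t0..T} (\<lambda>t. \<Sum>j<N i. \<bar>\<eta>' i j t\<bar>))"
          by (rule integral_sum) (auto intro!: integrable_sum ii)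
        ultimately show ?thesis by simp
      qed
      also have "\<dots> \<le> C" unfolding C_def using var[OF _ T] by (intro mult_left_mono sum_mono) auto
      finally show ?thesis .
    qed
    then show ?thesis by (rule converges_if_finite_length[OF x t0(1)])
  qed
  then show ?thesis using limit_is_equilibrium[OF x] by blast
qed

end

section \<open>Global synchronization\<close>

lemma (in weighted_graph) grad_energy: "grad energy x = force x"
  unfolding grad_def
proof (rule the_equality)
  show "(energy has_derivative (\<lambda>h. force x \<bullet> h)) (at x)" by (rule energy_has_derivative)
  fix g assume "(energy has_derivative (\<lambda>h. g \<bullet> h)) (at x)"
  then have "(\<lambda>h. g \<bullet> h) = (\<lambda>h. force x \<bullet> h)" using has_derivative_unique energy_has_derivative by blast
  then show "g = force x" by (metis vector_eq_rdot)
qed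

theorem theorem1p7:
  fixes adj :: "'n::finite \<Rightarrow> 'n \<Rightarrow> bool"
    and W B :: "'n set"
    and \<epsilon> \<alpha> d :: real
    and n :: nat
  assumes eps: "0 < \<epsilon>" "\<epsilon> < 1"
    and alpha: "0 < \<alpha>" "\<alpha> < 1/5"
    and alpha_d: "\<alpha> * d \<ge> 1"
    and graph: "simple_graph adj"
    and no_isolated: "\<forall>v. \<exists>u. adj v u"
    and partition: "W \<union> B = UNIV" "W \<inter> B = {}"
    and expander: "is_expander adj n d \<alpha>"
    and min_deg: "\<forall>v\<in>W. real (induced_degree adj W v) \<ge> 2 * (\<epsilon> + \<alpha>) * d"
    and cond1: "let dmax = real (Max (induced_degree adj W ` W));
                    \<delta> = \<epsilon> * d / (dmax - 2 * \<epsilon> * d)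
                in 8 * (1 + \<delta>) * (dmax + 1)
                     / (\<delta>\<^sup>2 * exp (\<epsilon> / (40 * \<alpha>) * ln (1 + \<delta>))) \<le> 1"
    and cond2: "8 / (real (Max (induced_degree adj W ` W)) - 4 * \<epsilon> * d) \<le> 1"
    and B1: "real (card B) \<le> \<alpha> * real n"
    and B2: "\<forall>u\<in>B. \<forall>v\<in>B. \<not> adj u v"
    and B3: "\<forall>v\<in>B. real (degree adj v) \<le> real (Max (induced_degree adj W ` W)) + 1"
    and B4: "\<forall>v. card (nbhd adj v \<inter> B) \<le> 1"
  shows "globally_synchronizing adj"
proof -
  have sym: "adj u v \<longleftrightarrow> adj v u" for u v using graph by (auto simp: simple_graph_def)
  have card_eq: "(\<Sum>u\<in>X. adjr adj v u) = real (card (nbhd adj v \<inter> X))" for v X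
    by (simp add: sum.If_cases nbhd_def Int_def conj_commute)
  define dm where "dm = real (Max (induced_degree adj W ` W))"
  define \<delta> where "\<delta> = \<epsilon> * d / (dm - 2 * \<epsilon> * d)"
  have n: "n = CARD('n)" using expander by (simp add: is_expander_def)
  have ad0: "\<alpha> * d \<ge> 0" using alpha_d by simp
  interpret wg: weighted_graph "adjr adj"
    by unfold_locales (use sym in auto)
  interpret pe: partitioned_expander "adjr adj" W B \<epsilon> \<alpha> d dm "real CARD('n)" \<delta>
  proof
    show "0 < \<epsilon>" "\<epsilon> < 1" "0 < \<alpha>" "1 \<le> \<alpha> * d" "W \<union> B = UNIV" "W \<inter> B = {}" by fact+
    show "adjr adj u v = 0 \<or> adjr adj u v = 1" for u v by simp
    show "adjr adj u v = adjr adj v u" for u v using sym by simp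
    show "\<exists>u. adjr adj v u = 1" for v using no_isolated by auto
    show "(\<Sum>u\<in>UNIV. ((\<Sum>v\<in>UNIV. adjr adj u v * x v) - d / real CARD('n) * sum x UNIV)\<^sup>2) \<le> (\<alpha> * d)\<^sup>2 * (\<Sum>v\<in>UNIV. (x v)\<^sup>2)" for x
      using expander_norm_bound[OF expander ad0] n by simp
    show "\<bar>(\<Sum>u\<in>UNIV. \<Sum>v\<in>UNIV. adjr adj u v * y u * x v) - d / real CARD('n) * sum y UNIV * sum x UNIV\<bar>
       \<le> \<alpha> * d * sqrt (\<Sum>v\<in>UNIV. (y v)\<^sup>2) * sqrt (\<Sum>v\<in>UNIV. (x v)\<^sup>2)" for x y
      using expander_mixing[OF expander ad0] n by simp
    show "2 * (\<epsilon> + \<alpha>) * d \<le> (\<Sum>u\<in>W. adjr adj v u)" if "v \<in> W" for v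
      using min_deg that unfolding card_eq by (simp add: induced_degree_def)
    show "(\<Sum>u\<in>W. adjr adj v u) \<le> dm" if "v \<in> W" for v
    proof -
      have "induced_degree adj W v \<le> Max (induced_degree adj W ` W)" using that by (intro Max_ge) auto
      then show ?thesis unfolding card_eq dm_def by (simp add: induced_degree_def)
    qed
    show "W \<noteq> {}"
    proof
      assume "W = {}"
      then have "B = UNIV" using partition by simp
      then show False using B2 no_isolated by blast
    qed
    show "adjr adj u v = 0" if "u \<in> B" "v \<in> B" for u v using B2 that by simp
    show "(\<Sum>u\<in>UNIV. adjr adj v u) \<le> dm + 1" if "v \<in> B" for v
      using B3 that unfolding card_eq dm_def by (simp add: degree_def)
    show "(\<Sum>u\<in>B. adjr adj v u) \<le> 1" for v using B4 unfolding card_eq by simp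
    show "\<delta> = \<epsilon> * d / (dm - 2 * \<epsilon> * d)" by (rule \<delta>_def)
    show "8 * (1 + \<delta>) * (dm + 1) / (\<delta>\<^sup>2 * exp (\<epsilon> / (40 * \<alpha>) * ln (1 + \<delta>))) \<le> 1"
      using cond1 by (simp add: Let_def dm_def \<delta>_def)
  qed simp
  have energy: "kuramoto_energy adj = wg.energy"
    by (simp add: fun_eq_iff kuramoto_energy_def wg.energy_def adj_matrix_def)
  have traj: "kuramoto_trajectory adj \<theta> \<longleftrightarrow> descent_curve wg.force \<theta>" for \<theta>
    by (simp add: kuramoto_trajectory_def descent_curve_def energy wg.grad_energy)
  \<comment> \<open>Membership asks for a direction of negative curvature; that the limit of a
    trajectory is critical comes from the convergence theorem.\<close>
  define A where "A = {p. \<exists>w. w \<bullet> wg.hess p w < 0}"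
  define S where "S = {x 0 |x. descent_curve wg.force x \<and> (\<exists>p\<in>A. (x \<longlongrightarrow> p) at_top)}"
  have "negligible S"
    unfolding S_def
  proof (rule negligible_converging_to_strict_saddle[OF wg.force_Lipschitz])
    fix p assume "p \<in> A"
    then obtain w where "w \<bullet> wg.hess p w < 0" by (auto simp: A_def)
    then show "\<exists>H e. linear H \<and> (\<forall>x y. H x \<bullet> y = x \<bullet> H y) \<and> e \<bullet> H e < 0 \<and>
       (\<forall>\<eta>>0. \<exists>r>0. \<forall>a\<in>ball p r. \<forall>b\<in>ball p r. norm (wg.force a - wg.force b - H (a - b)) \<le> \<eta> * norm (a - b))"
      using wg.linear_hess wg.hess_sym wg.force_strictly_differentiable by blast
  qed
  then have "AE x in lebesgue. x \<notin> S" by (simp add: negligible_iff_null_sets AE_not_in)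
  \<comment> \<open>\<open>negligible\<close> refers to the completed measure; the statement is
    carried back to \<open>lborel\<close>, over which the uniform distribution is defined.\<close>
  then have ae: "AE x in lborel. x \<notin> S" by (simp add: AE_completion_iff)
  have sync: "converges_to_sync \<theta>" if \<theta>: "\<theta> 0 \<notin> S" "kuramoto_trajectory adj \<theta>" for \<theta>
  proof -
    have dc: "descent_curve wg.force \<theta>" using \<theta>(2) traj by simp
    obtain p where p: "(\<theta> \<longlongrightarrow> p) at_top" "wg.force p = 0" using wg.descent_curve_converges[OF dc] by blast
    have "p \<notin> A"
    proof
      assume "p \<in> A"
      then have "\<theta> 0 \<in> S" using dc p(1) unfolding S_def by blast
      then show False using \<theta>(1) by simp
    qed
    then have psd: "0 \<le> w \<bullet> wg.hess p w" for w by (auto simp: A_def not_less)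
    have "cis (p $ u) = cis (p $ v)" for u v
    proof (rule pe.stable_critical_imp_sync)
      fix v
      have "(\<Sum>u\<in>UNIV. adjr adj v u * sin (p $ u - p $ v)) = - (wg.force p $ v)"
        unfolding wg.force_def using sin_minus[of "p $ v - p $ _"] by (simp add: sum_negf[symmetric] del: sum_negf)
      then show "(\<Sum>u\<in>UNIV. adjr adj v u * sin (p $ u - p $ v)) = 0" using p(2) by simp
    next
      fix h :: "'n \<Rightarrow> real"
      have "0 \<le> wg.hess p (\<chi> v. h v) \<bullet> (\<chi> v. h v)" using psd[of "\<chi> v. h v"] by (simp only: inner_commute)
      then show "0 \<le> (\<Sum>u\<in>UNIV. \<Sum>v\<in>UNIV. adjr adj u v * cos (p $ u - p $ v) * (h u - h v)\<^sup>2)"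
        unfolding wg.inner_hess by (simp add: power2_eq_square)
    qed
    then have eq: "cis (p $ v) = cis (p $ undefined)" for v by blast
    have "((\<lambda>t. cis (\<theta> t $ v)) \<longlongrightarrow> cis (p $ undefined)) at_top" for v
    proof -
      have "((\<lambda>t. \<theta> t $ v) \<longlongrightarrow> p $ v) at_top" using p(1) by (rule tendsto_vec_nth)
      then have "((\<lambda>t. cis (\<theta> t $ v)) \<longlongrightarrow> cis (p $ v)) at_top" by (rule tendsto_cis)
      then show ?thesis using eq[of v] by simp
    qed
    then show ?thesis unfolding converges_to_sync_def by blast
  qed
  show ?thesis
    unfolding globally_synchronizing_def
  proof (rule AE_uniform_measureI)
    show "AE x in lborel. x \<in> cbox 0 (\<chi> v. 2 * pi) \<longrightarrow>
      (\<forall>\<theta>. \<theta> 0 = x \<and> kuramoto_trajectory adj \<theta> \<longrightarrow> converges_to_sync \<theta>)"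
      using ae by eventually_elim (use sync in blast)
  qed simp
qed

end
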